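(* For every $\epsilon>0$ there is a positive integer $L=L(\epsilon)$, depending only on $\epsilon$ (not on $\mu$ or $N$) and satisfying $L=\mathcal{O}((\ln\epsilon)^2)$, such that for every $\mu<0$ and every integer $N\ge 1$ the $N$-particle Green's function $\mathcal{G}_\mu=(\mathcal{T}-\mu\mathcal{I})^{-1}$ has a separated representation with $L$ terms and relative error in operator norm bounded by $\epsilon$; that is, there exist one-particle operators $\mathcal{F}^p_i$ ($1\le p\le L$, $1\le i\le N$) with $$\Big\|\mathcal{G}_\mu-\sum_{p=1}^{L}\bigotimes_{i=1}^N\mathcal{F}^p_i\Big\|\le\epsilon\,\|\mathcal{G}_\mu\|.$$
   Context: Each particle has a variable $\gamma=(\mathbf{r},\sigma)$ with $\mathbf{r}\in\mathbb{R}^3$ and spin $\sigma\in\{-\tfrac12,\tfrac12\}$; one-particle functions are in $L^2(\mathbb{R}^3\times\{-\tfrac12,\tfrac12\})$, and $N$-particle functions are in the $L^2$ space of the product of $N$ copies. The $N$-particle kinetic energy operator is $\mathcal{T}=-\frac12\sum_{i=1}^N\Delta_i$, where $\Delta_i$ is the three-dimensional Laplacian in the spatial variable $\mathbf{r}_i$ of particle $i$, and $\mathcal{I}$ is the identity. A separated representation with $L$ terms of an $N$-particle operator is a sum of $L$ operators, each of which is a tensor product of $N$ bounded one-particle operators, the $i$-th acting on the variable $\gamma_i$. $\|\cdot\|$ is the operator norm on $L^2$. The notation $\mathcal{O}((\ln\epsilon)^2)$ is understood as $\epsilon\to0$. *)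

theory Defs
  imports "HOL-Analysis.Analysis" "HOL-Library.Landau_Symbols"
begin

section \<open>Square-integrable functions and bounded operators\<close>

text \<open>
  \<open>L\<^sup>2(M)\<close> is represented by its square-integrable functions, with equality understood
  almost everywhere. An operator acts on representatives; linearity together with
  boundedness makes it compatible with almost-everywhere equality (see \<open>bounded_op_cong_AE\<close>).
\<close>

definition L2 :: "'a measure \<Rightarrow> ('a \<Rightarrow> complex) set" where
  "L2 M = {f \<in> borel_measurable M. integrable M (\<lambda>x. (cmod (f x))\<^sup>2)}"

definition l2norm :: "'a measure \<Rightarrow> ('a \<Rightarrow> complex) \<Rightarrow> real" where
  "l2norm M f = sqrt (LINT x|M. (cmod (f x))\<^sup>2)"

type_synonym 'a operator = "('a \<Rightarrow> complex) \<Rightarrow> ('a \<Rightarrow> complex)"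

definition bounded_op :: "'a measure \<Rightarrow> 'a operator \<Rightarrow> bool" where
  "bounded_op M A \<longleftrightarrow>
     (\<forall>f\<in>L2 M. A f \<in> L2 M) \<and>
     (\<forall>f\<in>L2 M. \<forall>g\<in>L2 M. AE x in M. A (\<lambda>y. f y + g y) x = A f x + A g x) \<and>
     (\<forall>c. \<forall>f\<in>L2 M. AE x in M. A (\<lambda>y. c * f y) x = c * A f x) \<and>
     (\<exists>C. \<forall>f\<in>L2 M. l2norm M (A f) \<le> C * l2norm M f)"

definition op_norm :: "'a measure \<Rightarrow> 'a operator \<Rightarrow> real" where
  "op_norm M A = (SUP f\<in>{f \<in> L2 M. l2norm M f \<le> 1}. l2norm M (A f))"


section \<open>One-particle and N-particle spaces\<close>

text \<open>A particle variable is a pair (position, spin) with spin \<open>-1/2\<close> or \<open>1/2\<close>.\<close>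

type_synonym particle = "(real ^ 3) \<times> real"

type_synonym config = "nat \<Rightarrow> particle"

definition particle_measure :: "particle measure" where
  "particle_measure = lborel \<Otimes>\<^sub>M count_space {- 1 / 2, 1 / 2}"

text \<open>The particles are numbered \<open>0, \<dots>, N - 1\<close>.\<close>

definition config_measure :: "nat \<Rightarrow> config measure" where
  "config_measure N = (\<Pi>\<^sub>M i\<in>{..<N}. particle_measure)"


section \<open>The kinetic energy operator\<close>

definition shift :: "nat \<Rightarrow> 3 \<Rightarrow> real \<Rightarrow> config \<Rightarrow> config" where
  "shift i k h x = x(i := (fst (x i) + h *\<^sub>R axis k 1, snd (x i)))"

definition partial :: "nat \<Rightarrow> 3 \<Rightarrow> (config \<Rightarrow> complex) \<Rightarrow> (config \<Rightarrow> complex)" where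
  "partial i k \<phi> = (\<lambda>x. vector_derivative (\<lambda>h. \<phi> (shift i k h x)) (at 0))"

definition iter_partial :: "(nat \<times> 3) list \<Rightarrow> (config \<Rightarrow> complex) \<Rightarrow> (config \<Rightarrow> complex)" where
  "iter_partial ks \<phi> = foldr (\<lambda>(i, k). partial i k) ks \<phi>"

text \<open>
  Test functions: infinitely differentiable and compactly supported in the spatial variables,
  for each value of the spins. Spins range over a discrete set, so continuity on the
  configuration space imposes no condition relating different spins.
\<close>

definition test_function :: "nat \<Rightarrow> (config \<Rightarrow> complex) \<Rightarrow> bool" where
  "test_function N \<phi> \<longleftrightarrow>
     (\<forall>ks. set ks \<subseteq> {..<N} \<times> UNIV \<longrightarrow>
        continuous_on (space (config_measure N)) (iter_partial ks \<phi>) \<and>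
        (\<forall>x\<in>space (config_measure N). \<forall>i<N. \<forall>k.
           (\<lambda>h. iter_partial ks \<phi> (shift i k h x)) differentiable (at 0))) \<and>
     (\<exists>R. \<forall>x\<in>space (config_measure N). (\<exists>i<N. norm (fst (x i)) > R) \<longrightarrow> \<phi> x = 0)"

definition laplacian :: "nat \<Rightarrow> (config \<Rightarrow> complex) \<Rightarrow> (config \<Rightarrow> complex)" where
  "laplacian i \<phi> = (\<lambda>x. \<Sum>k\<in>UNIV. partial i k (partial i k \<phi>) x)"

definition kinetic_test :: "nat \<Rightarrow> (config \<Rightarrow> complex) \<Rightarrow> (config \<Rightarrow> complex)" where
  "kinetic_test N \<phi> = (\<lambda>x. - (1 / 2) * (\<Sum>i<N. laplacian i \<phi> x))"

text \<open>
  The graph of the unbounded operator \<open>T = - 1/2 \<Sum>\<^sub>i \<Delta>\<^sub>i\<close>: derivatives are taken in the sense of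
  distributions, and the domain consists of all \<open>u\<close> in \<open>L\<^sup>2\<close> with \<open>T u\<close> in \<open>L\<^sup>2\<close> (which is the
  Sobolev space \<open>H\<^sup>2\<close>, the domain of self-adjointness).
\<close>

definition kinetic :: "nat \<Rightarrow> (config \<Rightarrow> complex) \<Rightarrow> (config \<Rightarrow> complex) \<Rightarrow> bool" where
  "kinetic N u v \<longleftrightarrow>
     u \<in> L2 (config_measure N) \<and> v \<in> L2 (config_measure N) \<and>
     (\<forall>\<phi>. test_function N \<phi> \<longrightarrow>
        (LINT x|config_measure N. u x * kinetic_test N \<phi> x) =
        (LINT x|config_measure N. v x * \<phi> x))"

text \<open>
  \<open>G\<close> is the bounded two-sided inverse of \<open>T - \<mu> I\<close>: it inverts from the right on all of \<open>L\<^sup>2\<close>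
  and from the left on the domain of \<open>T\<close>. Such \<open>G\<close> is unique (see \<open>greens_function_unique\<close>).
\<close>

definition greens_function :: "nat \<Rightarrow> real \<Rightarrow> config operator \<Rightarrow> bool" where
  "greens_function N \<mu> G \<longleftrightarrow>
     bounded_op (config_measure N) G \<and>
     (\<forall>f\<in>L2 (config_measure N). \<exists>v. kinetic N (G f) v \<and>
        (AE x in config_measure N. v x - complex_of_real \<mu> * G f x = f x)) \<and>
     (\<forall>u v. kinetic N u v \<longrightarrow>
        (AE x in config_measure N. G (\<lambda>y. v y - complex_of_real \<mu> * u y) x = u x))"


section \<open>Separated representations\<close>

text \<open>
  The tensor product of bounded one-particle operators is the bounded operator with the
  prescribed action on product functions; it is unique because these span a dense subspace.
\<close>

definition tensor_product :: "nat \<Rightarrow> (nat \<Rightarrow> particle operator) \<Rightarrow> config operator \<Rightarrow> bool" where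
  "tensor_product N F B \<longleftrightarrow>
     (\<forall>i<N. bounded_op particle_measure (F i)) \<and>
     bounded_op (config_measure N) B \<and>
     (\<forall>f. (\<forall>i<N. f i \<in> L2 particle_measure) \<longrightarrow>
        (AE x in config_measure N.
           B (\<lambda>y. \<Prod>i<N. f i (y i)) x = (\<Prod>i<N. F i (f i) (x i))))"

definition separated_representation ::
    "nat \<Rightarrow> nat \<Rightarrow> (nat \<Rightarrow> nat \<Rightarrow> particle operator) \<Rightarrow> config operator \<Rightarrow> bool" where
  "separated_representation N L F S \<longleftrightarrow>
     (\<exists>B. (\<forall>p<L. tensor_product N (F p) (B p)) \<and> S = (\<lambda>f x. \<Sum>p<L. B p f x))"


section \<open>Well-definedness\<close>

lemma L2_diff:
  assumes "f \<in> L2 M" "g \<in> L2 M"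
  shows "(\<lambda>x. f x - g x) \<in> L2 M"
proof -
  have m: "f \<in> borel_measurable M" "g \<in> borel_measurable M"
    and i: "integrable M (\<lambda>x. 2 * (cmod (f x))\<^sup>2 + 2 * (cmod (g x))\<^sup>2)"
    using assms by (auto simp: L2_def)
  have "(cmod (f x - g x))\<^sup>2 \<le> 2 * (cmod (f x))\<^sup>2 + 2 * (cmod (g x))\<^sup>2" for x
  proof -
    have "(cmod (f x - g x))\<^sup>2 \<le> (cmod (f x) + cmod (g x))\<^sup>2"
      by (intro power_mono norm_triangle_ineq4) auto
    also have "\<dots> \<le> 2 * (cmod (f x))\<^sup>2 + 2 * (cmod (g x))\<^sup>2"
      using sum_squares_bound[of "cmod (f x)" "cmod (g x)"] unfolding power2_sum by linarith
    finally show ?thesis .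
  qed
  then have "integrable M (\<lambda>x. (cmod (f x - g x))\<^sup>2)"
    using m by (intro Bochner_Integration.integrable_bound[OF i] AE_I2) (simp_all add: abs_of_nonneg)
  then show ?thesis
    using m by (simp add: L2_def)
qed

lemma bounded_op_cong_AE:
  assumes A: "bounded_op M A" and f: "f \<in> L2 M" and g: "g \<in> L2 M"
    and eq: "AE x in M. f x = g x"
  shows "AE x in M. A f x = A g x"
proof -
  define d where "d = (\<lambda>x. f x - g x)"
  have d: "d \<in> L2 M"
    unfolding d_def using f g by (rule L2_diff)
  have "(LINT x|M. (cmod (d x))\<^sup>2) = (LINT x|M. 0)"
  proof (rule integral_cong_AE)
    show "(\<lambda>x. (cmod (d x))\<^sup>2) \<in> borel_measurable M"
      using d unfolding L2_def by blast
    show "AE x in M. (cmod (d x))\<^sup>2 = 0"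
      using eq by eventually_elim (simp add: d_def)
  qed simp
  then have "l2norm M d = 0"
    by (simp add: l2norm_def)
  moreover obtain C where "\<forall>f\<in>L2 M. l2norm M (A f) \<le> C * l2norm M f"
    using A unfolding bounded_op_def by blast
  ultimately have n: "l2norm M (A d) \<le> 0"
    using d by fastforce
  have Ad: "A d \<in> L2 M"
    using A d by (simp add: bounded_op_def)
  have "(LINT x|M. (cmod (A d x))\<^sup>2) \<le> 0"
    using n by (simp add: l2norm_def)
  moreover have "0 \<le> (LINT x|M. (cmod (A d x))\<^sup>2)"
    by simp
  ultimately have "(LINT x|M. (cmod (A d x))\<^sup>2) = 0"
    by linarith
  then have z: "AE x in M. A d x = 0"
    using Ad integral_nonneg_eq_0_iff_AE[of M "\<lambda>x. (cmod (A d x))\<^sup>2"] by (simp add: L2_def)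
  have "AE x in M. A (\<lambda>y. g y + d y) x = A g x + A d x"
    using A g d by (simp add: bounded_op_def)
  moreover have "(\<lambda>y. g y + d y) = f"
    by (simp add: d_def)
  ultimately have "AE x in M. A f x = A g x + A d x"
    by simp
  with z show ?thesis
    by eventually_elim simp
qed

lemma greens_function_unique:
  assumes G: "greens_function N \<mu> G" and H: "greens_function N \<mu> H"
    and f: "f \<in> L2 (config_measure N)"
  shows "AE x in config_measure N. G f x = H f x"
proof -
  obtain v where v: "kinetic N (G f) v"
    and eq: "AE x in config_measure N. v x - complex_of_real \<mu> * G f x = f x"
    using G f unfolding greens_function_def by blast
  have "(\<lambda>y. v y - complex_of_real \<mu> * G f y) \<in> L2 (config_measure N)"
  proof (rule L2_diff)
    show "v \<in> L2 (config_measure N)"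
      using v by (simp add: kinetic_def)
    show "(\<lambda>y. complex_of_real \<mu> * G f y) \<in> L2 (config_measure N)"
      using v by (auto simp: kinetic_def L2_def norm_mult power_mult_distrib)
  qed
  then have "AE x in config_measure N. H (\<lambda>y. v y - complex_of_real \<mu> * G f y) x = H f x"
    using H f eq unfolding greens_function_def by (blast intro: bounded_op_cong_AE)
  moreover have "AE x in config_measure N. H (\<lambda>y. v y - complex_of_real \<mu> * G f y) x = G f x"
    using H v unfolding greens_function_def by blast
  ultimately show ?thesis
    by eventually_elim simp
qed

end

theory Submission
  imports Defs "HOL-Probability.Characteristic_Functions"
begin

text \<open>
  By scaling, \<open>1 / (\<lambda> - \<mu>)\<close> for \<open>\<lambda> \<ge> 0\<close> is \<open>1 / (- \<mu>)\<close> times \<open>1 / z\<close> for \<open>z \<ge> 1\<close>, and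
  \<open>1 / z = \<integral> exp (- t z) dt\<close> over \<open>t > 0\<close>. Cutting \<open>[\<delta>, R]\<close> into \<open>O(ln (1/\<epsilon>))\<close> intervals \<open>[a, 3a/2]\<close> and
  interpolating \<open>t \<mapsto> exp (- t z)\<close> in \<open>O(ln (1/\<epsilon>))\<close> nodes on each gives an exponential sum with error
  \<open>\<epsilon>\<close> uniformly in \<open>z \<ge> 1\<close>, because \<open>(a z)\<^sup>n exp (- a z) \<le> n!\<close>. Substituting the kinetic energy \<open>T\<close> for \<open>\<lambda>\<close> turns each exponential
  into a multiple of the heat operator \<open>exp (- t T)\<close>, which is a tensor product since its kernel
  is a product of Gaussians.

  The operator norm of the error is bounded by the sup norm of the scalar error without the
  spectral theorem: by the Fourier representation of the Gaussian, \<open>\<langle>exp (- t T) f, g\<rangle>\<close> for \<open>t > 0\<close>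
  and integrable \<open>f, g\<close> is the integral of \<open>exp (- t \<Lambda>)\<close> against the product of the transforms of
  \<open>f\<close> and \<open>g\<close>, and letting \<open>t \<rightarrow> 0\<close> gives Bessel's inequality for the transform.

  The Green's function is \<open>\<integral> exp (\<mu> t) exp (- t T) dt\<close>. It inverts \<open>T - \<mu>\<close> from the left because the distributional
  equation \<open>T u = v\<close> may be tested on cut-off Gaussians, so that \<open>exp (\<mu> t) exp (- t T) u\<close> has derivative
  \<open>- exp (\<mu> t) exp (- t T) (v - \<mu> u)\<close>; it inverts from the right by duality.
\<close>

section \<open>Exponential sums for 1/z\<close>

text \<open>Uniformity in N and \<mu> comes from the spectrum: the scaled symbol (\<Lambda> - \<mu>)
  / - \<mu> has its values in [1, \<infinity>) for every N, so one scalar approximation serves all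
  cases. The error is relative, so the norm of the Green's function must be bounded from below. Half
  of its size 1 / - \<mu> is enough and comes from explicit test functions; the lost factor 2 is
  repaid by a scalar error of \<epsilon> / 2.

  The transform is an absolutely convergent integral for integrable functions only, while the claims
  concern all of L2. Estimates are therefore proved for functions that are both integrable and
  square-integrable, and extended by truncation to sets of finite measure.

  The inversion of T - \<mu> is weak as well. Convergence of the heat flow to the identity at t = 0
  is established in norm for indicators of open sets of finite measure, and the identity G (T -
  \<mu>) u = u is tested against exactly these, which suffice to detect that an L2 function is zero
  almost everywhere.\<close>

lemma zeros_of_derivative:
  fixes f f' :: "real \<Rightarrow> real"
  assumes "\<And>x. (f has_real_derivative f' x) (at x)"
    and "finite Z" "card Z = Suc n" "Z \<subseteq> {a..b}" "\<And>z. z \<in> Z \<Longrightarrow> f z = 0"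
  shows "\<exists>Z'. finite Z' \<and> card Z' = n \<and> Z' \<subseteq> {a..b} \<and> (\<forall>z\<in>Z'. f' z = 0)"
  using assms(2-5)
proof (induction n arbitrary: Z b)
  case 0
  then show ?case by (intro exI[of _ "{}"]) auto
next
  case (Suc n)
  \<comment> \<open>Rolle's theorem is applied between the two largest zeros \<open>Max Y\<close>
    and \<open>m\<close>. The induction hypothesis is used with right endpoint \<open>Max Y\<close>,
    so the zeros it yields lie at or below that point and the new one is distinct from them.\<close>
  define m where "m = Max Z"
  define Y where "Y = Z - {m}"
  have Zne: "Z \<noteq> {}" using Suc.prems by auto
  have mZ: "m \<in> Z" unfolding m_def using Suc.prems(1) Zne by (rule Max_in)
  have Y: "finite Y" "card Y = Suc n" using Suc.prems mZ by (auto simp: Y_def)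
  then have Yne: "Y \<noteq> {}" by auto
  have MY: "Max Y \<in> Y" using Y Yne by (intro Max_in)
  have "x \<in> {a..Max Y}" if "x \<in> Y" for x
    using that Y Suc.prems(3) Max_ge[OF Y(1) that] by (auto simp: Y_def)
  then have "Y \<subseteq> {a..Max Y}" by blast
  then obtain Z' where Z': "finite Z'" "card Z' = n" "Z' \<subseteq> {a..Max Y}" "\<forall>z\<in>Z'. f' z = 0"
    using Suc.IH[of Y "Max Y"] Y Suc.prems(4) by (auto simp: Y_def)
  have lt: "Max Y < m"
    using MY Suc.prems(1) by (auto simp: Y_def m_def less_le intro: Max_ge)
  have "\<exists>\<xi>>Max Y. \<xi> < m \<and> (f has_real_derivative 0) (at \<xi>)"
  proof (rule Rolle[OF lt])
    show "f (Max Y) = f m" using MY mZ Suc.prems(4) by (auto simp: Y_def)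
    show "continuous_on {Max Y..m} f"
      using assms(1) by (meson DERIV_isCont continuous_at_imp_continuous_on)
    show "f differentiable at x" for x
      using assms(1) real_differentiable_def by blast
  qed
  then obtain \<xi> where \<xi>: "Max Y < \<xi>" "\<xi> < m" "f' \<xi> = 0"
    using assms(1) DERIV_unique by blast
  have "Max Y \<in> {a..b}" "m \<in> {a..b}" using Suc.prems(3) MY mZ by (auto simp: Y_def)
  then have "insert \<xi> Z' \<subseteq> {a..b}" using \<xi> Z'(3) by fastforce
  moreover have "\<xi> \<notin> Z'" using Z'(3) \<xi> by auto
  ultimately show ?case
    using Z' \<xi> by (intro exI[of _ "insert \<xi> Z'"]) auto
qed

text \<open>The successive derivatives are given as a family \<open>F\<close>, so a shift of the
  index plays the part of differentiation in the induction.\<close>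

lemma zero_of_iterated_derivative:
  fixes F :: "nat \<Rightarrow> real \<Rightarrow> real"
  assumes "\<And>i x. (F i has_real_derivative F (Suc i) x) (at x)"
    and "finite Z" "card Z = Suc n" "Z \<subseteq> {a..b}" "\<And>z. z \<in> Z \<Longrightarrow> F 0 z = 0"
  shows "\<exists>\<xi>\<in>{a..b}. F n \<xi> = 0"
  using assms
proof (induction n arbitrary: F Z)
  case 0
  then obtain z where "Z = {z}" by (auto simp: card_Suc_eq)
  with 0 show ?case by auto
next
  case (Suc n)
  obtain Z' where "finite Z'" "card Z' = Suc n" "Z' \<subseteq> {a..b}" "\<forall>z\<in>Z'. F (Suc 0) z = 0"
    using zeros_of_derivative[OF Suc.prems(1) Suc.prems(2-5)] by blast
  then show ?case
    using Suc.IH[of "\<lambda>i. F (Suc i)" Z'] Suc.prems(1) by auto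
qed

lemma higher_pderiv_eq_0:
  fixes p :: "real poly"
  assumes "degree p < n"
  shows "(pderiv ^^ n) p = 0"
  using assms by (intro poly_eqI) (simp add: coeff_higher_pderiv coeff_eq_0)

lemma higher_pderiv_monic:
  fixes p :: "real poly"
  assumes "degree p = n" "lead_coeff p = 1"
  shows "(pderiv ^^ n) p = [:fact n:]"
proof (rule poly_eqI)
  fix i
  show "coeff ((pderiv ^^ n) p) i = coeff [:fact n:] i"
    using assms by (cases i) (simp_all add: coeff_higher_pderiv coeff_eq_0 pochhammer_fact[symmetric])
qed

text \<open>The remainder formula of Lagrange interpolation. A multiple \<open>c\<close> of the
  nodal polynomial \<open>W\<close> is added to \<open>p\<close> to make the error vanish at
  \<open>t\<close> as well. With n + 1 zeros, the n-th derivative of the error vanishes somewhere,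
  and since \<open>W\<close> is monic of degree n this expresses \<open>c\<close> by the n-th
  derivative of the exponential divided by n!.\<close>

lemma exp_interpolation_error:
  fixes z :: real
  assumes z: "0 \<le> z" and T: "finite T" "card T = n" "T \<subseteq> {a..b}" and t: "t \<in> {a..b}"
    and p: "degree p < n" "\<And>\<tau>. \<tau> \<in> T \<Longrightarrow> poly p \<tau> = exp (- (z * \<tau>))"
  shows "\<bar>exp (- (z * t)) - poly p t\<bar> \<le> z ^ n * exp (- (z * a)) / fact n * (b - a) ^ n"
proof (cases "t \<in> T")
  case True
  then show ?thesis using p z t by simp
next
  case False
  define W where "W = (\<Prod>\<tau>\<in>T. [:- \<tau>, 1:] :: real poly)"
  define c where "c = (exp (- (z * t)) - poly p t) / poly W t"
  define q where "q = p + smult c W"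
  define F where "F = (\<lambda>i s. (- z) ^ i * exp (- (z * s)) - poly ((pderiv ^^ i) q) s)"
  have Wt: "poly W t = (\<Prod>\<tau>\<in>T. t - \<tau>)" for t
    by (simp add: W_def poly_prod)
  have Wt0: "poly W t \<noteq> 0" using False T by (auto simp: Wt)
  have dW: "degree W = n" unfolding W_def using T by (subst degree_prod_eq_sum_degree) auto
  have lW: "lead_coeff W = 1" unfolding W_def by (simp add: lead_coeff_prod)
  have "\<exists>\<xi>\<in>{a..b}. F n \<xi> = 0"
  proof (rule zero_of_iterated_derivative)
    show "(F i has_real_derivative F (Suc i) x) (at x)" for i x
      unfolding F_def by (auto intro!: derivative_eq_intros poly_DERIV simp: algebra_simps)
    show "finite (insert t T)" "card (insert t T) = Suc n" "insert t T \<subseteq> {a..b}"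
      using T t False by auto
    show "F 0 s = 0" if "s \<in> insert t T" for s
    proof (cases "s = t")
      case True
      then show ?thesis using Wt0 by (simp add: F_def q_def c_def)
    next
      case False
      then have "poly W s = 0" using that T by (auto simp: Wt)
      then show ?thesis using that False p by (simp add: F_def q_def)
    qed
  qed
  then obtain \<xi> where \<xi>: "a \<le> \<xi>" "F n \<xi> = 0" by auto
  have "(pderiv ^^ n) q = smult c [:fact n:]"
    unfolding q_def higher_pderiv_add higher_pderiv_smult
    using higher_pderiv_eq_0[OF p(1)] higher_pderiv_monic[OF dW lW] by simp
  then have "(- z) ^ n * exp (- (z * \<xi>)) = c * fact n" using \<xi> by (simp add: F_def)
  then have "\<bar>c\<bar> * fact n = \<bar>(- z) ^ n * exp (- (z * \<xi>))\<bar>" by (simp add: abs_mult)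
  also have "\<dots> = z ^ n * exp (- (z * \<xi>))" using z by (simp add: abs_mult power_abs)
  also have "\<dots> \<le> z ^ n * exp (- (z * a))" using z \<xi> by (intro mult_left_mono) (auto simp: mult_left_mono)
  finally have c: "\<bar>c\<bar> \<le> z ^ n * exp (- (z * a)) / fact n" by (simp add: field_simps)
  have "\<bar>poly W t\<bar> \<le> (\<Prod>\<tau>\<in>T. b - a)"
    unfolding Wt abs_prod using T t by (intro prod_mono) (fastforce simp: abs_le_iff)
  then have W: "\<bar>poly W t\<bar> \<le> (b - a) ^ n" using T by simp
  have "\<bar>exp (- (z * t)) - poly p t\<bar> = \<bar>c\<bar> * \<bar>poly W t\<bar>"
    using Wt0 by (simp add: c_def)
  also have "\<dots> \<le> z ^ n * exp (- (z * a)) / fact n * (b - a) ^ n"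
    using c W z by (intro mult_mono) auto
  finally show ?thesis .
qed

lemma power_le_fact_exp:
  fixes x :: real
  assumes "0 \<le> x"
  shows "x ^ n \<le> fact n * exp x"
proof -
  have "x ^ n / fact n \<le> (\<Sum>k. x ^ k / fact k)"
    using sum_le_suminf[of "\<lambda>k. x ^ k / fact k" "{n}"] summable_exp_generic[of x] assms
    by (simp add: scaleR_conv_of_real field_simps)
  also have "\<dots> = exp x" by (simp add: exp_def scaleR_conv_of_real field_simps)
  finally show ?thesis by (simp add: field_simps)
qed

text \<open>The weights are integrals of the Lagrange polynomials \<open>l j\<close> and hence
  independent of z. Any distinct nodes in [a, b] would serve, since the remainder estimate uses no
  more than that. Apart from the factor b - a, the length enters only through its ratio to a, which
  is why the intervals may grow geometrically.\<close>

lemma exp_quadrature: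
  fixes a b \<theta> :: real
  assumes a: "0 < a" "a < b" "b - a \<le> \<theta> * a" and n: "0 < n"
  shows "\<exists>w \<tau>. (\<forall>j<n. a \<le> \<tau> j) \<and>
    (\<forall>z>0. \<bar>(exp (- (z * a)) - exp (- (z * b))) / z - (\<Sum>j<n. w j * exp (- (z * \<tau> j)))\<bar> \<le> (b - a) * \<theta> ^ n)"
proof -
  define \<tau> where "\<tau> = (\<lambda>j::nat. a + (b - a) * real j / real n)"
  define l where "l = (\<lambda>j. \<Prod>i\<in>{..<n}-{j}. smult (1 / (\<tau> j - \<tau> i)) [:- \<tau> i, 1:])"
  define w where "w = (\<lambda>j. integral {a..b} (poly (l j)))"
  have inj: "inj_on \<tau> {..<n}" using a n by (auto simp: inj_on_def \<tau>_def)
  have lag: "poly (l j) (\<tau> i) = (if i = j then 1 else 0)" if "i < n" "j < n" for i j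
  proof (cases "i = j")
    case True
    have "poly (smult (1 / (\<tau> j - \<tau> k)) [:- \<tau> k, 1:]) (\<tau> j) = 1" if "k \<in> {..<n} - {j}" for k
    proof -
      have "\<tau> j \<noteq> \<tau> k" using that \<open>j < n\<close> inj by (auto dest: inj_onD)
      then show ?thesis by (simp add: diff_divide_distrib[symmetric])
    qed
    then show ?thesis unfolding l_def poly_prod using True by (subst prod.neutral) auto
  next
    case False
    then show ?thesis using that by (auto simp: l_def poly_prod intro!: prod_zero bexI[of _ i])
  qed
  have deg: "degree (l j) < n" if "j < n" for j
  proof -
    have "degree (l j) \<le> (\<Sum>i\<in>{..<n}-{j}. degree (smult (1 / (\<tau> j - \<tau> i)) [:- \<tau> i, 1:]))"
      unfolding l_def
      using degree_prod_sum_le[of "{..<n}-{j}" "\<lambda>i. smult (1 / (\<tau> j - \<tau> i)) [:- \<tau> i, 1:]"]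
      by (simp only: comp_def finite_Diff finite_lessThan)
    also have "\<dots> \<le> (\<Sum>i\<in>{..<n}-{j}. 1)"
      by (intro sum_mono) (auto intro: order.trans[OF degree_smult_le])
    also have "\<dots> < n" using that by simp
    finally show ?thesis .
  qed
  have \<tau>: "a \<le> \<tau> j" "\<tau> j \<le> b" if "j < n" for j
  proof -
    show "a \<le> \<tau> j" using a by (simp add: \<tau>_def)
    have "(b - a) * (real j / real n) \<le> (b - a) * 1" using that a by (intro mult_left_mono) auto
    then show "\<tau> j \<le> b" by (simp add: \<tau>_def)
  qed
  have "\<bar>(exp (- (z * a)) - exp (- (z * b))) / z - (\<Sum>j<n. w j * exp (- (z * \<tau> j)))\<bar> \<le> (b - a) * \<theta> ^ n"
    if z: "0 < z" for z
  proof -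
    define p where "p = (\<Sum>j<n. smult (exp (- (z * \<tau> j))) (l j))"
    have dp: "degree p < n"
      unfolding p_def using deg n
      by (intro degree_sum_less) (auto intro: le_less_trans[OF degree_smult_le])
    have pv: "poly p s = exp (- (z * s))" if s: "s \<in> \<tau> ` {..<n}" for s
    proof -
      obtain i where i: "i < n" "s = \<tau> i" using s by auto
      have "poly p s = (\<Sum>j<n. exp (- (z * \<tau> j)) * (if i = j then 1 else 0))"
        unfolding p_def i poly_sum poly_smult using lag i by (intro sum.cong) auto
      then show ?thesis using i by (simp add: if_distrib sum.delta cong: if_cong)
    qed
    have bound: "\<bar>exp (- (z * s)) - poly p s\<bar> \<le> \<theta> ^ n" if "s \<in> {a..b}" for s
    proof -
      have "\<bar>exp (- (z * s)) - poly p s\<bar> \<le> z ^ n * exp (- (z * a)) / fact n * (b - a) ^ n"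
        by (rule exp_interpolation_error[of z "\<tau> ` {..<n}"]) (use z \<tau> that pv dp inj in \<open>auto simp: card_image\<close>)
      also have "\<dots> \<le> z ^ n * exp (- (z * a)) / fact n * (\<theta> * a) ^ n"
        using z a by (intro mult_left_mono power_mono) auto
      also have "\<dots> = (z * a) ^ n * exp (- (z * a)) / fact n * \<theta> ^ n"
        by (simp add: power_mult_distrib)
      also have "\<dots> \<le> 1 * \<theta> ^ n"
      proof (rule mult_right_mono)
        have "0 \<le> \<theta>" using a by (smt (verit) zero_less_mult_pos2)
        then show "0 \<le> \<theta> ^ n" by simp
        show "(z * a) ^ n * exp (- (z * a)) / fact n \<le> 1"
          using power_le_fact_exp[of "z * a" n] z a by (simp add: exp_minus field_simps)
      qed
      finally show ?thesis by simp
    qed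
    have e: "((\<lambda>s. exp (- (z * s))) has_integral (- exp (- (z * b)) / z - (- exp (- (z * a)) / z))) {a..b}"
      using a z
      by (intro fundamental_theorem_of_calculus)
         (auto intro!: derivative_eq_intros simp flip: has_real_derivative_iff_has_vector_derivative)
    have pc: "poly q integrable_on {a..b}" for q :: "real poly"
      by (intro integrable_continuous_real continuous_intros)
    have "integral {a..b} (poly p) = (\<Sum>j<n. integral {a..b} (\<lambda>s. exp (- (z * \<tau> j)) * poly (l j) s))"
      unfolding p_def poly_sum poly_smult
      by (intro integral_sum integrable_on_cmult_left) (auto intro: pc)
    also have "\<dots> = (\<Sum>j<n. w j * exp (- (z * \<tau> j)))"
      by (simp add: w_def mult.commute)
    finally have ip: "(poly p has_integral (\<Sum>j<n. w j * exp (- (z * \<tau> j)))) {a..b}"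
      using pc[of p] by (metis integrable_integral)
    have "norm ((- exp (- (z * b)) / z - (- exp (- (z * a)) / z)) - (\<Sum>j<n. w j * exp (- (z * \<tau> j))))
        \<le> \<theta> ^ n * measure lborel (cbox a b)"
    proof (rule has_integral_bound)
      show "0 \<le> \<theta> ^ n" using bound[of a] a by force
      show "((\<lambda>s. exp (- (z * s)) - poly p s) has_integral
          (- exp (- (z * b)) / z - (- exp (- (z * a)) / z)) - (\<Sum>j<n. w j * exp (- (z * \<tau> j)))) (cbox a b)"
        using has_integral_diff[OF e ip] by simp
    qed (use bound in auto)
    then show ?thesis using a by (simp add: algebra_simps diff_divide_distrib)
  qed
  then show ?thesis using \<tau> by blast
qed

text \<open>Every interval [a, 3a/2] has ratio \<theta> = 1/2. The error of each piece is
  proportional to its length, so the errors add up to a multiple of the total length.\<close>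

lemma exp_quadrature_composite:
  fixes \<delta> :: real
  assumes \<delta>: "0 < \<delta>" and n: "0 < n"
  shows "\<exists>w \<tau>. (\<forall>j<J * n. 0 < \<tau> j) \<and>
    (\<forall>z>0. \<bar>(exp (- (z * \<delta>)) - exp (- (z * (\<delta> * (3/2) ^ J)))) / z - (\<Sum>j<J * n. w j * exp (- (z * \<tau> j)))\<bar>
      \<le> (\<delta> * (3/2) ^ J - \<delta>) * (1/2) ^ n)"
proof (induction J)
  case 0
  then show ?case by simp
next
  case (Suc J)
  define a where "a = \<delta> * (3/2) ^ J"
  define b where "b = \<delta> * (3/2) ^ Suc J"
  have a: "0 < a" "a < b" "b - a \<le> 1/2 * a" using \<delta> by (auto simp: a_def b_def)
  obtain w \<tau> where 1: "\<forall>j<J * n. 0 < \<tau> j"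
    "\<And>z. z > 0 \<Longrightarrow> \<bar>(exp (- (z * \<delta>)) - exp (- (z * a))) / z - (\<Sum>j<J * n. w j * exp (- (z * \<tau> j)))\<bar>
      \<le> (a - \<delta>) * (1/2) ^ n"
    using Suc.IH unfolding a_def by blast
  obtain w' \<tau>' where 2: "\<forall>j<n. a \<le> \<tau>' j"
    "\<And>z. z > 0 \<Longrightarrow> \<bar>(exp (- (z * a)) - exp (- (z * b))) / z - (\<Sum>j<n. w' j * exp (- (z * \<tau>' j)))\<bar>
      \<le> (b - a) * (1/2) ^ n"
    using exp_quadrature[OF a n] by blast
  define W where "W = (\<lambda>j. if j < J * n then w j else w' (j - J * n))"
  define S where "S = (\<lambda>j. if j < J * n then \<tau> j else \<tau>' (j - J * n))"
  have sum: "(\<Sum>j<Suc J * n. W j * exp (- (z * S j))) =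
      (\<Sum>j<J * n. w j * exp (- (z * \<tau> j))) + (\<Sum>j<n. w' j * exp (- (z * \<tau>' j)))" for z
  proof -
    have "{..<Suc J * n} = {..<J * n} \<union> (\<lambda>j. j + J * n) ` {..<n}"
    proof (intro set_eqI iffI)
      fix x assume "x \<in> {..<Suc J * n}"
      then show "x \<in> {..<J * n} \<union> (\<lambda>j. j + J * n) ` {..<n}"
        by (cases "x < J * n") (auto simp: image_iff intro!: bexI[of _ "x - J * n"])
    qed auto
    then have "(\<Sum>j<Suc J * n. W j * exp (- (z * S j))) =
        (\<Sum>j<J * n. W j * exp (- (z * S j))) + (\<Sum>j\<in>(\<lambda>j. j + J * n) ` {..<n}. W j * exp (- (z * S j)))"
      by (simp only:) (rule sum.union_disjoint, auto)
    also have "(\<Sum>j\<in>(\<lambda>j. j + J * n) ` {..<n}. W j * exp (- (z * S j))) = (\<Sum>j<n. w' j * exp (- (z * \<tau>' j)))"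
      by (subst sum.reindex) (auto simp: W_def S_def inj_on_def)
    finally show ?thesis by (simp add: W_def S_def)
  qed
  have "0 < S j" if "j < Suc J * n" for j
  proof (cases "j < J * n")
    case True
    then show ?thesis using 1 by (simp add: S_def)
  next
    case False
    then have "a \<le> \<tau>' (j - J * n)" using that by (intro 2(1)[rule_format]) auto
    then show ?thesis using a False by (simp add: S_def)
  qed
  moreover have "\<bar>(exp (- (z * \<delta>)) - exp (- (z * b))) / z - (\<Sum>j<Suc J * n. W j * exp (- (z * S j)))\<bar>
      \<le> (b - \<delta>) * (1/2) ^ n" if "z > 0" for z
  proof -
    have "(b - \<delta>) * (1/2) ^ n = (b - a) * (1/2) ^ n + (a - \<delta>) * (1/2) ^ n" by (simp add: algebra_simps)
    moreover have "(exp (- (z * \<delta>)) - exp (- (z * b))) / z =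
        (exp (- (z * \<delta>)) - exp (- (z * a))) / z + (exp (- (z * a)) - exp (- (z * b))) / z"
      by (simp add: diff_divide_distrib)
    ultimately show ?thesis using 1(2)[OF that] 2(2)[OF that] sum[of z] by linarith
  qed
  ultimately show ?case unfolding b_def by blast
qed

text \<open>The integral over \<open>[0, \<delta>]\<close>, the quadrature on \<open>[\<delta>, \<delta> (3/2)\<^sup>J]\<close> with \<open>n\<close> nodes per interval, and
  the tail each cost at most \<open>\<delta> = 1/2\<^bsup>m + 2\<^esup>\<close> when \<open>J = 4 (m + 2)\<close> and \<open>n = 5 (m + 2)\<close>.\<close>

lemma inverse_exp_sum:
  fixes m :: nat
  shows "\<exists>w \<tau>. (\<forall>j<20 * (m + 2)\<^sup>2. 0 < \<tau> j) \<and>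
    (\<forall>z\<ge>1::real. \<bar>1 / z - (\<Sum>j<20 * (m + 2)\<^sup>2. w j * exp (- (z * \<tau> j)))\<bar> \<le> (1/2) ^ m)"
proof -
  define \<delta> :: real where "\<delta> = (1/2) ^ (m + 2)"
  define J where "J = 4 * (m + 2)"
  define n where "n = 5 * (m + 2)"
  define b where "b = \<delta> * (3/2) ^ J"
  have Jn: "J * n = 20 * (m + 2)\<^sup>2" by (simp add: J_def n_def power2_eq_square algebra_simps)
  obtain w \<tau> where 1: "\<forall>j<J * n. 0 < \<tau> j"
    "\<And>z. z > 0 \<Longrightarrow> \<bar>(exp (- (z * \<delta>)) - exp (- (z * b))) / z - (\<Sum>j<J * n. w j * exp (- (z * \<tau> j)))\<bar>
      \<le> (b - \<delta>) * (1/2) ^ n"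
    using exp_quadrature_composite[of \<delta> n J] unfolding b_def by (auto simp: \<delta>_def n_def)
  \<comment> \<open>Since (3/2)^2 = 9/4 exceeds 2, the J = 4 (m + 2) factors 3/2 carry \<delta>
    beyond 1 / \<delta> = 2^(m + 2), far enough for the tail exp (- b) to fall below
    \<delta>.\<close>
  have "(2::real) ^ (2 * (m + 2)) \<le> (9/4) ^ (2 * (m + 2))" by (intro power_mono) auto
  also have "\<dots> = (3/2) ^ J"
  proof -
    have "J = 2 * (2 * (m + 2))" by (simp add: J_def)
    then show ?thesis by (simp only: power_mult) (simp add: power2_eq_square)
  qed
  finally have "\<delta> * 2 ^ (2 * (m + 2)) \<le> b" unfolding b_def by (simp add: \<delta>_def)
  moreover have "\<delta> * 2 ^ (2 * (m + 2)) = 2 ^ (m + 2)"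
    by (simp only: \<delta>_def mult_2 power_add[of _ "m + 2" "m + 2"] power_one_over) simp
  ultimately have b1: "2 ^ (m + 2) \<le> b" by simp
  \<comment> \<open>The crude growth bound 2^J = 16^(m + 2) is beaten by (1/2)^n = (1/32)^(m + 2),
    which leaves a factor \<delta> to spare.\<close>
  have "(3/2::real) ^ J \<le> 2 ^ J" by (intro power_mono) auto
  then have "b \<le> \<delta> * 2 ^ J" by (simp add: b_def \<delta>_def)
  then have "b * (1/2) ^ n \<le> \<delta> * 2 ^ J * (1/2) ^ n" by (intro mult_right_mono) auto
  also have "\<delta> * 2 ^ J * (1/2) ^ n = (1/2) ^ (m + 2) * (2 ^ 4 * (1/2) ^ 5) ^ (m + 2)"
    unfolding J_def n_def \<delta>_def by (simp only: power_mult power_mult_distrib mult.assoc)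
  also have "\<dots> = \<delta> * \<delta>" by (simp add: \<delta>_def power_divide)
  also have "\<dots> \<le> \<delta> * 1" unfolding \<delta>_def by (intro mult_left_mono power_le_one) auto
  finally have b2: "b * (1/2) ^ n \<le> \<delta>" by simp
  have "\<bar>1 / z - (\<Sum>j<J * n. w j * exp (- (z * \<tau> j)))\<bar> \<le> (1/2) ^ m" if z: "1 \<le> z" for z
  proof -
    have "0 \<le> 1 - exp (- (z * \<delta>))" using z by (simp add: \<delta>_def)
    moreover have "1 - exp (- (z * \<delta>)) \<le> z * \<delta>" using exp_ge_add_one_self[of "- (z * \<delta>)"] by linarith
    ultimately have e1: "0 \<le> (1 - exp (- (z * \<delta>))) / z" "(1 - exp (- (z * \<delta>))) / z \<le> \<delta>"
      using z by (auto simp: field_simps)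
    have b0: "0 < b" using b1 by (smt (verit) zero_less_power)
    have "exp (- (z * b)) / z \<le> exp (- b)"
      using z b0 by (smt (verit) divide_le_eq_1 exp_gt_zero exp_le_cancel_iff frac_le mult_le_cancel_right1 div_by_1)
    also have "\<dots> \<le> 1 / 2 ^ (m + 2)"
    proof -
      have "2 ^ (m + 2) \<le> exp b" using exp_ge_add_one_self[of b] b1 by linarith
      then show ?thesis by (simp add: exp_minus field_simps)
    qed
    finally have e2: "exp (- (z * b)) / z \<le> \<delta>" by (simp add: \<delta>_def power_divide)
    have e2': "0 \<le> exp (- (z * b)) / z" using z by simp
    have "(b - \<delta>) * (1/2) ^ n \<le> b * (1/2) ^ n" by (simp add: \<delta>_def)
    then have e3: "\<bar>(exp (- (z * \<delta>)) - exp (- (z * b))) / z - (\<Sum>j<J * n. w j * exp (- (z * \<tau> j)))\<bar> \<le> \<delta>"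
      using 1(2)[of z] z b2 by linarith
    have "1 / z = (1 - exp (- (z * \<delta>))) / z + (exp (- (z * \<delta>)) - exp (- (z * b))) / z + exp (- (z * b)) / z"
      by (simp add: diff_divide_distrib)
    then have "\<bar>1 / z - (\<Sum>j<J * n. w j * exp (- (z * \<tau> j)))\<bar> \<le> 3 * \<delta>"
      using e1 e2 e2' e3 by linarith
    also have "\<dots> \<le> (1/2) ^ m" by (simp add: \<delta>_def power_add)
    finally show ?thesis .
  qed
  then show ?thesis using 1(1) unfolding Jn by blast
qed

text \<open>The half in \<epsilon> / 2 pays for the factor 2 lost in
  \<open>green_norm_lower\<close>. It is produced by the added 1 in \<open>m\<close>, and
  \<open>nat\<close> makes \<open>m\<close> equal to 1 for \<epsilon> \<ge> 1.\<close>

lemma inverse_exp_sum_log_squared: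
  "\<exists>L :: real \<Rightarrow> nat. (\<forall>\<epsilon>>0. L \<epsilon> > 0) \<and> (\<lambda>\<epsilon>. real (L \<epsilon>)) \<in> O[at_right 0](\<lambda>\<epsilon>. (ln \<epsilon>)\<^sup>2) \<and>
    (\<forall>\<epsilon>>0. \<exists>w \<tau>. (\<forall>j<L \<epsilon>. 0 < \<tau> j) \<and> (\<forall>z\<ge>1::real. \<bar>1 / z - (\<Sum>j<L \<epsilon>. w j * exp (- (z * \<tau> j)))\<bar> \<le> \<epsilon> / 2))"
proof -
  define m where "m = (\<lambda>\<epsilon>::real. nat \<lceil>log 2 (1 / \<epsilon>)\<rceil> + 1)"
  define L where "L = (\<lambda>\<epsilon>. 20 * (m \<epsilon> + 2)\<^sup>2)"
  have pw: "(1/2) ^ m \<epsilon> \<le> \<epsilon> / 2" if "\<epsilon> > 0" for \<epsilon>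
  proof -
    have "1 / \<epsilon> = 2 powr (log 2 (1 / \<epsilon>))" using that by simp
    also have "\<dots> \<le> 2 powr (real (nat \<lceil>log 2 (1 / \<epsilon>)\<rceil>))"
      by (intro powr_mono) linarith+
    finally have "1 / \<epsilon> \<le> 2 ^ nat \<lceil>log 2 (1 / \<epsilon>)\<rceil>" by (simp add: powr_realpow)
    then have "2 / \<epsilon> \<le> 2 ^ m \<epsilon>" unfolding m_def by simp
    then show ?thesis using that by (simp add: power_divide field_simps)
  qed
  have "(\<lambda>\<epsilon>. real (L \<epsilon>)) \<in> O[at_right 0](\<lambda>\<epsilon>. (ln \<epsilon>)\<^sup>2)"
  proof (rule bigoI)
    have "eventually (\<lambda>\<epsilon>::real. \<epsilon> < 1/2) (at_right 0)" "eventually (\<lambda>\<epsilon>::real. 0 < \<epsilon>) (at_right 0)"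
      by (auto intro!: eventually_at_rightI[of 0 "1/2"] simp: eventually_at_right_less)
    then show "\<forall>\<^sub>F \<epsilon> in at_right 0. norm (real (L \<epsilon>)) \<le> 20 * 25 / (ln 2)\<^sup>2 * norm ((ln \<epsilon>)\<^sup>2)"
    proof eventually_elim
      case (elim \<epsilon>)
      define l where "l = log 2 (1 / \<epsilon>)"
      have "1 = log 2 (2::real)" by simp
      also have "\<dots> \<le> l" unfolding l_def using elim by (subst log_le_cancel_iff) (auto simp: field_simps)
      finally have l1: "1 \<le> l" .
      \<comment> \<open>Rounding up, the added 1 and the shift by 2 cost at most 4, and 4 \<le> 4
        l.\<close>
      have "real (m \<epsilon> + 2) \<le> 5 * l" using l1 unfolding m_def l_def[symmetric] by linarith
      then have "real (m \<epsilon> + 2) ^ 2 \<le> (5 * l) ^ 2" by (intro power_mono) auto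
      then have "real (L \<epsilon>) \<le> 20 * 25 * l\<^sup>2" by (simp add: L_def power_mult_distrib)
      also have "l = - ln \<epsilon> / ln 2" using elim by (simp add: l_def log_def ln_div)
      finally show ?case by (simp add: power_divide)
    qed
  qed
  moreover have "\<exists>w \<tau>. (\<forall>j<L \<epsilon>. 0 < \<tau> j) \<and> (\<forall>z\<ge>1::real. \<bar>1 / z - (\<Sum>j<L \<epsilon>. w j * exp (- (z * \<tau> j)))\<bar> \<le> \<epsilon> / 2)"
    if "\<epsilon> > 0" for \<epsilon>
  proof -
    obtain w \<tau> :: "nat \<Rightarrow> real" where "\<forall>j<L \<epsilon>. 0 < \<tau> j" "\<forall>z\<ge>1::real. \<bar>1 / z - (\<Sum>j<L \<epsilon>. w j * exp (- (z * \<tau> j)))\<bar> \<le> (1/2) ^ m \<epsilon>"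
      using inverse_exp_sum[of "m \<epsilon>"] unfolding L_def by blast
    with pw[OF that] show ?thesis by (intro exI[of _ w] exI[of _ \<tau>]) force
  qed
  moreover have "\<forall>\<epsilon>>0. L \<epsilon> > 0" by (simp add: L_def)
  ultimately show ?thesis by blast
qed

section \<open>Integral operators with symmetric kernels\<close>

lemma L2_measurable: "f \<in> L2 M \<Longrightarrow> f \<in> borel_measurable M"
  and L2_integrable: "f \<in> L2 M \<Longrightarrow> integrable M (\<lambda>x. (cmod (f x))\<^sup>2)"
  by (auto simp: L2_def)

lemma l2norm_nonneg [simp]: "0 \<le> l2norm M f"
  by (simp add: l2norm_def)

lemma l2norm_square: "(l2norm M f)\<^sup>2 = (LINT x|M. (cmod (f x))\<^sup>2)"
  by (simp add: l2norm_def)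

lemma L2_bounded:
  assumes "g \<in> L2 M" "f \<in> borel_measurable M" "\<And>x. x \<in> space M \<Longrightarrow> cmod (f x) \<le> C * cmod (g x)"
  shows "f \<in> L2 M"
proof -
  have "integrable M (\<lambda>x. C\<^sup>2 * (cmod (g x))\<^sup>2)" using L2_integrable[OF assms(1)] by simp
  then have "integrable M (\<lambda>x. (cmod (f x))\<^sup>2)"
  proof (rule Bochner_Integration.integrable_bound)
    show "AE x in M. norm ((cmod (f x))\<^sup>2) \<le> norm (C\<^sup>2 * (cmod (g x))\<^sup>2)"
      using assms(3) by (intro AE_I2) (simp add: power_mult_distrib[symmetric] power_mono)
  qed (use assms in measurable)
  then show ?thesis using assms by (simp add: L2_def)
qed

lemma L2_scale: "f \<in> L2 M \<Longrightarrow> (\<lambda>x. c * f x) \<in> L2 M"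
  by (rule L2_bounded[of f _ _ "cmod c"]) (auto dest: L2_measurable simp: norm_mult)

lemma borel_measurable_cnj [measurable (raw)]:
  "f \<in> borel_measurable M \<Longrightarrow> (\<lambda>x. cnj (f x)) \<in> borel_measurable M"
  by (rule measurable_compose[of f M borel cnj])
     (auto intro!: borel_measurable_continuous_onI continuous_intros)

lemma L2_cnj: "f \<in> L2 M \<Longrightarrow> (\<lambda>x. cnj (f x)) \<in> L2 M"
  by (rule L2_bounded[of f _ _ 1]) (use L2_measurable[of f M] in auto)

lemma L2_add: "f \<in> L2 M \<Longrightarrow> g \<in> L2 M \<Longrightarrow> (\<lambda>x. f x + g x) \<in> L2 M"
  using L2_diff[of f M "\<lambda>x. - 1 * g x"] L2_scale[of g M "-1"] by simp

lemma L2_sum: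
  assumes "\<And>i. i \<in> I \<Longrightarrow> f i \<in> L2 M"
  shows "(\<lambda>x. \<Sum>i\<in>I. f i x) \<in> L2 M"
proof -
  have "(\<lambda>x. 0) \<in> L2 M" by (simp add: L2_def)
  then show ?thesis
    using assms by (induction I rule: infinite_finite_induct) (simp_all add: L2_add)
qed

lemma L2_indicator:
  assumes "f \<in> L2 M" "A \<in> sets M"
  shows "(\<lambda>x. f x * indicator A x) \<in> L2 M"
proof (rule L2_bounded[OF assms(1), of _ 1])
  show "(\<lambda>x. f x * indicator A x) \<in> borel_measurable M"
    using L2_measurable[OF assms(1)] assms(2) by simp
qed (simp split: split_indicator)

lemma l2norm_mono:
  assumes "f \<in> L2 M" "g \<in> L2 M" "AE x in M. cmod (f x) \<le> cmod (g x)"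
  shows "l2norm M f \<le> l2norm M g"
  unfolding l2norm_def using assms
  by (intro real_sqrt_le_mono integral_mono_AE L2_integrable) (auto intro: power_mono)

lemma l2norm_cong_AE:
  assumes "f \<in> L2 M" "g \<in> L2 M" "AE x in M. f x = g x"
  shows "l2norm M f = l2norm M g"
  using assms by (intro antisym l2norm_mono) auto

lemma l2norm_scale: "l2norm M (\<lambda>x. c * f x) = cmod c * l2norm M f"
  by (simp add: l2norm_def norm_mult power_mult_distrib real_sqrt_mult)

lemma L2_prod_integrable:
  assumes "f \<in> L2 M" "g \<in> L2 M"
  shows "integrable M (\<lambda>x. f x * g x)"
proof (rule Bochner_Integration.integrable_bound)
  show "integrable M (\<lambda>x. (cmod (f x))\<^sup>2 + (cmod (g x))\<^sup>2)"
    using assms by (intro Bochner_Integration.integrable_add L2_integrable)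
  have "cmod (f x) * cmod (g x) \<le> (cmod (f x))\<^sup>2 + (cmod (g x))\<^sup>2" for x
  proof -
    have "0 \<le> cmod (f x) * cmod (g x)" by simp
    then show ?thesis using sum_squares_bound[of "cmod (f x)" "cmod (g x)"] by linarith
  qed
  then show "AE x in M. norm (f x * g x) \<le> norm ((cmod (f x))\<^sup>2 + (cmod (g x))\<^sup>2)"
    by (simp add: norm_mult)
qed (use L2_measurable[OF assms(1)] L2_measurable[OF assms(2)] in measurable)

lemma L2_Cauchy_Schwarz_norm:
  assumes f: "f \<in> L2 M" and g: "g \<in> L2 M"
  shows "(LINT x|M. cmod (f x) * cmod (g x)) \<le> l2norm M f * l2norm M g"
proof -
  have [measurable]: "f \<in> borel_measurable M" "g \<in> borel_measurable M"
    using f g by (auto dest: L2_measurable)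
  have i: "integrable M (\<lambda>x. cmod (f x) * cmod (g x))"
    using integrable_norm[OF L2_prod_integrable[OF f g]] by (simp add: norm_mult)
  have sq: "(\<integral>\<^sup>+x. (ennreal (cmod (h x)))\<^sup>2 \<partial>M) = ennreal ((l2norm M h)\<^sup>2)" if "h \<in> L2 M" for h
    unfolding l2norm_square ennreal_power[OF norm_ge_zero]
    by (rule nn_integral_eq_integral) (use that in \<open>auto dest: L2_integrable\<close>)
  have "(\<integral>\<^sup>+x. ennreal (cmod (f x)) * ennreal (cmod (g x)) \<partial>M) = ennreal (LINT x|M. cmod (f x) * cmod (g x))"
    unfolding ennreal_mult'[OF norm_ge_zero, symmetric]
    by (rule nn_integral_eq_integral) (use i in auto)
  with Cauchy_Schwarz_nn_integral[of "\<lambda>x. ennreal (cmod (f x))" M "\<lambda>x. ennreal (cmod (g x))"]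
  have "(ennreal (LINT x|M. cmod (f x) * cmod (g x)))\<^sup>2 \<le> ennreal ((l2norm M f)\<^sup>2) * ennreal ((l2norm M g)\<^sup>2)"
    by (simp only: sq[OF f] sq[OF g]) simp
  then have "ennreal ((LINT x|M. cmod (f x) * cmod (g x))\<^sup>2) \<le> ennreal ((l2norm M f * l2norm M g)\<^sup>2)"
    by (simp add: ennreal_power ennreal_mult'[symmetric] power_mult_distrib del: ennreal_le_iff)
  then have "(LINT x|M. cmod (f x) * cmod (g x))\<^sup>2 \<le> (l2norm M f * l2norm M g)\<^sup>2"
    by (simp add: ennreal_le_iff)
  then show ?thesis by (rule power2_le_imp_le) simp
qed

text \<open>The pairing is bilinear, without conjugation, to match the distributional pairing in
  \<open>kinetic\<close>; \<open>L2_cnj\<close> converts it into the inner product.\<close>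

lemma L2_Cauchy_Schwarz:
  assumes f: "f \<in> L2 M" and g: "g \<in> L2 M"
  shows "cmod (LINT x|M. f x * g x) \<le> l2norm M f * l2norm M g"
proof -
  have "cmod (LINT x|M. f x * g x) \<le> (LINT x|M. cmod (f x * g x))"
    by (rule integral_norm_bound)
  also have "\<dots> \<le> l2norm M f * l2norm M g"
    using L2_Cauchy_Schwarz_norm[OF f g] by (simp add: norm_mult)
  finally show ?thesis .
qed

lemma l2norm_triangle:
  assumes f: "f \<in> L2 M" and g: "g \<in> L2 M"
  shows "l2norm M (\<lambda>x. f x + g x) \<le> l2norm M f + l2norm M g"
proof (rule power2_le_imp_le)
  have i: "integrable M (\<lambda>x. cmod (f x) * cmod (g x))"
    using integrable_norm[OF L2_prod_integrable[OF f g]] by (simp add: norm_mult)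
  have "(l2norm M (\<lambda>x. f x + g x))\<^sup>2 \<le> (LINT x|M. (cmod (f x))\<^sup>2 + 2 * (cmod (f x) * cmod (g x)) + (cmod (g x))\<^sup>2)"
    unfolding l2norm_square
  proof (rule integral_mono)
    show "(cmod (f x + g x))\<^sup>2 \<le> (cmod (f x))\<^sup>2 + 2 * (cmod (f x) * cmod (g x)) + (cmod (g x))\<^sup>2" for x
      using power_mono[OF norm_triangle_ineq[of "f x" "g x"], of 2] by (simp add: power2_sum mult_ac)
  qed (use i f g in \<open>auto intro!: L2_integrable L2_add Bochner_Integration.integrable_add\<close>)
  also have "\<dots> = (LINT x|M. (cmod (f x))\<^sup>2) + 2 * (LINT x|M. cmod (f x) * cmod (g x)) + (LINT x|M. (cmod (g x))\<^sup>2)"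
    using i f g by (simp add: L2_integrable)
  also have "\<dots> \<le> (l2norm M f)\<^sup>2 + 2 * (l2norm M f * l2norm M g) + (l2norm M g)\<^sup>2"
    using L2_Cauchy_Schwarz_norm[OF f g] by (simp add: l2norm_square)
  finally show "(l2norm M (\<lambda>x. f x + g x))\<^sup>2 \<le> (l2norm M f + l2norm M g)\<^sup>2"
    by (simp add: power2_sum)
qed simp

lemma l2norm_sum:
  assumes "\<And>i. i \<in> I \<Longrightarrow> f i \<in> L2 M"
  shows "l2norm M (\<lambda>x. \<Sum>i\<in>I. f i x) \<le> (\<Sum>i\<in>I. l2norm M (f i))"
  using assms
proof (induction I rule: infinite_finite_induct)
  case (insert i I)
  then show ?case
    using l2norm_triangle[of "f i" M "\<lambda>x. \<Sum>i\<in>I. f i x"] L2_sum[of I f M] by fastforce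
qed (auto simp: l2norm_def)

text \<open>Where the integrand is not integrable the Bochner integral is 0 by convention. For
  square-integrable \<open>f\<close> and the kernels below such points form a null set, by
  \<open>AE_integrand_integrable\<close>.\<close>

definition integral_op :: "'a measure \<Rightarrow> ('a \<Rightarrow> 'a \<Rightarrow> real) \<Rightarrow> 'a operator" where
  "integral_op M k f = (\<lambda>x. LINT y|M. complex_of_real (k x y) * f y)"

text \<open>The setting of Schur's test: by symmetry the bound C on the row integrals also bounds
  the column integrals, and Cauchy-Schwarz with weight \<open>k\<close> then bounds the operator on
  L2 by C.\<close>

locale schur_kernel = sigma_finite_measure M for M :: "'a measure" +
  fixes k :: "'a \<Rightarrow> 'a \<Rightarrow> real" and C :: real
  assumes kernel_measurable [measurable]: "(\<lambda>(x, y). k x y) \<in> borel_measurable (M \<Otimes>\<^sub>M M)"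
    and kernel_nonneg: "\<And>x y. 0 \<le> k x y"
    and kernel_sym: "\<And>x y. k x y = k y x"
    and kernel_integrable: "\<And>x. x \<in> space M \<Longrightarrow> integrable M (k x)"
    and kernel_bound: "\<And>x. x \<in> space M \<Longrightarrow> (LINT y|M. k x y) \<le> C"
    and bound_nonneg: "0 \<le> C"
begin

sublocale pair: pair_sigma_finite M M ..

text \<open>Integrating over \<open>x\<close> first, the column integral contributes the factor
  C.\<close>

lemma weighted_square_integrable:
  assumes f: "f \<in> L2 M"
  shows "integrable (M \<Otimes>\<^sub>M M) (\<lambda>(x, y). k x y * (cmod (f y))\<^sup>2)"
    and "(LINT x|M. LINT y|M. k x y * (cmod (f y))\<^sup>2) \<le> C * (l2norm M f)\<^sup>2"
proof -
  have [measurable]: "f \<in> borel_measurable M" using f by (rule L2_measurable)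
  have b: "(\<integral>\<^sup>+x. ennreal (k x y * (cmod (f y))\<^sup>2) \<partial>M) \<le> ennreal (C * (cmod (f y))\<^sup>2)" if "y \<in> space M" for y
  proof -
    have "(\<integral>\<^sup>+x. ennreal (k x y * (cmod (f y))\<^sup>2) \<partial>M) = (\<integral>\<^sup>+x. ennreal ((cmod (f y))\<^sup>2 * k y x) \<partial>M)"
      using kernel_sym by (simp add: mult.commute)
    also have "\<dots> = ennreal (LINT x|M. (cmod (f y))\<^sup>2 * k y x)"
      by (intro nn_integral_eq_integral) (use kernel_integrable[OF that] kernel_nonneg in auto)
    also have "\<dots> \<le> ennreal (C * (cmod (f y))\<^sup>2)"
      using kernel_bound[OF that] by (intro ennreal_leI) (simp add: mult.commute mult_left_mono mult_right_mono)
    finally show ?thesis .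
  qed
  have nn: "(\<integral>\<^sup>+p. ennreal (norm (case p of (x, y) \<Rightarrow> k x y * (cmod (f y))\<^sup>2)) \<partial>(M \<Otimes>\<^sub>M M))
      \<le> ennreal (C * (l2norm M f)\<^sup>2)"
  proof -
    have "(\<integral>\<^sup>+p. ennreal (norm (case p of (x, y) \<Rightarrow> k x y * (cmod (f y))\<^sup>2)) \<partial>(M \<Otimes>\<^sub>M M))
        = (\<integral>\<^sup>+y. \<integral>\<^sup>+x. ennreal (k x y * (cmod (f y))\<^sup>2) \<partial>M \<partial>M)"
      by (subst pair.nn_integral_snd[symmetric]) (auto simp: kernel_nonneg)
    also have "\<dots> \<le> (\<integral>\<^sup>+y. ennreal (C * (cmod (f y))\<^sup>2) \<partial>M)"
      by (intro nn_integral_mono b)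
    also have "\<dots> = ennreal (LINT y|M. C * (cmod (f y))\<^sup>2)"
      by (intro nn_integral_eq_integral) (use L2_integrable[OF f] bound_nonneg in auto)
    finally show ?thesis by (simp add: l2norm_square)
  qed
  show i: "integrable (M \<Otimes>\<^sub>M M) (\<lambda>(x, y). k x y * (cmod (f y))\<^sup>2)"
  proof (rule integrableI_bounded)
    show "(\<integral>\<^sup>+p. ennreal (norm (case p of (x, y) \<Rightarrow> k x y * (cmod (f y))\<^sup>2)) \<partial>(M \<Otimes>\<^sub>M M)) < \<infinity>"
      using nn by (rule le_less_trans) simp
  qed measurable
  have "ennreal (LINT x|M. LINT y|M. k x y * (cmod (f y))\<^sup>2)
      = ennreal (integral\<^sup>L (M \<Otimes>\<^sub>M M) (\<lambda>(x, y). k x y * (cmod (f y))\<^sup>2))"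
    using pair.integral_fst[OF i] by simp
  also have "\<dots> = (\<integral>\<^sup>+p. ennreal (case p of (x, y) \<Rightarrow> k x y * (cmod (f y))\<^sup>2) \<partial>(M \<Otimes>\<^sub>M M))"
    by (intro nn_integral_eq_integral[symmetric] i) (auto simp: kernel_nonneg)
  also have "\<dots> \<le> ennreal (C * (l2norm M f)\<^sup>2)"
    using nn by (simp add: kernel_nonneg case_prod_beta)
  finally show "(LINT x|M. LINT y|M. k x y * (cmod (f y))\<^sup>2) \<le> C * (l2norm M f)\<^sup>2"
    using bound_nonneg by (simp add: ennreal_le_iff)
qed

lemma integrand_integrable:
  assumes f: "f \<in> L2 M" and x: "x \<in> space M" and i: "integrable M (\<lambda>y. k x y * (cmod (f y))\<^sup>2)"
  shows "integrable M (\<lambda>y. complex_of_real (k x y) * f y)"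
proof (rule Bochner_Integration.integrable_bound)
  have [measurable]: "f \<in> borel_measurable M" using f by (rule L2_measurable)
  show "integrable M (\<lambda>y. k x y + k x y * (cmod (f y))\<^sup>2)"
    using kernel_integrable[OF x] i by simp
  show "(\<lambda>y. complex_of_real (k x y) * f y) \<in> borel_measurable M" using x by measurable
  have "a \<le> 1 + a\<^sup>2" if "0 \<le> a" for a :: real using sum_squares_bound[of a 1] that by simp
  then have "k x y * cmod (f y) \<le> k x y * (1 + (cmod (f y))\<^sup>2)" for y
    by (intro mult_left_mono kernel_nonneg) simp
  then show "AE y in M. norm (complex_of_real (k x y) * f y) \<le> norm (k x y + k x y * (cmod (f y))\<^sup>2)"
    by (intro AE_I2) (simp add: norm_mult kernel_nonneg algebra_simps)
qed

lemma AE_weighted_square_integrable: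
  "f \<in> L2 M \<Longrightarrow> AE x in M. integrable M (\<lambda>y. k x y * (cmod (f y))\<^sup>2)"
  using pair.AE_integrable_fst[OF weighted_square_integrable(1)] .

lemma AE_integrand_integrable:
  assumes "f \<in> L2 M"
  shows "AE x in M. integrable M (\<lambda>y. complex_of_real (k x y) * f y)"
  using AE_weighted_square_integrable[OF assms] AE_space
  by eventually_elim (rule integrand_integrable[OF assms])

text \<open>Cauchy-Schwarz for the splitting of \<open>k f\<close> into sqrt k and sqrt k f; the
  first factor contributes the row integral.\<close>

lemma integral_op_pointwise:
  assumes f: "f \<in> L2 M" and x: "x \<in> space M" and i: "integrable M (\<lambda>y. k x y * (cmod (f y))\<^sup>2)"
  shows "(cmod (integral_op M k f x))\<^sup>2 \<le> C * (LINT y|M. k x y * (cmod (f y))\<^sup>2)"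
proof -
  have [measurable]: "f \<in> borel_measurable M" using f by (rule L2_measurable)
  define a where "a = (\<lambda>y. complex_of_real (sqrt (k x y)))"
  define b where "b = (\<lambda>y. complex_of_real (sqrt (k x y)) * f y)"
  have aL: "a \<in> L2 M" and bL: "b \<in> L2 M"
    using x kernel_integrable[OF x] i
    by (auto simp: L2_def a_def b_def norm_mult power_mult_distrib kernel_nonneg)
  have "integral_op M k f x = (LINT y|M. a y * b y)"
    unfolding integral_op_def a_def b_def
    by (simp add: kernel_nonneg flip: mult.assoc of_real_mult)
  then have "cmod (integral_op M k f x) \<le> l2norm M a * l2norm M b"
    using L2_Cauchy_Schwarz[OF aL bL] by simp
  then have "(cmod (integral_op M k f x))\<^sup>2 \<le> (l2norm M a * l2norm M b)\<^sup>2"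
    by (intro power_mono) auto
  also have "\<dots> = (LINT y|M. k x y) * (LINT y|M. k x y * (cmod (f y))\<^sup>2)"
    by (simp add: power_mult_distrib l2norm_square a_def b_def norm_mult kernel_nonneg)
  also have "\<dots> \<le> C * (LINT y|M. k x y * (cmod (f y))\<^sup>2)"
    by (intro mult_right_mono kernel_bound x) (simp add: kernel_nonneg)
  finally show ?thesis .
qed

lemma integral_op_measurable:
  assumes "f \<in> borel_measurable M"
  shows "integral_op M k f \<in> borel_measurable M"
  unfolding integral_op_def using assms by measurable

lemma
  assumes f: "f \<in> L2 M"
  shows integral_op_L2: "integral_op M k f \<in> L2 M"
    and integral_op_norm: "l2norm M (integral_op M k f) \<le> C * l2norm M f"
proof -
  have [measurable]: "f \<in> borel_measurable M" using f by (rule L2_measurable)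
  note [measurable] = integral_op_measurable[of f]
  note w = weighted_square_integrable[OF f]
  have bd: "AE x in M. (cmod (integral_op M k f x))\<^sup>2 \<le> C * (LINT y|M. k x y * (cmod (f y))\<^sup>2)"
    using AE_weighted_square_integrable[OF f] AE_space
    by eventually_elim (rule integral_op_pointwise[OF f])
  have i1: "integrable M (\<lambda>x. C * (LINT y|M. k x y * (cmod (f y))\<^sup>2))"
    using pair.integrable_fst[OF w(1)] by simp
  have i2: "integrable M (\<lambda>x. (cmod (integral_op M k f x))\<^sup>2)"
  proof (rule Bochner_Integration.integrable_bound[OF i1])
    show "AE x in M. norm ((cmod (integral_op M k f x))\<^sup>2) \<le> norm (C * (LINT y|M. k x y * (cmod (f y))\<^sup>2))"
      using bd by eventually_elim simp
  qed measurable
  then show "integral_op M k f \<in> L2 M" by (simp add: L2_def integral_op_measurable)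
  have "(l2norm M (integral_op M k f))\<^sup>2 \<le> (LINT x|M. C * (LINT y|M. k x y * (cmod (f y))\<^sup>2))"
    unfolding l2norm_square by (rule integral_mono_AE[OF i2 i1 bd])
  also have "\<dots> \<le> C * (C * (l2norm M f)\<^sup>2)"
    using w(2) bound_nonneg by (simp add: mult_left_mono)
  also have "\<dots> = (C * l2norm M f)\<^sup>2" by (simp add: power2_eq_square)
  finally show "l2norm M (integral_op M k f) \<le> C * l2norm M f"
    by (rule power2_le_imp_le) (simp add: bound_nonneg)
qed

lemma bounded_integral_op: "bounded_op M (integral_op M k)"
  unfolding bounded_op_def
proof (intro conjI ballI allI)
  fix f g :: "'a \<Rightarrow> complex" assume f: "f \<in> L2 M" and g: "g \<in> L2 M"
  show "AE x in M. integral_op M k (\<lambda>y. f y + g y) x = integral_op M k f x + integral_op M k g x"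
    using AE_integrand_integrable[OF f] AE_integrand_integrable[OF g]
    by eventually_elim (simp add: integral_op_def distrib_left)
next
  fix f :: "'a \<Rightarrow> complex" and c
  show "AE x in M. integral_op M k (\<lambda>y. c * f y) x = c * integral_op M k f x"
    by (simp add: integral_op_def mult.left_commute)
next
  show "\<exists>C. \<forall>f\<in>L2 M. l2norm M (integral_op M k f) \<le> C * l2norm M f"
    using integral_op_norm by blast
qed (rule integral_op_L2)

text \<open>Absolute integrability follows from a b \<le> a^2 + b^2 and the weighted squares of
  \<open>f\<close> and \<open>g\<close>. It licenses the exchange of integrals in
  \<open>bilinear_eq\<close> and \<open>integral_op_symmetric\<close>.\<close>

lemma bilinear_integrable:
  assumes f: "f \<in> L2 M" and g: "g \<in> L2 M"
  shows "integrable (M \<Otimes>\<^sub>M M) (\<lambda>(x, y). complex_of_real (k x y) * f y * g x)"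
proof (rule Bochner_Integration.integrable_bound)
  have [measurable]: "f \<in> borel_measurable M" "g \<in> borel_measurable M"
    using f g by (auto dest: L2_measurable)
  have "integrable (M \<Otimes>\<^sub>M M) (\<lambda>(x, y). k x y * (cmod (g x))\<^sup>2)"
    using pair.integrable_product_swap[OF weighted_square_integrable(1)[OF g]] kernel_sym
    by (simp add: case_prod_beta)
  then show "integrable (M \<Otimes>\<^sub>M M) (\<lambda>p. (case p of (x, y) \<Rightarrow> k x y * (cmod (f y))\<^sup>2) + (case p of (x, y) \<Rightarrow> k x y * (cmod (g x))\<^sup>2))"
    using weighted_square_integrable(1)[OF f] by (rule Bochner_Integration.integrable_add[rotated])
  show "(\<lambda>(x, y). complex_of_real (k x y) * f y * g x) \<in> borel_measurable (M \<Otimes>\<^sub>M M)" by measurable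
  have "k x y * (a * b) \<le> k x y * (a\<^sup>2 + b\<^sup>2)" if "0 \<le> a" "0 \<le> b" for x y a b
  proof (intro mult_left_mono kernel_nonneg)
    have "0 \<le> a * b" using that by simp
    then show "a * b \<le> a\<^sup>2 + b\<^sup>2" using sum_squares_bound[of a b] by linarith
  qed
  from this[OF norm_ge_zero norm_ge_zero]
  have b: "k x y * cmod (f y) * cmod (g x) \<le> k x y * (cmod (f y))\<^sup>2 + k x y * (cmod (g x))\<^sup>2" for x y
    by (metis distrib_left mult.assoc)
  show "AE p in M \<Otimes>\<^sub>M M. norm (case p of (x, y) \<Rightarrow> complex_of_real (k x y) * f y * g x)
     \<le> norm ((case p of (x, y) \<Rightarrow> k x y * (cmod (f y))\<^sup>2) + (case p of (x, y) \<Rightarrow> k x y * (cmod (g x))\<^sup>2))"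
    using b by (intro AE_I2) (auto simp: norm_mult kernel_nonneg)
qed

lemma bilinear_eq:
  assumes f: "f \<in> L2 M" and g: "g \<in> L2 M"
  shows "(LINT x|M. integral_op M k f x * g x) = integral\<^sup>L (M \<Otimes>\<^sub>M M) (\<lambda>(x, y). complex_of_real (k x y) * f y * g x)"
  using pair.integral_fst[OF bilinear_integrable[OF f g]] by (simp add: integral_op_def)

lemma integral_op_symmetric:
  assumes f: "f \<in> L2 M" and g: "g \<in> L2 M"
  shows "(LINT x|M. integral_op M k f x * g x) = (LINT x|M. f x * integral_op M k g x)"
proof -
  have "(LINT x|M. f x * integral_op M k g x) = (LINT y|M. LINT x|M. complex_of_real (k x y) * f y * g x)"
    unfolding integral_op_def integral_mult_right_zero[symmetric]
    by (intro Bochner_Integration.integral_cong refl) (simp add: kernel_sym mult_ac)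
  also have "\<dots> = integral\<^sup>L (M \<Otimes>\<^sub>M M) (\<lambda>(x, y). complex_of_real (k x y) * f y * g x)"
    using pair.integral_snd[OF bilinear_integrable[OF f g]] .
  finally show ?thesis using bilinear_eq[OF f g] by simp
qed

end

section \<open>Abstract heat kernels and their resolvents\<close>

lemma (in pair_sigma_finite) integrable_times:
  fixes f g :: "_ \<Rightarrow> _::{real_normed_field, banach, second_countable_topology}"
  assumes f: "integrable M1 f" and g: "integrable M2 g"
  shows "integrable (M1 \<Otimes>\<^sub>M M2) (\<lambda>(x, y). f x * g y)"
proof (rule Fubini_integrable)
  have [measurable]: "f \<in> borel_measurable M1" "g \<in> borel_measurable M2" using f g by auto
  show "(\<lambda>(x, y). f x * g y) \<in> borel_measurable (M1 \<Otimes>\<^sub>M M2)" by measurable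
  show "integrable M1 (\<lambda>x. LINT y|M2. norm (case (x, y) of (x, y) \<Rightarrow> f x * g y))"
    using f by (simp add: norm_mult)
  show "AE x in M1. integrable M2 (\<lambda>y. case (x, y) of (x, y) \<Rightarrow> f x * g y)"
    using g by simp
qed

context sigma_finite_measure
begin

text \<open>The sets \<open>A n\<close> exhaust the space with finite measure and do not depend on
  \<open>f\<close>. They approximate L2 functions by integrable ones, for which the Fourier formulas
  are available.\<close>

lemma L2_truncation:
  obtains A :: "nat \<Rightarrow> 'a set" where "\<And>n. A n \<in> sets M"
    "\<And>n (f :: 'a \<Rightarrow> complex). f \<in> L2 M \<Longrightarrow> integrable M (\<lambda>x. f x * indicator (A n) x)"
    "\<And>f :: 'a \<Rightarrow> complex. f \<in> L2 M \<Longrightarrow> (\<lambda>n. l2norm M (\<lambda>x. f x * indicator (- A n) x)) \<longlonglongrightarrow> 0"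
proof -
  obtain A :: "nat \<Rightarrow> 'a set" where A: "range A \<subseteq> sets M" "(\<Union>i. A i) = space M"
    "\<And>i. emeasure M (A i) \<noteq> \<infinity>" "incseq A"
    using sigma_finite_incseq by blast
  have [measurable]: "A n \<in> sets M" for n using A by auto
  show thesis
  proof (rule that[of A])
    fix n and f :: "'a \<Rightarrow> complex" assume f: "f \<in> L2 M"
    note [measurable] = L2_measurable[OF f]
    have ind: "(\<lambda>x. indicator (A n) x :: complex) \<in> L2 M"
    proof -
      have "(\<lambda>x. (cmod (indicator (A n) x))\<^sup>2) = (indicator (A n) :: 'a \<Rightarrow> real)"
        by (auto split: split_indicator)
      then show ?thesis using A(3)[of n] by (simp add: L2_def less_top)
    qed
    show "integrable M (\<lambda>x. f x * indicator (A n) x)"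
      by (rule L2_prod_integrable[OF f ind])
  next
    fix f :: "'a \<Rightarrow> complex" assume f: "f \<in> L2 M"
    note [measurable] = L2_measurable[OF f]
    have "(\<lambda>n. LINT x|M. (cmod (f x * indicator (- A n) x))\<^sup>2) \<longlonglongrightarrow> (LINT x|M. 0)"
    proof (rule integral_dominated_convergence[where w = "\<lambda>x. (cmod (f x))\<^sup>2"])
      show "AE x in M. (\<lambda>n. (cmod (f x * indicator (- A n) x))\<^sup>2) \<longlonglongrightarrow> 0"
      proof (rule AE_I2)
        fix x assume "x \<in> space M"
        then obtain m where "x \<in> A m" using A(2) by blast
        then have "x \<in> A n" if "n \<ge> m" for n using A(4) that by (meson incseq_def subsetD)
        then have "\<forall>\<^sub>F n in sequentially. (cmod (f x * indicator (- A n) x))\<^sup>2 = 0"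
          by (intro eventually_sequentiallyI[of m]) simp
        then show "(\<lambda>n. (cmod (f x * indicator (- A n) x))\<^sup>2) \<longlonglongrightarrow> 0"
          by (rule tendsto_eventually)
      qed
      show "AE x in M. norm ((cmod (f x * indicator (- A n) x))\<^sup>2) \<le> (cmod (f x))\<^sup>2" for n
        by (auto split: split_indicator)
    qed (use L2_integrable[OF f] in \<open>auto\<close>)
    then have "(\<lambda>n. sqrt (LINT x|M. (cmod (f x * indicator (- A n) x))\<^sup>2)) \<longlonglongrightarrow> sqrt 0"
      by (intro tendsto_real_sqrt) simp
    then show "(\<lambda>n. l2norm M (\<lambda>x. f x * indicator (- A n) x)) \<longlonglongrightarrow> 0"
      by (simp add: l2norm_def)
  qed auto
qed

lemma indicator_split_L2:
  assumes f: "f \<in> L2 M" and A: "A \<in> sets M"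
  shows "(\<lambda>x. f x * indicator A x) \<in> L2 M" "(\<lambda>x. f x * indicator (- A) x) \<in> L2 M"
    "f = (\<lambda>x. f x * indicator A x + f x * indicator (- A) x)"
    "l2norm M (\<lambda>x. f x * indicator A x) \<le> l2norm M f"
proof -
  note [measurable] = L2_measurable[OF f] A
  show a: "(\<lambda>x. f x * indicator A x) \<in> L2 M" by (rule L2_indicator[OF f A])
  show "(\<lambda>x. f x * indicator (- A) x) \<in> L2 M"
    using f by (rule L2_bounded[of _ _ _ 1]) (auto split: split_indicator)
  show "f = (\<lambda>x. f x * indicator A x + f x * indicator (- A) x)"
    by (auto split: split_indicator)
  show "l2norm M (\<lambda>x. f x * indicator A x) \<le> l2norm M f"
    by (rule l2norm_mono[OF a f]) (auto split: split_indicator)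
qed

text \<open>The test function is \<open>h\<close> cut off to \<open>A n\<close>, whose pairing with
  \<open>h\<close> is the square of its own norm. It is integrable, as the hypothesis demands, and
  the cut-off is removed in the limit.\<close>

lemma l2norm_dual:
  assumes h: "h \<in> L2 M" and B: "0 \<le> B"
    and b: "\<And>g. g \<in> L2 M \<Longrightarrow> integrable M g \<Longrightarrow> cmod (LINT x|M. h x * cnj (g x)) \<le> B * l2norm M g"
  shows "l2norm M h \<le> B"
proof -
  obtain A where A: "\<And>n. A n \<in> sets M" "\<And>n. integrable M (\<lambda>x. h x * indicator (A n) x)"
    "(\<lambda>n. l2norm M (\<lambda>x. h x * indicator (- A n) x)) \<longlonglongrightarrow> 0"
    using L2_truncation h by metis
  have le: "l2norm M h \<le> B + l2norm M (\<lambda>x. h x * indicator (- A n) x)" for n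
  proof -
    define g where "g = (\<lambda>x. h x * indicator (A n) x)"
    have g: "g \<in> L2 M" unfolding g_def by (rule L2_indicator[OF h A(1)])
    have "h x * cnj (g x) = complex_of_real ((cmod (g x))\<^sup>2)" for x
      by (auto simp: g_def complex_norm_square split: split_indicator simp del: of_real_power)
    then have "(LINT x|M. h x * cnj (g x)) = complex_of_real ((l2norm M g)\<^sup>2)"
      by (simp add: l2norm_square del: of_real_power)
    then have "(l2norm M g)\<^sup>2 \<le> B * l2norm M g"
      using b[OF g] A(2)[of n] by (simp add: g_def norm_power)
    then have "l2norm M g \<le> B"
      using B by (cases "l2norm M g = 0") (auto simp: power2_eq_square less_le)
    moreover have "l2norm M h \<le> l2norm M g + l2norm M (\<lambda>x. h x * indicator (- A n) x)"
      using l2norm_triangle[OF indicator_split_L2(1,2)[OF h A(1)[of n]]]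
      unfolding g_def indicator_split_L2(3)[OF h A(1)[of n], symmetric] .
    ultimately show ?thesis by linarith
  qed
  show ?thesis
    by (rule LIMSEQ_le_const[of "\<lambda>n. B + l2norm M (\<lambda>x. h x * indicator (- A n) x)"])
       (use le tendsto_add[OF tendsto_const A(3), of "B"] in auto)
qed

end

text \<open>The normalisation of the exponential distribution with rate \<open>a\<close>. The open
  half-line matches heat kernels that vanish for t \<le> 0; the two integrands differ only at t =
  0.\<close>

lemma exp_half_line:
  fixes a :: real
  assumes a: "0 < a"
  shows "has_bochner_integral lborel (\<lambda>t. indicator {0<..} t * exp (- (t * a))) (1 / a)"
proof (rule has_bochner_integral_nn_integral)
  have "(\<integral>\<^sup>+t. ennreal (exponential_density a t) \<partial>lborel) = 1"
    using prob_space.emeasure_space_1[OF prob_space_exponential_density[OF a]]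
    by (simp add: emeasure_density)
  then have "ennreal (1 / a) = ennreal (1 / a) * (\<integral>\<^sup>+t. ennreal (exponential_density a t) \<partial>lborel)"
    by simp
  also have "\<dots> = (\<integral>\<^sup>+t. ennreal (1 / a) * ennreal (exponential_density a t) \<partial>lborel)"
    by (intro nn_integral_cmult[symmetric]) simp
  also have "\<dots> = (\<integral>\<^sup>+t. ennreal (indicator {0<..} t * exp (- (t * a))) \<partial>lborel)"
  proof (rule nn_integral_cong_AE)
    show "AE t in lborel. ennreal (1 / a) * ennreal (exponential_density a t) =
        ennreal (indicator {0<..} t * exp (- (t * a)))"
      using AE_lborel_singleton[of 0]
      by eventually_elim
        (use a in \<open>auto simp: exponential_density_def ennreal_mult'[symmetric] split: split_indicator\<close>)
  qed
  finally show "(\<integral>\<^sup>+t. ennreal (indicator {0<..} t * exp (- (t * a))) \<partial>lborel) = ennreal (1 / a)" by simp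
qed (use a in auto)

text \<open>Extending \<open>K\<close> by 0 to t \<le> 0 makes the Laplace transform in t an
  integral over the whole line, and lets measurability be stated jointly in t, x and y, as Fubini's
  theorem requires.\<close>

locale heat_kernel = sigma_finite_measure M for M :: "'a measure" +
  fixes K :: "real \<Rightarrow> 'a \<Rightarrow> 'a \<Rightarrow> real"
  assumes K_measurable: "(\<lambda>(t, x, y). K t x y) \<in> borel_measurable (borel \<Otimes>\<^sub>M (M \<Otimes>\<^sub>M M))"
    and K_nonneg: "\<And>t x y. 0 \<le> K t x y"
    and K_sym: "\<And>t x y. K t x y = K t y x"
    and K_zero: "\<And>t x y. t \<le> 0 \<Longrightarrow> K t x y = 0"
    and K_integrable: "\<And>t x. x \<in> space M \<Longrightarrow> integrable M (K t x)"
    and K_integral: "\<And>t x. 0 < t \<Longrightarrow> x \<in> space M \<Longrightarrow> (LINT y|M. K t x y) = 1"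
begin

lemma measurable_K [measurable (raw)]:
  assumes [measurable]: "f \<in> borel_measurable N" "g \<in> measurable N M" "h \<in> measurable N M"
  shows "(\<lambda>w. K (f w) (g w) (h w)) \<in> borel_measurable N"
proof -
  have "(\<lambda>w. (f w, g w, h w)) \<in> measurable N (borel \<Otimes>\<^sub>M (M \<Otimes>\<^sub>M M))" by measurable
  from measurable_compose[OF this K_measurable] show ?thesis by simp
qed

definition heat_op :: "real \<Rightarrow> 'a operator" where
  "heat_op t = integral_op M (K t)"

text \<open>For x = y the integrand may fail to be integrable at t = 0, as it does for Gaussian
  kernels in dimension at least 2; the value is then 0 by convention. Fubini's theorem controls the
  integral for almost every pair, which is enough for the pairings.\<close>

definition green_kernel :: "real \<Rightarrow> 'a \<Rightarrow> 'a \<Rightarrow> real" where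
  "green_kernel \<mu> x y = (LINT t|lborel. exp (\<mu> * t) * K t x y)"

definition green :: "real \<Rightarrow> 'a operator" where
  "green \<mu> = integral_op M (green_kernel \<mu>)"

lemma K_integral': "x \<in> space M \<Longrightarrow> (LINT y|M. K t x y) = indicator {0<..} t"
  using K_integral[of t x] by (cases "0 < t") (auto simp: K_zero)

lemma schur_heat: "schur_kernel M (K t) 1"
proof
  show "(\<lambda>(x, y). K t x y) \<in> borel_measurable (M \<Otimes>\<^sub>M M)" by measurable
qed (use K_nonneg K_sym K_integrable K_integral' in \<open>auto split: split_indicator\<close>)

text \<open>For fixed \<open>x\<close> and t > 0 the kernel has mass one in \<open>y\<close>, so the
  mass in t and y together is the integral of exp (\<mu> t) over the half-line. It becomes the Schur
  constant in \<open>schur_green\<close>.\<close>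

lemma exp_K_integrable:
  assumes \<mu>: "\<mu> < 0" and x: "x \<in> space M"
  shows "integrable (lborel \<Otimes>\<^sub>M M) (\<lambda>(t, y). exp (\<mu> * t) * K t x y)"
    and "(LINT t|lborel. LINT y|M. exp (\<mu> * t) * K t x y) = 1 / - \<mu>"
proof -
  interpret tm: pair_sigma_finite lborel M ..
  have b: "has_bochner_integral lborel (\<lambda>t. indicator {0<..} t * exp (- (t * (- \<mu>)))) (1 / - \<mu>)"
    using \<mu> by (intro exp_half_line) auto
  have e: "(LINT y|M. exp (\<mu> * t) * K t x y) = indicator {0<..} t * exp (- (t * (- \<mu>)))" for t
    using K_integral'[OF x, of t] by (simp add: mult.commute)
  show "(LINT t|lborel. LINT y|M. exp (\<mu> * t) * K t x y) = 1 / - \<mu>"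
    unfolding e using b by (rule has_bochner_integral_integral_eq)
  show "integrable (lborel \<Otimes>\<^sub>M M) (\<lambda>(t, y). exp (\<mu> * t) * K t x y)"
  proof (rule tm.Fubini_integrable)
    show "(\<lambda>(t, y). exp (\<mu> * t) * K t x y) \<in> borel_measurable (lborel \<Otimes>\<^sub>M M)"
      using x by measurable
    have "(\<lambda>t. LINT y|M. norm (case (t, y) of (t, y) \<Rightarrow> exp (\<mu> * t) * K t x y))
        = (\<lambda>t. indicator {0<..} t * exp (- (t * (- \<mu>))))"
      using e by (simp add: K_nonneg)
    then show "integrable lborel (\<lambda>t. LINT y|M. norm (case (t, y) of (t, y) \<Rightarrow> exp (\<mu> * t) * K t x y))"
      using b by (simp add: has_bochner_integral_iff)
    show "AE t in lborel. integrable M (\<lambda>y. case (t, y) of (t, y) \<Rightarrow> exp (\<mu> * t) * K t x y)"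
      using K_integrable[OF x] by simp
  qed
qed

lemma schur_green:
  assumes \<mu>: "\<mu> < 0"
  shows "schur_kernel M (green_kernel \<mu>) (1 / - \<mu>)"
proof
  interpret tm: pair_sigma_finite lborel M ..
  have "(\<lambda>p. LINT t|lborel. exp (\<mu> * t) * K t (fst p) (snd p)) \<in> borel_measurable (M \<Otimes>\<^sub>M M)"
    by measurable
  then show "(\<lambda>(x, y). green_kernel \<mu> x y) \<in> borel_measurable (M \<Otimes>\<^sub>M M)"
    by (simp add: green_kernel_def case_prod_beta')
  show "0 \<le> green_kernel \<mu> x y" for x y
    by (simp add: green_kernel_def K_nonneg)
  show "green_kernel \<mu> x y = green_kernel \<mu> y x" for x y
    by (simp add: green_kernel_def K_sym)
  fix x assume x: "x \<in> space M"
  show "integrable M (green_kernel \<mu> x)"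
    using tm.integrable_snd[OF exp_K_integrable(1)[OF \<mu> x]] by (simp add: green_kernel_def[abs_def])
  have "(LINT y|M. green_kernel \<mu> x y) = 1 / - \<mu>"
    using tm.Fubini_integral[OF exp_K_integrable(1)[OF \<mu> x]] exp_K_integrable(2)[OF \<mu> x]
    by (simp add: green_kernel_def)
  then show "(LINT y|M. green_kernel \<mu> x y) \<le> 1 / - \<mu>" by simp
qed (use \<mu> in simp)

lemma heat_op_L2: "f \<in> L2 M \<Longrightarrow> heat_op t f \<in> L2 M"
  unfolding heat_op_def by (rule schur_kernel.integral_op_L2[OF schur_heat])

lemma heat_op_norm: "f \<in> L2 M \<Longrightarrow> l2norm M (heat_op t f) \<le> l2norm M f"
  unfolding heat_op_def using schur_kernel.integral_op_norm[OF schur_heat, of f t] by simp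

lemma bounded_heat_op: "bounded_op M (heat_op t)"
  unfolding heat_op_def by (rule schur_kernel.bounded_integral_op[OF schur_heat])

lemma heat_op_symmetric:
  "f \<in> L2 M \<Longrightarrow> g \<in> L2 M \<Longrightarrow> (LINT x|M. heat_op t f x * g x) = (LINT x|M. f x * heat_op t g x)"
  unfolding heat_op_def by (rule schur_kernel.integral_op_symmetric[OF schur_heat])

lemma green_L2: "\<mu> < 0 \<Longrightarrow> f \<in> L2 M \<Longrightarrow> green \<mu> f \<in> L2 M"
  unfolding green_def by (rule schur_kernel.integral_op_L2[OF schur_green])

lemma green_norm: "\<mu> < 0 \<Longrightarrow> f \<in> L2 M \<Longrightarrow> l2norm M (green \<mu> f) \<le> 1 / - \<mu> * l2norm M f"
  unfolding green_def by (rule schur_kernel.integral_op_norm[OF schur_green])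

lemma bounded_green: "\<mu> < 0 \<Longrightarrow> bounded_op M (green \<mu>)"
  unfolding green_def by (rule schur_kernel.bounded_integral_op[OF schur_green])

lemma green_symmetric:
  "\<mu> < 0 \<Longrightarrow> f \<in> L2 M \<Longrightarrow> g \<in> L2 M \<Longrightarrow> (LINT x|M. green \<mu> f x * g x) = (LINT x|M. f x * green \<mu> g x)"
  unfolding green_def by (rule schur_kernel.integral_op_symmetric[OF schur_green])

lemma heat_op_pairing_measurable [measurable]:
  assumes [measurable]: "f \<in> borel_measurable M" "g \<in> borel_measurable M"
  shows "(\<lambda>t. LINT x|M. heat_op t f x * g x) \<in> borel_measurable borel"
  unfolding heat_op_def integral_op_def by measurable

lemma heat_op_pairing_bound:
  "f \<in> L2 M \<Longrightarrow> g \<in> L2 M \<Longrightarrow> cmod (LINT x|M. heat_op t f x * g x) \<le> l2norm M f * l2norm M g"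
  by (rule order.trans[OF L2_Cauchy_Schwarz[OF heat_op_L2] mult_right_mono[OF heat_op_norm l2norm_nonneg]])

lemma heat_op_nonpos: "t \<le> 0 \<Longrightarrow> heat_op t f x = 0"
  by (simp add: heat_op_def integral_op_def K_zero)

text \<open>Fubini's theorem in t and the pair (x, y). Because the kernel is nonnegative, the
  integral of the absolute value over (x, y) is itself a heat pairing, that of |f| and |g|, times
  exp (\<mu> t); contractivity bounds this pairing uniformly in t.\<close>

lemma
  assumes \<mu>: "\<mu> < 0" and f: "f \<in> L2 M" and g: "g \<in> L2 M"
  shows green_pairing_integrable:
      "integrable lborel (\<lambda>t. complex_of_real (exp (\<mu> * t)) * (LINT x|M. heat_op t f x * g x))"
    and green_pairing: "(LINT x|M. green \<mu> f x * g x) =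
      (LINT t|lborel. complex_of_real (exp (\<mu> * t)) * (LINT x|M. heat_op t f x * g x))"
proof -
  interpret MM: pair_sigma_finite M M ..
  interpret T: pair_sigma_finite lborel "M \<Otimes>\<^sub>M M" ..
  note [measurable] = L2_measurable[OF f] L2_measurable[OF g]
  define H where "H = (\<lambda>t (p::'a \<times> 'a). complex_of_real (exp (\<mu> * t)) *
    (complex_of_real (K t (fst p) (snd p)) * f (snd p) * g (fst p)))"
  define f' where "f' = (\<lambda>x. complex_of_real (cmod (f x)))"
  define g' where "g' = (\<lambda>x. complex_of_real (cmod (g x)))"
  have f': "f' \<in> L2 M" and g': "g' \<in> L2 M"
    using f g by (auto simp: f'_def g'_def L2_def)
  have nf': "l2norm M f' = l2norm M f" "l2norm M g' = l2norm M g"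
    by (simp_all add: f'_def g'_def l2norm_def)
  have meas: "(\<lambda>(t, p). H t p) \<in> borel_measurable (lborel \<Otimes>\<^sub>M (M \<Otimes>\<^sub>M M))"
    unfolding H_def by measurable
  have Ki: "integrable (M \<Otimes>\<^sub>M M) (\<lambda>(x, y). complex_of_real (K t x y) * u y * v x)"
    if "u \<in> L2 M" "v \<in> L2 M" for t u v
    using schur_kernel.bilinear_integrable[OF schur_heat that] .
  have Ke: "integral\<^sup>L (M \<Otimes>\<^sub>M M) (\<lambda>(x, y). complex_of_real (K t x y) * u y * v x) = (LINT x|M. heat_op t u x * v x)"
    if "u \<in> L2 M" "v \<in> L2 M" for t u v
    using schur_kernel.bilinear_eq[OF schur_heat that, of t] by (simp add: heat_op_def)
  have Hp: "integral\<^sup>L (M \<Otimes>\<^sub>M M) (H t) = complex_of_real (exp (\<mu> * t)) * (LINT x|M. heat_op t f x * g x)" for t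
    unfolding H_def integral_mult_right_zero using Ke[OF f g, of t] by (simp add: case_prod_beta')
  have int: "integrable (lborel \<Otimes>\<^sub>M (M \<Otimes>\<^sub>M M)) (\<lambda>(t, p). H t p)"
  proof (rule T.Fubini_integrable[OF meas])
    have b: "(LINT p|(M \<Otimes>\<^sub>M M). norm (H t p)) \<le> indicator {0<..} t * exp (- (t * (- \<mu>))) * (l2norm M f * l2norm M g)" for t
    proof (cases "0 < t")
      case True
      have "(LINT p|(M \<Otimes>\<^sub>M M). complex_of_real (norm (H t p))) =
          complex_of_real (exp (\<mu> * t)) * (LINT x|M. heat_op t f' x * g' x)"
        unfolding Ke[OF f' g', symmetric] integral_mult_right_zero[symmetric]
        by (intro Bochner_Integration.integral_cong) (auto simp: H_def norm_mult K_nonneg f'_def g'_def)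
      then have "(LINT p|(M \<Otimes>\<^sub>M M). norm (H t p)) = cmod (complex_of_real (exp (\<mu> * t)) * (LINT x|M. heat_op t f' x * g' x))"
        unfolding integral_complex_of_real
        by (metis norm_of_real abs_of_nonneg Bochner_Integration.integral_nonneg norm_ge_zero)
      also have "\<dots> \<le> exp (\<mu> * t) * (l2norm M f * l2norm M g)"
        using heat_op_pairing_bound[OF f' g'] by (simp add: norm_mult nf')
      finally show ?thesis using True by (simp add: mult.commute)
    qed (simp add: H_def K_zero)
    show "integrable lborel (\<lambda>t. LINT p|(M \<Otimes>\<^sub>M M). norm (case (t, p) of (t, p) \<Rightarrow> H t p))"
    proof (rule Bochner_Integration.integrable_bound)
      show "integrable lborel (\<lambda>t. indicator {0<..} t * exp (- (t * (- \<mu>))) * (l2norm M f * l2norm M g))"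
        using exp_half_line[of "- \<mu>"] \<mu> by (intro integrable_mult_left) (auto simp: has_bochner_integral_iff)
      show "(\<lambda>t. LINT p|(M \<Otimes>\<^sub>M M). norm (case (t, p) of (t, p) \<Rightarrow> H t p)) \<in> borel_measurable lborel"
        unfolding H_def by measurable
    qed (use b order.trans in \<open>fastforce simp: abs_of_nonneg\<close>)
    show "AE t in lborel. integrable (M \<Otimes>\<^sub>M M) (\<lambda>p. case (t, p) of (t, p) \<Rightarrow> H t p)"
      using Ki[OF f g] by (simp add: H_def case_prod_beta')
  qed
  show "integrable lborel (\<lambda>t. complex_of_real (exp (\<mu> * t)) * (LINT x|M. heat_op t f x * g x))"
    using T.integrable_fst[OF int] by (simp add: Hp)
  have "(LINT x|M. green \<mu> f x * g x) =
      integral\<^sup>L (M \<Otimes>\<^sub>M M) (\<lambda>(x, y). complex_of_real (green_kernel \<mu> x y) * f y * g x)"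
    unfolding green_def by (rule schur_kernel.bilinear_eq[OF schur_green[OF \<mu>] f g])
  also have "\<dots> = (LINT p|(M \<Otimes>\<^sub>M M). LINT t|lborel. H t p)"
  proof (intro Bochner_Integration.integral_cong refl)
    fix p
    have "(LINT t|lborel. H t p) =
        (LINT t|lborel. complex_of_real (exp (\<mu> * t) * K t (fst p) (snd p)) * (f (snd p) * g (fst p)))"
      by (simp add: H_def mult.assoc)
    also have "\<dots> = complex_of_real (green_kernel \<mu> (fst p) (snd p)) * (f (snd p) * g (fst p))"
      unfolding integral_mult_left_zero integral_complex_of_real green_kernel_def ..
    finally show "(case p of (x, y) \<Rightarrow> complex_of_real (green_kernel \<mu> x y) * f y * g x) = (LINT t|lborel. H t p)"
      by (simp add: case_prod_beta mult.assoc)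
  qed
  also have "\<dots> = (LINT t|lborel. integral\<^sup>L (M \<Otimes>\<^sub>M M) (H t))"
    by (rule T.Fubini_integral[OF int])
  finally show "(LINT x|M. green \<mu> f x * g x) =
      (LINT t|lborel. complex_of_real (exp (\<mu> * t)) * (LINT x|M. heat_op t f x * g x))"
    by (simp add: Hp)
qed

end

section \<open>Spectral multipliers\<close>

text \<open>\<open>E\<close> stands for plane waves, \<Lambda> for their energies and
  \<open>c\<close> for the Plancherel constant. Frequencies range over the same measure space as the
  configurations, so functions and transforms live on one space.\<close>

locale spectral_heat_kernel = heat_kernel +
  fixes E :: "'a \<Rightarrow> 'a \<Rightarrow> complex" and \<Lambda> :: "'a \<Rightarrow> real" and c :: real
  assumes E_measurable: "(\<lambda>(\<eta>, x). E \<eta> x) \<in> borel_measurable (M \<Otimes>\<^sub>M M)"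
    and E_bounded: "\<And>\<eta> x. cmod (E \<eta> x) \<le> 1"
    and \<Lambda>_measurable [measurable]: "\<Lambda> \<in> borel_measurable M"
    and \<Lambda>_nonneg: "\<And>\<eta>. 0 \<le> \<Lambda> \<eta>"
    and exp_\<Lambda>_integrable: "\<And>t. 0 < t \<Longrightarrow> integrable M (\<lambda>\<eta>. exp (- (t * \<Lambda> \<eta>)))"
    and c_pos: "0 < c"
    and K_spectral: "\<And>t x y. 0 < t \<Longrightarrow> x \<in> space M \<Longrightarrow> y \<in> space M \<Longrightarrow>
      complex_of_real (K t x y) =
        complex_of_real c * (LINT \<eta>|M. complex_of_real (exp (- (t * \<Lambda> \<eta>))) * E \<eta> x * cnj (E \<eta> y))"
begin

sublocale MM: pair_sigma_finite M M ..

lemma measurable_E [measurable (raw)]: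
  assumes [measurable]: "g \<in> measurable N M" "h \<in> measurable N M"
  shows "(\<lambda>w. E (g w) (h w)) \<in> borel_measurable N"
proof -
  have "(\<lambda>w. (g w, h w)) \<in> measurable N (M \<Otimes>\<^sub>M M)" by measurable
  from measurable_compose[OF this E_measurable] show ?thesis by simp
qed

definition transform :: "('a \<Rightarrow> complex) \<Rightarrow> 'a \<Rightarrow> complex" where
  "transform f \<eta> = (LINT y|M. cnj (E \<eta> y) * f y)"

lemma measurable_transform [measurable]:
  assumes [measurable]: "f \<in> borel_measurable M"
  shows "transform f \<in> borel_measurable M"
  unfolding transform_def[abs_def] by measurable

lemma E_mult_integrable:
  assumes "integrable M f" "\<eta> \<in> space M"
  shows "integrable M (\<lambda>y. cnj (E \<eta> y) * f y)"
proof (rule Bochner_Integration.integrable_bound[OF assms(1)])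
  have [measurable]: "f \<in> borel_measurable M" using assms by auto
  show "(\<lambda>y. cnj (E \<eta> y) * f y) \<in> borel_measurable M" using assms(2) by measurable
  show "AE y in M. norm (cnj (E \<eta> y) * f y) \<le> norm (f y)"
    using E_bounded by (intro AE_I2) (simp add: norm_mult mult_left_le_one_le)
qed

lemma transform_bound:
  assumes f: "integrable M f" and \<eta>: "\<eta> \<in> space M"
  shows "cmod (transform f \<eta>) \<le> (LINT y|M. cmod (f y))"
proof -
  have "cmod (transform f \<eta>) \<le> (LINT y|M. cmod (cnj (E \<eta> y) * f y))"
    unfolding transform_def by (rule integral_norm_bound)
  also have "\<dots> \<le> (LINT y|M. cmod (f y))"
  proof (rule integral_mono)
    show "integrable M (\<lambda>y. cmod (cnj (E \<eta> y) * f y))"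
      by (rule integrable_norm[OF E_mult_integrable[OF f \<eta>]])
  qed (use f E_bounded in \<open>auto simp: norm_mult mult_left_le_one_le\<close>)
  finally show ?thesis .
qed

text \<open>The factor exp (- t \<Lambda>) provides integrability in the frequency and
  \<open>f\<close> provides it in \<open>y\<close>, which permits the exchange of integrals.\<close>

lemma heat_op_transform:
  assumes t: "0 < t" and f: "integrable M f" and x: "x \<in> space M"
  shows "heat_op t f x =
    complex_of_real c * (LINT \<eta>|M. complex_of_real (exp (- (t * \<Lambda> \<eta>))) * E \<eta> x * transform f \<eta>)"
proof -
  have [measurable]: "f \<in> borel_measurable M" using f by auto
  define H where "H = (\<lambda>y \<eta>. complex_of_real (exp (- (t * \<Lambda> \<eta>))) * E \<eta> x * cnj (E \<eta> y) * f y)"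
  have "integrable (M \<Otimes>\<^sub>M M) (\<lambda>(y, \<eta>). f y * complex_of_real (exp (- (t * \<Lambda> \<eta>))))"
    using f exp_\<Lambda>_integrable[OF t] by (intro MM.integrable_times) auto
  then have int: "integrable (M \<Otimes>\<^sub>M M) (\<lambda>(y, \<eta>). H y \<eta>)"
  proof (rule Bochner_Integration.integrable_bound)
    show "(\<lambda>(y, \<eta>). H y \<eta>) \<in> borel_measurable (M \<Otimes>\<^sub>M M)" unfolding H_def using x by measurable
    have "cmod (H y \<eta>) \<le> cmod (f y * complex_of_real (exp (- (t * \<Lambda> \<eta>))))" for y \<eta>
    proof -
      have "cmod (H y \<eta>) = cmod (f y) * exp (- (t * \<Lambda> \<eta>)) * (cmod (E \<eta> x) * cmod (E \<eta> y))"
        by (simp add: H_def norm_mult)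
      also have "\<dots> \<le> cmod (f y) * exp (- (t * \<Lambda> \<eta>)) * 1"
        by (intro mult_left_mono mult_le_one E_bounded) auto
      finally show ?thesis by (simp add: norm_mult)
    qed
    then show "AE p in M \<Otimes>\<^sub>M M. norm (case p of (y, \<eta>) \<Rightarrow> H y \<eta>) \<le>
        norm (case p of (y, \<eta>) \<Rightarrow> f y * complex_of_real (exp (- (t * \<Lambda> \<eta>))))"
      by (intro AE_I2) auto
  qed
  have "heat_op t f x = (LINT y|M. complex_of_real c * (LINT \<eta>|M. H y \<eta>))"
    unfolding heat_op_def integral_op_def
  proof (intro Bochner_Integration.integral_cong refl)
    fix y assume y: "y \<in> space M"
    show "complex_of_real (K t x y) * f y = complex_of_real c * (LINT \<eta>|M. H y \<eta>)"
      unfolding K_spectral[OF t x y] H_def integral_mult_left_zero by simp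
  qed
  also have "\<dots> = complex_of_real c * (LINT \<eta>|M. LINT y|M. H y \<eta>)"
    using MM.Fubini_integral[OF int] by simp
  also have "(LINT \<eta>|M. LINT y|M. H y \<eta>) = (LINT \<eta>|M. complex_of_real (exp (- (t * \<Lambda> \<eta>))) * E \<eta> x * transform f \<eta>)"
    unfolding transform_def H_def integral_mult_right_zero[symmetric] by (simp add: mult.assoc)
  finally show ?thesis .
qed

lemma heat_op_pairing:
  assumes t: "0 < t" and f: "integrable M f" and g: "integrable M g"
  shows "(LINT x|M. heat_op t f x * cnj (g x)) =
    complex_of_real c * (LINT \<eta>|M. complex_of_real (exp (- (t * \<Lambda> \<eta>))) * (transform f \<eta> * cnj (transform g \<eta>)))"
proof -
  have [measurable]: "f \<in> borel_measurable M" "g \<in> borel_measurable M" using f g by auto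
  define H where "H = (\<lambda>x \<eta>. complex_of_real (exp (- (t * \<Lambda> \<eta>))) * E \<eta> x * transform f \<eta> * cnj (g x))"
  define I where "I = (LINT y|M. cmod (f y))"
  have "integrable (M \<Otimes>\<^sub>M M) (\<lambda>(x, \<eta>). g x * complex_of_real (I * exp (- (t * \<Lambda> \<eta>))))"
    using g exp_\<Lambda>_integrable[OF t]
    by (intro MM.integrable_times) auto
  then have int: "integrable (M \<Otimes>\<^sub>M M) (\<lambda>(x, \<eta>). H x \<eta>)"
  proof (rule Bochner_Integration.integrable_bound)
    show "(\<lambda>(x, \<eta>). H x \<eta>) \<in> borel_measurable (M \<Otimes>\<^sub>M M)" unfolding H_def by measurable
    have "cmod (H x \<eta>) \<le> cmod (g x * complex_of_real (I * exp (- (t * \<Lambda> \<eta>))))" if "\<eta> \<in> space M" for x \<eta>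
    proof -
      have "cmod (H x \<eta>) = cmod (g x) * exp (- (t * \<Lambda> \<eta>)) * (cmod (E \<eta> x) * cmod (transform f \<eta>))"
        by (simp add: H_def norm_mult)
      also have "\<dots> \<le> cmod (g x) * exp (- (t * \<Lambda> \<eta>)) * (1 * I)"
        using transform_bound[OF f that] by (intro mult_left_mono mult_mono E_bounded) (auto simp: I_def)
      also have "\<dots> = cmod (g x * complex_of_real (I * exp (- (t * \<Lambda> \<eta>))))"
        by (simp add: norm_mult I_def)
      finally show ?thesis .
    qed
    then show "AE p in M \<Otimes>\<^sub>M M. norm (case p of (x, \<eta>) \<Rightarrow> H x \<eta>) \<le>
        norm (case p of (x, \<eta>) \<Rightarrow> g x * complex_of_real (I * exp (- (t * \<Lambda> \<eta>))))"
      by (intro AE_I2) (auto simp: space_pair_measure)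
  qed
  have "(LINT x|M. heat_op t f x * cnj (g x)) = (LINT x|M. complex_of_real c * (LINT \<eta>|M. H x \<eta>))"
  proof (intro Bochner_Integration.integral_cong refl)
    fix x assume x: "x \<in> space M"
    show "heat_op t f x * cnj (g x) = complex_of_real c * (LINT \<eta>|M. H x \<eta>)"
      unfolding H_def integral_mult_left_zero heat_op_transform[OF t f x] by (rule mult.assoc)
  qed
  also have "\<dots> = complex_of_real c * (LINT \<eta>|M. LINT x|M. H x \<eta>)"
    using MM.Fubini_integral[OF int] by simp
  also have "(LINT \<eta>|M. LINT x|M. H x \<eta>) =
      (LINT \<eta>|M. complex_of_real (exp (- (t * \<Lambda> \<eta>))) * (transform f \<eta> * cnj (transform g \<eta>)))"
  proof (intro Bochner_Integration.integral_cong refl)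
    fix \<eta>
    have "cnj (transform g \<eta>) = (LINT x|M. cnj (cnj (E \<eta> x) * g x))"
      by (simp only: transform_def Bochner_Integration.integral_cnj)
    then have "complex_of_real (exp (- (t * \<Lambda> \<eta>))) * (transform f \<eta> * cnj (transform g \<eta>)) =
        (LINT x|M. complex_of_real (exp (- (t * \<Lambda> \<eta>))) * transform f \<eta> * (E \<eta> x * cnj (g x)))"
      by (simp add: mult.assoc)
    then show "(LINT x|M. H x \<eta>) = complex_of_real (exp (- (t * \<Lambda> \<eta>))) * (transform f \<eta> * cnj (transform g \<eta>))"
      by (simp add: H_def mult_ac)
  qed
  finally show ?thesis .
qed

text \<open>Only this half of Plancherel's theorem is needed; it is the limit \<open>t \<rightarrow> 0\<close> of
  \<open>\<langle>heat_op t f, f\<rangle> \<le> \<parallel>f\<parallel>\<^sup>2\<close>.\<close>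

lemma
  assumes f: "f \<in> L2 M" and fi: "integrable M f"
  shows transform_L2: "transform f \<in> L2 M"
    and transform_norm: "c * (l2norm M (transform f))\<^sup>2 \<le> (l2norm M f)\<^sup>2"
proof -
  note [measurable] = L2_measurable[OF f]
  define u where "u = (\<lambda>n \<eta>. ennreal (exp (- (1 / real (Suc n) * \<Lambda> \<eta>)) * (cmod (transform f \<eta>))\<^sup>2))"
  have b: "(\<integral>\<^sup>+\<eta>. u n \<eta> \<partial>M) \<le> ennreal ((l2norm M f)\<^sup>2 / c)" for n
  proof -
    define t where "t = 1 / real (Suc n)"
    have t: "0 < t" by (simp add: t_def)
    have i: "integrable M (\<lambda>\<eta>. exp (- (t * \<Lambda> \<eta>)) * (cmod (transform f \<eta>))\<^sup>2)"
    proof (rule Bochner_Integration.integrable_bound)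
      show "integrable M (\<lambda>\<eta>. exp (- (t * \<Lambda> \<eta>)) * (LINT y|M. cmod (f y))\<^sup>2)"
        using exp_\<Lambda>_integrable[OF t] by simp
      show "AE \<eta> in M. norm (exp (- (t * \<Lambda> \<eta>)) * (cmod (transform f \<eta>))\<^sup>2)
          \<le> norm (exp (- (t * \<Lambda> \<eta>)) * (LINT y|M. cmod (f y))\<^sup>2)"
        using transform_bound[OF fi] by (intro AE_I2) (simp add: power_mono)
    qed measurable
    have "complex_of_real c * complex_of_real (LINT \<eta>|M. exp (- (t * \<Lambda> \<eta>)) * (cmod (transform f \<eta>))\<^sup>2) =
        (LINT x|M. heat_op t f x * cnj (f x))"
      unfolding heat_op_pairing[OF t fi fi] integral_complex_of_real[symmetric]
      by (simp add: complex_norm_square del: of_real_power)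
    then have "cmod (complex_of_real c * complex_of_real (LINT \<eta>|M. exp (- (t * \<Lambda> \<eta>)) * (cmod (transform f \<eta>))\<^sup>2)) \<le> (l2norm M f)\<^sup>2"
      using heat_op_pairing_bound[OF f L2_cnj[OF f], of t] by (simp add: l2norm_def power2_eq_square)
    then have "c * (LINT \<eta>|M. exp (- (t * \<Lambda> \<eta>)) * (cmod (transform f \<eta>))\<^sup>2) \<le> (l2norm M f)\<^sup>2"
      using c_pos by (simp add: norm_mult)
    then have "(LINT \<eta>|M. exp (- (t * \<Lambda> \<eta>)) * (cmod (transform f \<eta>))\<^sup>2) \<le> (l2norm M f)\<^sup>2 / c"
      using c_pos by (simp add: field_simps)
    moreover have "(\<integral>\<^sup>+\<eta>. u n \<eta> \<partial>M) = ennreal (LINT \<eta>|M. exp (- (t * \<Lambda> \<eta>)) * (cmod (transform f \<eta>))\<^sup>2)"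
      unfolding u_def t_def[symmetric] by (rule nn_integral_eq_integral[OF i]) simp
    ultimately show ?thesis by (simp add: ennreal_leI)
  qed
  have lim: "(\<lambda>n. u n \<eta>) \<longlonglongrightarrow> ennreal ((cmod (transform f \<eta>))\<^sup>2)" for \<eta>
  proof -
    have "(\<lambda>n. exp (- (1 / real (Suc n) * \<Lambda> \<eta>)) * (cmod (transform f \<eta>))\<^sup>2) \<longlonglongrightarrow>
        exp (- (0 * \<Lambda> \<eta>)) * (cmod (transform f \<eta>))\<^sup>2"
      by (intro tendsto_intros LIMSEQ_Suc lim_1_over_n)
    then show ?thesis unfolding u_def by (intro tendsto_ennrealI) simp
  qed
  \<comment> \<open>Fatou's lemma along t = 1 / (n + 1), where the bound \<open>b\<close> is uniform
    in n. Square integrability of the transform is part of the outcome.\<close>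
  have "(\<integral>\<^sup>+\<eta>. ennreal ((cmod (transform f \<eta>))\<^sup>2) \<partial>M) = (\<integral>\<^sup>+\<eta>. liminf (\<lambda>n. u n \<eta>) \<partial>M)"
    by (intro nn_integral_cong lim_imp_Liminf[symmetric] lim) simp
  also have "\<dots> \<le> liminf (\<lambda>n. integral\<^sup>N M (u n))"
    by (rule nn_integral_liminf) (simp add: u_def)
  also have "\<dots> \<le> ennreal ((l2norm M f)\<^sup>2 / c)"
    by (rule Liminf_le) (auto simp: b)
  finally have nn: "(\<integral>\<^sup>+\<eta>. ennreal ((cmod (transform f \<eta>))\<^sup>2) \<partial>M) \<le> ennreal ((l2norm M f)\<^sup>2 / c)" .
  have i: "integrable M (\<lambda>\<eta>. (cmod (transform f \<eta>))\<^sup>2)"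
    by (rule integrableI_bounded) (use le_less_trans[OF nn] in auto)
  then show "transform f \<in> L2 M" by (simp add: L2_def)
  have "ennreal ((l2norm M (transform f))\<^sup>2) \<le> ennreal ((l2norm M f)\<^sup>2 / c)"
    unfolding l2norm_square[of M "transform f"] using nn nn_integral_eq_integral[OF i] by simp
  then have "(l2norm M (transform f))\<^sup>2 \<le> (l2norm M f)\<^sup>2 / c"
    using c_pos by (simp add: ennreal_le_iff)
  then show "c * (l2norm M (transform f))\<^sup>2 \<le> (l2norm M f)\<^sup>2"
    using c_pos by (simp add: field_simps)
qed

lemma transform_mult_integrable:
  assumes f: "f \<in> L2 M" "integrable M f" and g: "g \<in> L2 M" "integrable M g"
  shows "integrable M (\<lambda>\<eta>. transform f \<eta> * cnj (transform g \<eta>))"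
  by (intro L2_prod_integrable L2_cnj transform_L2 f g)

text \<open>The Laplace integral of exp (- t (\<Lambda> - \<mu>)) is 1 / (\<Lambda> - \<mu>), the
  symbol of the resolvent. Since \<Lambda> is nonnegative, exp (\<mu> t) dominates in t, uniformly
  in the frequency.\<close>

lemma green_transform_pairing:
  assumes \<mu>: "\<mu> < 0" and f: "f \<in> L2 M" "integrable M f" and g: "g \<in> L2 M" "integrable M g"
  shows "(LINT x|M. green \<mu> f x * cnj (g x)) =
    complex_of_real c * (LINT \<eta>|M. complex_of_real (1 / (\<Lambda> \<eta> - \<mu>)) * (transform f \<eta> * cnj (transform g \<eta>)))"
proof -
  interpret T: pair_sigma_finite lborel M ..
  have [measurable]: "f \<in> borel_measurable M" "g \<in> borel_measurable M" using f g by auto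
  define h where "h = (\<lambda>\<eta>. transform f \<eta> * cnj (transform g \<eta>))"
  define H where "H = (\<lambda>t \<eta>. complex_of_real (indicator {0<..} t * exp (- (t * (\<Lambda> \<eta> - \<mu>)))) * h \<eta>)"
  have [measurable]: "h \<in> borel_measurable M" unfolding h_def by measurable
  have hi: "integrable M h" unfolding h_def by (rule transform_mult_integrable[OF f g])
  have hb: "has_bochner_integral lborel (\<lambda>t. indicator {0<..} t * exp (- (t * a))) (1 / a)" if "a > 0" for a :: real
    using exp_half_line[OF that] .
  have "integrable (lborel \<Otimes>\<^sub>M M) (\<lambda>(t, \<eta>). complex_of_real (indicator {0<..} t * exp (- (t * (- \<mu>)))) * h \<eta>)"
    using hb[of "- \<mu>"] \<mu> hi by (intro T.integrable_times) (auto simp: has_bochner_integral_iff simp del: of_real_mult)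
  then have int: "integrable (lborel \<Otimes>\<^sub>M M) (\<lambda>(t, \<eta>). H t \<eta>)"
  proof (rule Bochner_Integration.integrable_bound)
    show "(\<lambda>(t, \<eta>). H t \<eta>) \<in> borel_measurable (lborel \<Otimes>\<^sub>M M)" unfolding H_def by measurable
    have "cmod (H t \<eta>) \<le> cmod (complex_of_real (indicator {0<..} t * exp (- (t * (- \<mu>)))) * h \<eta>)" for t \<eta>
    proof -
      have "- (t * (\<Lambda> \<eta> - \<mu>)) \<le> - (t * (- \<mu>))" if "0 < t"
        using that \<Lambda>_nonneg[of \<eta>] by (simp add: right_diff_distrib)
      then show ?thesis
        by (auto simp: H_def norm_mult mult_right_mono split: split_indicator)
    qed
    then show "AE p in lborel \<Otimes>\<^sub>M M. norm (case p of (t, \<eta>) \<Rightarrow> H t \<eta>) \<le>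
        norm (case p of (t, \<eta>) \<Rightarrow> complex_of_real (indicator {0<..} t * exp (- (t * (- \<mu>)))) * h \<eta>)"
      by (intro AE_I2) auto
  qed
  have "(LINT x|M. green \<mu> f x * cnj (g x)) =
      (LINT t|lborel. complex_of_real (exp (\<mu> * t)) * (LINT x|M. heat_op t f x * cnj (g x)))"
    by (rule green_pairing[OF \<mu> f(1) L2_cnj[OF g(1)]])
  also have "\<dots> = (LINT t|lborel. complex_of_real c * (LINT \<eta>|M. H t \<eta>))"
  proof (intro Bochner_Integration.integral_cong refl)
    fix t
    show "complex_of_real (exp (\<mu> * t)) * (LINT x|M. heat_op t f x * cnj (g x)) =
        complex_of_real c * (LINT \<eta>|M. H t \<eta>)"
    proof (cases "0 < t")
      case True
      have "exp (\<mu> * t) * exp (- (t * \<Lambda> \<eta>)) = exp (- (t * (\<Lambda> \<eta> - \<mu>)))" for \<eta>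
        by (simp add: exp_add[symmetric] algebra_simps)
      then have "complex_of_real (exp (\<mu> * t)) * (complex_of_real (exp (- (t * \<Lambda> \<eta>))) * h \<eta>) = H t \<eta>" for \<eta>
        using True by (simp add: H_def mult.assoc[symmetric] flip: of_real_mult)
      then have "complex_of_real (exp (\<mu> * t)) * (LINT \<eta>|M. complex_of_real (exp (- (t * \<Lambda> \<eta>))) * h \<eta>) = (LINT \<eta>|M. H t \<eta>)"
        unfolding integral_mult_right_zero[symmetric] by simp
      then show ?thesis using heat_op_pairing[OF True f(2) g(2)] by (simp add: h_def mult.left_commute)
    qed (simp add: heat_op_nonpos H_def)
  qed
  also have "\<dots> = complex_of_real c * (LINT \<eta>|M. LINT t|lborel. H t \<eta>)"
    using T.Fubini_integral[OF int] by simp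
  also have "(LINT \<eta>|M. LINT t|lborel. H t \<eta>) = (LINT \<eta>|M. complex_of_real (1 / (\<Lambda> \<eta> - \<mu>)) * h \<eta>)"
  proof (intro Bochner_Integration.integral_cong refl)
    fix \<eta>
    have "(LINT t|lborel. indicator {0<..} t * exp (- (t * (\<Lambda> \<eta> - \<mu>)))) = 1 / (\<Lambda> \<eta> - \<mu>)"
      using hb[of "\<Lambda> \<eta> - \<mu>"] \<Lambda>_nonneg[of \<eta>] \<mu> by (simp add: has_bochner_integral_iff)
    then show "(LINT t|lborel. H t \<eta>) = complex_of_real (1 / (\<Lambda> \<eta> - \<mu>)) * h \<eta>"
      unfolding H_def integral_mult_left_zero integral_complex_of_real by simp
  qed
  finally show ?thesis by (simp add: h_def)
qed

text \<open>The bound is first obtained for integrable \<open>f\<close>, whose transform exists. For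
  general \<open>f\<close> the crude norm bound \<open>C\<close>, which depends on the weights,
  multiplies only the norm of a truncation tail and disappears in the limit.\<close>

theorem multiplier_bound:
  fixes w \<tau> :: "nat \<Rightarrow> real"
  assumes \<mu>: "\<mu> < 0" and \<tau>: "\<And>j. j < L \<Longrightarrow> 0 < \<tau> j" and B: "0 \<le> B"
    and r: "\<And>s. 0 \<le> s \<Longrightarrow> \<bar>1 / (s - \<mu>) - (\<Sum>j<L. w j * exp (- (\<tau> j * s)))\<bar> \<le> B"
    and f: "f \<in> L2 M"
  shows "l2norm M (\<lambda>x. green \<mu> f x - (\<Sum>j<L. complex_of_real (w j) * heat_op (\<tau> j) f x)) \<le> B * l2norm M f"
proof -
  define D where "D = (\<lambda>f x. green \<mu> f x - (\<Sum>j<L. complex_of_real (w j) * heat_op (\<tau> j) f x))"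
  define C where "C = 1 / - \<mu> + (\<Sum>j<L. \<bar>w j\<bar>)"
  have sum_L2: "(\<lambda>x. \<Sum>j<L. complex_of_real (w j) * heat_op (\<tau> j) f x) \<in> L2 M" if "f \<in> L2 M" for f
    using that by (intro L2_sum L2_scale heat_op_L2)
  have D_L2: "D f \<in> L2 M" if "f \<in> L2 M" for f
    unfolding D_def using that by (intro L2_diff green_L2 \<mu> sum_L2)
  have D_bound: "l2norm M (D f) \<le> C * l2norm M f" if f: "f \<in> L2 M" for f
  proof -
    have "l2norm M (D f) \<le> l2norm M (green \<mu> f) + l2norm M (\<lambda>x. - 1 * (\<Sum>j<L. complex_of_real (w j) * heat_op (\<tau> j) f x))"
      using l2norm_triangle[OF green_L2[OF \<mu> f] L2_scale[OF sum_L2[OF f], of "- 1"]] by (simp add: D_def)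
    also have "l2norm M (\<lambda>x. - 1 * (\<Sum>j<L. complex_of_real (w j) * heat_op (\<tau> j) f x))
        = l2norm M (\<lambda>x. \<Sum>j<L. complex_of_real (w j) * heat_op (\<tau> j) f x)"
      unfolding l2norm_scale by simp
    also have "\<dots> \<le> (\<Sum>j<L. l2norm M (\<lambda>x. complex_of_real (w j) * heat_op (\<tau> j) f x))"
      by (intro l2norm_sum L2_scale heat_op_L2 f)
    also have "\<dots> \<le> (\<Sum>j<L. \<bar>w j\<bar> * l2norm M f)"
      unfolding l2norm_scale by (intro sum_mono) (simp add: mult_left_mono heat_op_norm[OF f])
    finally show ?thesis
      using green_norm[OF \<mu> f] unfolding C_def distrib_right sum_distrib_right by linarith
  qed
  have D_add: "AE x in M. D (\<lambda>y. f y + g y) x = D f x + D g x" if f: "f \<in> L2 M" and g: "g \<in> L2 M" for f g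
  proof -
    have "AE x in M. \<forall>j\<in>{..<L}. heat_op (\<tau> j) (\<lambda>y. f y + g y) x = heat_op (\<tau> j) f x + heat_op (\<tau> j) g x"
      using bounded_heat_op f g by (intro AE_finite_allI) (auto simp: bounded_op_def)
    moreover have "AE x in M. green \<mu> (\<lambda>y. f y + g y) x = green \<mu> f x + green \<mu> g x"
      using bounded_green[OF \<mu>] f g by (auto simp: bounded_op_def)
    ultimately show ?thesis
      by eventually_elim (simp add: D_def distrib_left sum.distrib)
  qed
  have D_pairing: "cmod (LINT x|M. D f x * cnj (g x)) \<le> B * l2norm M f * l2norm M g"
    if f: "f \<in> L2 M" "integrable M f" and g: "g \<in> L2 M" "integrable M g" for f g
  proof -
    define h where "h = (\<lambda>\<eta>. transform f \<eta> * cnj (transform g \<eta>))"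
    define \<rho> where "\<rho> = (\<lambda>\<eta>. 1 / (\<Lambda> \<eta> - \<mu>) - (\<Sum>j<L. w j * exp (- (\<tau> j * \<Lambda> \<eta>))))"
    have hi: "integrable M h" unfolding h_def by (rule transform_mult_integrable[OF f g])
    have [measurable]: "h \<in> borel_measurable M" using hi by auto
    have ei: "integrable M (\<lambda>\<eta>. complex_of_real (exp (- (t * \<Lambda> \<eta>))) * h \<eta>)" if "0 < t" for t
      by (rule Bochner_Integration.integrable_bound[OF hi])
         (use that \<Lambda>_nonneg in \<open>auto simp: norm_mult intro!: mult_left_le_one_le\<close>)
    have gi: "integrable M (\<lambda>\<eta>. complex_of_real (1 / (\<Lambda> \<eta> - \<mu>)) * h \<eta>)"
    proof (rule Bochner_Integration.integrable_bound)
      show "integrable M (\<lambda>\<eta>. complex_of_real (1 / - \<mu>) * h \<eta>)" using hi by simp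
      have "\<bar>1 / (\<Lambda> \<eta> - \<mu>)\<bar> \<le> \<bar>1 / - \<mu>\<bar>" for \<eta>
        using \<Lambda>_nonneg[of \<eta>] \<mu> frac_le[of 1 1 "- \<mu>" "\<Lambda> \<eta> - \<mu>"] by simp
      then show "AE \<eta> in M. norm (complex_of_real (1 / (\<Lambda> \<eta> - \<mu>)) * h \<eta>) \<le> norm (complex_of_real (1 / - \<mu>) * h \<eta>)"
        unfolding norm_mult norm_of_real by (intro AE_I2 mult_right_mono) auto
    qed measurable
    have "(LINT x|M. D f x * cnj (g x)) = (LINT x|M. green \<mu> f x * cnj (g x)) -
        (\<Sum>j<L. complex_of_real (w j) * (LINT x|M. heat_op (\<tau> j) f x * cnj (g x)))"
    proof -
      have 1: "integrable M (\<lambda>x. green \<mu> f x * cnj (g x))"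
        by (intro L2_prod_integrable green_L2 L2_cnj f g \<mu>)
      have 2: "integrable M (\<lambda>x. heat_op (\<tau> j) f x * cnj (g x))" for j
        by (intro L2_prod_integrable heat_op_L2 L2_cnj f g)
      have "(\<lambda>x. D f x * cnj (g x)) = (\<lambda>x. green \<mu> f x * cnj (g x) - (\<Sum>j<L. complex_of_real (w j) * (heat_op (\<tau> j) f x * cnj (g x))))"
        by (simp add: D_def left_diff_distrib sum_distrib_right mult.assoc)
      then show ?thesis using 1 2 by simp
    qed
    also have "\<dots> = complex_of_real c * ((LINT \<eta>|M. complex_of_real (1 / (\<Lambda> \<eta> - \<mu>)) * h \<eta>) -
        (\<Sum>j<L. complex_of_real (w j) * (LINT \<eta>|M. complex_of_real (exp (- (\<tau> j * \<Lambda> \<eta>))) * h \<eta>)))"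
      using heat_op_pairing[OF \<tau> f(2) g(2)] unfolding green_transform_pairing[OF \<mu> f g] h_def[symmetric]
      by (simp add: right_diff_distrib sum_distrib_left mult.left_commute h_def)
    also have "\<dots> = complex_of_real c * (LINT \<eta>|M. complex_of_real (\<rho> \<eta>) * h \<eta>)"
    proof -
      have "(LINT \<eta>|M. complex_of_real (\<rho> \<eta>) * h \<eta>) = (LINT \<eta>|M. complex_of_real (1 / (\<Lambda> \<eta> - \<mu>)) * h \<eta> -
          (\<Sum>j<L. complex_of_real (w j) * (complex_of_real (exp (- (\<tau> j * \<Lambda> \<eta>))) * h \<eta>)))"
        by (simp add: \<rho>_def left_diff_distrib sum_distrib_right mult.assoc)
      also have "\<dots> = (LINT \<eta>|M. complex_of_real (1 / (\<Lambda> \<eta> - \<mu>)) * h \<eta>) -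
          (LINT \<eta>|M. (\<Sum>j<L. complex_of_real (w j) * (complex_of_real (exp (- (\<tau> j * \<Lambda> \<eta>))) * h \<eta>)))"
        using gi ei \<tau> by (intro Bochner_Integration.integral_diff Bochner_Integration.integrable_sum) auto
      also have "(LINT \<eta>|M. (\<Sum>j<L. complex_of_real (w j) * (complex_of_real (exp (- (\<tau> j * \<Lambda> \<eta>))) * h \<eta>))) =
          (\<Sum>j<L. complex_of_real (w j) * (LINT \<eta>|M. complex_of_real (exp (- (\<tau> j * \<Lambda> \<eta>))) * h \<eta>))"
        using ei \<tau> by (subst Bochner_Integration.integral_sum) auto
      finally show ?thesis by simp
    qed
    finally have "cmod (LINT x|M. D f x * cnj (g x)) = c * cmod (LINT \<eta>|M. complex_of_real (\<rho> \<eta>) * h \<eta>)"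
      using c_pos by (simp add: norm_mult)
    also have "\<dots> \<le> c * (LINT \<eta>|M. B * cmod (h \<eta>))"
    proof (intro mult_left_mono)
      have "cmod (LINT \<eta>|M. complex_of_real (\<rho> \<eta>) * h \<eta>) \<le> (LINT \<eta>|M. cmod (complex_of_real (\<rho> \<eta>) * h \<eta>))"
        by (rule integral_norm_bound)
      also have "\<dots> \<le> (LINT \<eta>|M. B * cmod (h \<eta>))"
      proof (rule integral_mono')
        show "integrable M (\<lambda>\<eta>. B * cmod (h \<eta>))" using hi by simp
        show "cmod (complex_of_real (\<rho> \<eta>) * h \<eta>) \<le> B * cmod (h \<eta>)" for \<eta>
          using r[OF \<Lambda>_nonneg[of \<eta>]] by (simp add: norm_mult \<rho>_def mult_right_mono del: of_real_diff of_real_sum)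
      qed (use B in auto)
      finally show "cmod (LINT \<eta>|M. complex_of_real (\<rho> \<eta>) * h \<eta>) \<le> (LINT \<eta>|M. B * cmod (h \<eta>))" .
    qed (use c_pos in simp)
    also have "\<dots> \<le> c * (B * (l2norm M (transform f) * l2norm M (transform g)))"
    proof -
      have "(LINT \<eta>|M. cmod (h \<eta>)) \<le> l2norm M (transform f) * l2norm M (\<lambda>x. cnj (transform g x))"
        using L2_Cauchy_Schwarz_norm[OF transform_L2[OF f] L2_cnj[OF transform_L2[OF g]]]
        by (simp add: h_def norm_mult)
      then show ?thesis using c_pos B by (simp add: mult_left_mono l2norm_def)
    qed
    \<comment> \<open>\<open>c\<close> is split as sqrt c times sqrt c, one factor for each
      application of Bessel's inequality \<open>transform_norm\<close>.\<close>
    also have "\<dots> = B * ((sqrt c * l2norm M (transform f)) * (sqrt c * l2norm M (transform g)))"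
      using c_pos by (simp add: mult_ac)
    also have "\<dots> \<le> B * (l2norm M f * l2norm M g)"
    proof (intro mult_left_mono mult_mono B)
      have le: "sqrt c * l2norm M (transform f) \<le> l2norm M f" if "f \<in> L2 M" "integrable M f" for f
      proof (rule power2_le_imp_le)
        show "(sqrt c * l2norm M (transform f))\<^sup>2 \<le> (l2norm M f)\<^sup>2"
          using transform_norm[OF that] c_pos by (simp only: power_mult_distrib real_sqrt_pow2 less_imp_le)
      qed simp
      show "sqrt c * l2norm M (transform f) \<le> l2norm M f" "sqrt c * l2norm M (transform g) \<le> l2norm M g"
        using le f g by auto
    qed (use c_pos in auto)
    finally show ?thesis by (simp add: mult.assoc)
  qed
  have D_L1: "l2norm M (D f) \<le> B * l2norm M f" if "f \<in> L2 M" "integrable M f" for f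
    using that B by (intro l2norm_dual D_L2 D_pairing) auto
  obtain A where A: "\<And>n. A n \<in> sets M" "\<And>n. integrable M (\<lambda>x. f x * indicator (A n) x)"
    "(\<lambda>n. l2norm M (\<lambda>x. f x * indicator (- A n) x)) \<longlonglongrightarrow> 0"
    using L2_truncation f by metis
  have "l2norm M (D f) \<le> B * l2norm M f + C * l2norm M (\<lambda>x. f x * indicator (- A n) x)" for n
  proof -
    define f1 where "f1 = (\<lambda>x. f x * indicator (A n) x)"
    define f2 where "f2 = (\<lambda>x. f x * indicator (- A n) x)"
    note s = indicator_split_L2[OF f A(1)[of n], folded f1_def f2_def]
    have "AE x in M. D f x = D f1 x + D f2 x"
      using D_add[OF s(1,2)] unfolding f1_def f2_def indicator_split_L2(3)[OF f A(1)[of n], symmetric] .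
    then have "l2norm M (D f) = l2norm M (\<lambda>x. D f1 x + D f2 x)"
      using s by (intro l2norm_cong_AE D_L2 L2_add f) auto
    also have "\<dots> \<le> l2norm M (D f1) + l2norm M (D f2)"
      using s by (intro l2norm_triangle D_L2)
    also have "l2norm M (D f1) \<le> B * l2norm M f"
      using D_L1[OF s(1) A(2)[of n, folded f1_def]] mult_left_mono[OF s(4) B] by linarith
    also have "l2norm M (D f2) \<le> C * l2norm M f2" using D_bound s by simp
    finally show ?thesis by (simp add: f2_def)
  qed
  moreover have "(\<lambda>n. B * l2norm M f + C * l2norm M (\<lambda>x. f x * indicator (- A n) x)) \<longlonglongrightarrow> B * l2norm M f + C * 0"
    by (intro tendsto_intros A)
  ultimately have "l2norm M (D f) \<le> B * l2norm M f"
    by (intro LIMSEQ_le_const) auto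
  then show ?thesis by (simp add: D_def)
qed

end

section \<open>The Gaussian kernel on configurations\<close>

text \<open>\<open>t\<close> is the variance, which fits a generator equal to half the
  Laplacian.\<close>

abbreviation gauss :: "real \<Rightarrow> real \<Rightarrow> real" where
  "gauss t \<equiv> normal_density 0 (sqrt t)"

lemma gauss_eq: "0 < t \<Longrightarrow> gauss t a = 1 / sqrt (2 * pi * t) * exp (- a\<^sup>2 / (2 * t))"
  by (simp add: normal_density_def)

text \<open>Up to a constant, exp (- t s^2 / 2) is the standard normal density at sqrt t s. A linear
  substitution therefore turns the integral into the characteristic function of the normal
  distribution at a / sqrt t.\<close>

lemma gauss_fourier:
  assumes t: "0 < t"
  shows "integrable lborel (\<lambda>s. complex_of_real (exp (- (t * s\<^sup>2 / 2))) * cis (s * a))"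
    and "(LINT s|lborel. complex_of_real (exp (- (t * s\<^sup>2 / 2))) * cis (s * a)) = complex_of_real (2 * pi * gauss t a)"
proof -
  define h where "h = (\<lambda>x. complex_of_real (std_normal_density x) * cis (a / sqrt t * x))"
  have "integrable lborel (\<lambda>x. complex_of_real (std_normal_density x))" by simp
  then have hi: "integrable lborel h"
  proof (rule Bochner_Integration.integrable_bound)
    have "continuous_on UNIV (\<lambda>x. cis (a / sqrt t * x))" by (intro continuous_intros)
    then have [measurable]: "(\<lambda>x. cis (a / sqrt t * x)) \<in> borel_measurable borel"
      by (rule borel_measurable_continuous_onI)
    show "h \<in> borel_measurable lborel" unfolding h_def by measurable
  qed (simp add: h_def norm_mult)
  have "(LINT x|lborel. h x) = char std_normal_distribution (a / sqrt t)"
    unfolding char_def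
  proof (subst integral_density)
    show "(\<lambda>x. iexp (a / sqrt t * x)) \<in> borel_measurable lborel"
      unfolding measurable_lborel2 by (intro borel_measurable_continuous_onI continuous_intros)
  qed (auto simp: h_def cis_conv_exp scaleR_conv_of_real)
  also have "\<dots> = complex_of_real (exp (- (a\<^sup>2 / (2 * t))))"
    using t by (simp add: char_std_normal_distribution power_divide)
  finally have he: "(LINT x|lborel. h x) = complex_of_real (exp (- (a\<^sup>2 / (2 * t))))" .
  have hs: "h (0 + sqrt t * s) = complex_of_real (1 / sqrt (2 * pi)) * (complex_of_real (exp (- (t * s\<^sup>2 / 2))) * cis (s * a))" for s
    using t by (simp add: h_def std_normal_density_def power_mult_distrib mult_ac)
  have hi': "integrable lborel (\<lambda>s. h (0 + sqrt t * s))"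
    by (rule lborel_integrable_real_affine[OF hi]) (use t in simp)
  moreover have "complex_of_real (sqrt (2 * pi)) * h (0 + sqrt t * s) =
      complex_of_real (exp (- (t * s\<^sup>2 / 2))) * cis (s * a)" for s
    unfolding hs mult.assoc[symmetric] of_real_mult[symmetric] by simp
  ultimately show "integrable lborel (\<lambda>s. complex_of_real (exp (- (t * s\<^sup>2 / 2))) * cis (s * a))"
    using integrable_mult_right[of "complex_of_real (sqrt (2 * pi))" lborel "\<lambda>s. h (0 + sqrt t * s)"] by simp
  have "(LINT x|lborel. h x) = sqrt t *\<^sub>R (LINT s|lborel. h (0 + sqrt t * s))"
    using lborel_integral_real_affine[of "sqrt t" h 0] t by simp
  also have "\<dots> = complex_of_real (sqrt t / sqrt (2 * pi)) * (LINT s|lborel. complex_of_real (exp (- (t * s\<^sup>2 / 2))) * cis (s * a))"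
    unfolding hs by (simp add: scaleR_conv_of_real)
  finally have "complex_of_real (sqrt t / sqrt (2 * pi)) * (LINT s|lborel. complex_of_real (exp (- (t * s\<^sup>2 / 2))) * cis (s * a))
      = complex_of_real (exp (- (a\<^sup>2 / (2 * t))))" using he by simp
  moreover have "sqrt t / sqrt (2 * pi) * (2 * pi * gauss t a) = exp (- (a\<^sup>2 / (2 * t)))"
    using t by (simp add: gauss_eq real_sqrt_mult field_simps)
  ultimately have "complex_of_real (sqrt t / sqrt (2 * pi)) * (LINT s|lborel. complex_of_real (exp (- (t * s\<^sup>2 / 2))) * cis (s * a))
      = complex_of_real (sqrt t / sqrt (2 * pi)) * complex_of_real (2 * pi * gauss t a)"
    by (metis of_real_mult)
  then show "(LINT s|lborel. complex_of_real (exp (- (t * s\<^sup>2 / 2))) * cis (s * a)) = complex_of_real (2 * pi * gauss t a)"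
    using t by simp
qed

lemma gauss_convolution:
  assumes s: "0 < s" and t: "0 < t"
  shows "integrable lborel (\<lambda>y. gauss s (x - y) * gauss t (y - z))"
    and "(LINT y|lborel. gauss s (x - y) * gauss t (y - z)) = gauss (s + t) (x - z)"
proof -
  have "(\<integral>\<^sup>+y. ennreal (gauss s ((x - z) - y) * gauss t y) \<partial>lborel) = ennreal (gauss (s + t) (x - z))"
    using conv_normal_density_zero_mean[of "sqrt s" "sqrt t"] s t by (simp add: fun_eq_iff)
  then have "has_bochner_integral lborel (\<lambda>y. gauss s ((x - z) - y) * gauss t y) (gauss (s + t) (x - z))"
    by (intro has_bochner_integral_nn_integral) auto
  then have i: "integrable lborel (\<lambda>y. gauss s ((x - z) - y) * gauss t y)"
    "(LINT y|lborel. gauss s ((x - z) - y) * gauss t y) = gauss (s + t) (x - z)"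
    by (auto simp: has_bochner_integral_iff)
  show "integrable lborel (\<lambda>y. gauss s (x - y) * gauss t (y - z))"
    using lborel_integrable_real_affine[OF i(1), of 1 "- z"] by simp
  show "(LINT y|lborel. gauss s (x - y) * gauss t (y - z)) = gauss (s + t) (x - z)"
    using lborel_integral_real_affine[of 1 "\<lambda>y. gauss s ((x - z) - y) * gauss t y" "- z"] i(2) by simp
qed

lemma lborel_prod_integral:
  fixes g :: "'v::euclidean_space \<Rightarrow> real \<Rightarrow> 'b::{real_normed_field, banach, second_countable_topology}"
  assumes g: "\<And>b. b \<in> Basis \<Longrightarrow> integrable lborel (g b)"
  shows "integrable lborel (\<lambda>v. \<Prod>b\<in>Basis. g b (v \<bullet> b))"
    and "(LINT v|lborel. (\<Prod>b\<in>Basis. g b (v \<bullet> b))) = (\<Prod>b\<in>Basis. (LINT s|lborel. g b s))"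
proof -
  interpret product_sigma_finite "\<lambda>_::'v. lborel :: real measure" ..
  let ?T = "\<lambda>f. \<Sum>b\<in>Basis. f b *\<^sub>R (b::'v)"
  have [measurable]: "g b \<in> borel_measurable borel" if "b \<in> Basis" for b
    using g[OF that] by auto
  have m: "(\<lambda>v. \<Prod>b\<in>Basis. g b (v \<bullet> b)) \<in> borel_measurable borel" by measurable
  have T: "?T \<in> measurable (Pi\<^sub>M Basis (\<lambda>_. lborel)) borel" by measurable
  have e: "(\<Prod>b\<in>Basis. g b (?T f \<bullet> b)) = (\<Prod>b\<in>Basis. g b (f b))" for f
    by (intro prod.cong refl) (simp add: inner_sum_left_Basis)
  show "integrable lborel (\<lambda>v. \<Prod>b\<in>Basis. g b (v \<bullet> b))"
    unfolding lborel_eq[where 'a='v] integrable_distr_eq[OF T m] e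
    by (rule product_integrable_prod[OF finite_Basis g])
  have "(LINT v|lborel. (\<Prod>b\<in>Basis. g b (v \<bullet> b))) = (LINT v|(distr (Pi\<^sub>M Basis (\<lambda>_. lborel)) borel ?T). (\<Prod>b\<in>Basis. g b (v \<bullet> b)))"
    by (subst lborel_eq) (rule refl)
  also have "\<dots> = (LINT f|(Pi\<^sub>M Basis (\<lambda>_. lborel)). (\<Prod>b\<in>Basis. g b (f b)))"
    unfolding integral_distr[OF T m] e ..
  also have "\<dots> = (\<Prod>b\<in>Basis. (LINT s|lborel. g b s))"
    by (rule product_integral_prod[OF finite_Basis g])
  finally show "(LINT v|lborel. (\<Prod>b\<in>Basis. g b (v \<bullet> b))) = (\<Prod>b\<in>Basis. (LINT s|lborel. g b s))" .
qed

section \<open>Gaussians in three dimensions\<close>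

definition gauss3 :: "real \<Rightarrow> real ^ 3 \<Rightarrow> real" where
  "gauss3 t v = (1 / sqrt (2 * pi * t)) ^ 3 * exp (- (norm v)\<^sup>2 / (2 * t))"

lemma norm_square_Basis: "(norm v)\<^sup>2 = (\<Sum>b\<in>Basis. (v \<bullet> b)\<^sup>2)" for v :: "'v::euclidean_space"
  unfolding power2_norm_eq_inner by (subst euclidean_inner) (simp add: power2_eq_square)

lemma gauss3_prod: "0 < t \<Longrightarrow> gauss3 t v = (\<Prod>b\<in>Basis. gauss t (v \<bullet> b))"
proof -
  assume t: "0 < t"
  have "(\<Prod>b\<in>Basis. gauss t (v \<bullet> b)) = (\<Prod>b\<in>(Basis :: (real ^ 3) set). 1 / sqrt (2 * pi * t)) * exp (\<Sum>b\<in>Basis. - (v \<bullet> b)\<^sup>2 / (2 * t))"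
    by (simp only: gauss_eq[OF t] prod.distrib exp_sum finite_Basis)
  also have "(\<Sum>b\<in>Basis. - (v \<bullet> b)\<^sup>2 / (2 * t)) = - (norm v)\<^sup>2 / (2 * t)"
    by (simp add: norm_square_Basis sum_negf sum_divide_distrib)
  finally show ?thesis by (simp add: gauss3_def)
qed

lemma gauss3_integral:
  assumes t: "0 < t"
  shows "integrable lborel (\<lambda>v. gauss3 t (w - v))" "(LINT v|lborel. gauss3 t (w - v)) = 1"
proof -
  have i: "integrable lborel (\<lambda>s. gauss t (a - s))" "(LINT s|lborel. gauss t (a - s)) = 1" for a
    using lborel_integrable_real_affine[of "gauss t" "- 1" a] lborel_integral_real_affine[of "- 1" "gauss t" a] t
    by simp_all
  note p = lborel_prod_integral[where g = "\<lambda>b s. gauss t (w \<bullet> b - s)", OF i(1)]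
  show "integrable lborel (\<lambda>v. gauss3 t (w - v))"
    using p(1) t by (simp add: gauss3_prod inner_diff_left)
  show "(LINT v|lborel. gauss3 t (w - v)) = 1"
    using p(2) t i(2) by (simp add: gauss3_prod inner_diff_left)
qed

lemma gauss3_fourier:
  assumes t: "0 < t"
  shows "integrable lborel (\<lambda>\<xi>. complex_of_real (exp (- (t * (norm \<xi>)\<^sup>2 / 2))) * cis (\<xi> \<bullet> v))"
    and "complex_of_real (gauss3 t v) = complex_of_real ((1 / (2 * pi)) ^ 3) *
      (LINT \<xi>|lborel. complex_of_real (exp (- (t * (norm \<xi>)\<^sup>2 / 2))) * cis (\<xi> \<bullet> v))"
proof -
  have e: "complex_of_real (exp (- (t * (norm \<xi>)\<^sup>2 / 2))) * cis (\<xi> \<bullet> v) =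
      (\<Prod>b\<in>Basis. complex_of_real (exp (- (t * (\<xi> \<bullet> b)\<^sup>2 / 2))) * cis ((\<xi> \<bullet> b) * (v \<bullet> b)))" for \<xi>
  proof -
    have "(\<Prod>b\<in>Basis. cis ((\<xi> \<bullet> b) * (v \<bullet> b))) = cis (\<Sum>b\<in>Basis. (\<xi> \<bullet> b) * (v \<bullet> b))"
      by (simp add: cis_conv_exp exp_sum[symmetric] sum_distrib_left)
    then show ?thesis
      by (simp add: prod.distrib exp_sum[symmetric] norm_square_Basis euclidean_inner[of \<xi> v]
          sum_negf sum_divide_distrib sum_distrib_left flip: of_real_prod)
  qed
  note p = lborel_prod_integral[where g = "\<lambda>b s. complex_of_real (exp (- (t * s\<^sup>2 / 2))) * cis (s * (v \<bullet> b))",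
      OF gauss_fourier(1)[OF t]]
  show "integrable lborel (\<lambda>\<xi>. complex_of_real (exp (- (t * (norm \<xi>)\<^sup>2 / 2))) * cis (\<xi> \<bullet> v))"
    unfolding e by (rule p(1))
  show "complex_of_real (gauss3 t v) = complex_of_real ((1 / (2 * pi)) ^ 3) *
      (LINT \<xi>|lborel. complex_of_real (exp (- (t * (norm \<xi>)\<^sup>2 / 2))) * cis (\<xi> \<bullet> v))"
    unfolding e p(2) gauss_fourier(2)[OF t] using t
    by (simp add: gauss3_prod prod.distrib power_divide flip: of_real_prod)
qed

lemma gauss3_convolution:
  assumes s: "0 < s" and t: "0 < t"
  shows "integrable lborel (\<lambda>v. gauss3 s (u - v) * gauss3 t (v - w))"
    and "(LINT v|lborel. gauss3 s (u - v) * gauss3 t (v - w)) = gauss3 (s + t) (u - w)"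
proof -
  have e: "gauss3 s (u - v) * gauss3 t (v - w) = (\<Prod>b\<in>Basis. gauss s (u \<bullet> b - v \<bullet> b) * gauss t (v \<bullet> b - w \<bullet> b))" for v
    using s t by (simp add: gauss3_prod prod.distrib inner_diff_left)
  note p = lborel_prod_integral[where g = "\<lambda>b a. gauss s (u \<bullet> b - a) * gauss t (a - w \<bullet> b)",
      OF gauss_convolution(1)[OF s t]]
  show "integrable lborel (\<lambda>v. gauss3 s (u - v) * gauss3 t (v - w))"
    unfolding e by (rule p(1))
  show "(LINT v|lborel. gauss3 s (u - v) * gauss3 t (v - w)) = gauss3 (s + t) (u - w)"
    unfolding e p(2) gauss_convolution(2)[OF s t] using s t by (simp add: gauss3_prod inner_diff_left)
qed

lemma gauss3_sym: "gauss3 t (v - w) = gauss3 t (w - v)"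
  by (simp add: gauss3_def norm_minus_commute)

lemma gauss3_nonneg: "0 \<le> t \<Longrightarrow> 0 \<le> gauss3 t v"
  by (simp add: gauss3_def)

section \<open>One particle with spin\<close>

abbreviation spins :: "real set" where
  "spins \<equiv> {- 1 / 2, 1 / 2}"

lemma space_particle: "space particle_measure = UNIV \<times> spins"
  by (simp add: particle_measure_def space_pair_measure)

lemma space_config: "space (config_measure N) = PiE {..<N} (\<lambda>_. UNIV \<times> spins)"
  by (simp add: config_measure_def space_PiM space_particle)

lemma space_configD:
  "x \<in> space (config_measure N) \<Longrightarrow> i < N \<Longrightarrow> x i \<in> space particle_measure"
  by (auto simp: space_config space_particle)

interpretation particle: sigma_finite_measure particle_measure
proof -
  interpret pair_sigma_finite "lborel :: (real ^ 3) measure" "count_space spins"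
    by (intro pair_sigma_finite.intro sigma_finite_lborel sigma_finite_measure_count_space_finite) auto
  show "sigma_finite_measure particle_measure"
    unfolding particle_measure_def by (rule sigma_finite_measure_axioms)
qed

interpretation particles: product_sigma_finite "\<lambda>_. particle_measure" ..

lemma sigma_finite_config: "sigma_finite_measure (config_measure N)"
  unfolding config_measure_def by (rule particles.sigma_finite) simp

lemma measurable_fst_particle [measurable]: "fst \<in> measurable particle_measure borel"
  unfolding particle_measure_def by measurable

lemma measurable_snd_particle [measurable]: "snd \<in> measurable particle_measure borel"
  unfolding particle_measure_def by (rule measurable_compose[OF measurable_snd]) simp

lemma measurable_config_component [measurable]:
  "i < N \<Longrightarrow> (\<lambda>x. x i) \<in> measurable (config_measure N) particle_measure"
  unfolding config_measure_def by measurable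

lemma
  fixes f :: "real ^ 3 \<Rightarrow> 'b::{real_normed_field, banach, second_countable_topology}"
  assumes f: "integrable lborel f" and s: "s \<in> spins"
  shows particle_integrable: "integrable particle_measure (\<lambda>x. f (fst x) * of_bool (snd x = s))"
    and particle_integral: "(LINT x|particle_measure. f (fst x) * of_bool (snd x = s)) = (LINT v|lborel. f v)"
proof -
  interpret pair_sigma_finite "lborel :: (real ^ 3) measure" "count_space spins"
    by (intro pair_sigma_finite.intro sigma_finite_lborel sigma_finite_measure_count_space_finite) auto
  have i: "integrable (lborel \<Otimes>\<^sub>M count_space spins) (\<lambda>(v, \<sigma>). f v * of_bool (\<sigma> = s))"
    by (rule integrable_times[OF f]) (simp add: integrable_count_space)
  then show "integrable particle_measure (\<lambda>x. f (fst x) * of_bool (snd x = s))"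
    by (simp add: particle_measure_def case_prod_beta')
  have "(LINT x|particle_measure. f (fst x) * of_bool (snd x = s)) =
      (LINT v|lborel. LINT \<sigma>|count_space spins. f v * of_bool (\<sigma> = s))"
    using integral_fst[OF i] by (simp add: particle_measure_def case_prod_beta')
  also have "\<dots> = (LINT v|lborel. f v)"
    using s by (auto simp: lebesgue_integral_count_space_finite)
  finally show "(LINT x|particle_measure. f (fst x) * of_bool (snd x = s)) = (LINT v|lborel. f v)" .
qed

definition heat1 :: "real \<Rightarrow> particle \<Rightarrow> particle \<Rightarrow> real" where
  "heat1 t x y = (if 0 < t then gauss3 t (fst x - fst y) * of_bool (snd x = snd y) else 0)"

text \<open>The guard on \<open>t\<close> matters for N = 0, where the empty product would be 1 also
  for t \<le> 0.\<close>

definition heatN :: "nat \<Rightarrow> real \<Rightarrow> config \<Rightarrow> config \<Rightarrow> real" where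
  "heatN N t x y = (if 0 < t then \<Prod>i<N. heat1 t (x i) (y i) else 0)"

lemma measurable_heat1 [measurable (raw)]:
  assumes [measurable]: "f \<in> borel_measurable L" "g \<in> measurable L particle_measure" "h \<in> measurable L particle_measure"
  shows "(\<lambda>w. heat1 (f w) (g w) (h w)) \<in> borel_measurable L"
  unfolding heat1_def gauss3_def of_bool_def by measurable

lemma heat1_nonneg: "0 \<le> heat1 t x y"
  by (simp add: heat1_def gauss3_nonneg)

lemma heat1_sym: "heat1 t x y = heat1 t y x"
  by (auto simp: heat1_def gauss3_sym[of t "fst x"])

lemma
  assumes x: "x \<in> space particle_measure"
  shows heat1_integrable: "integrable particle_measure (heat1 t x)"
    and heat1_integral: "0 < t \<Longrightarrow> (LINT y|particle_measure. heat1 t x y) = 1"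
proof -
  have s: "snd x \<in> spins" using x by (auto simp: space_particle)
  have e: "heat1 t x = (\<lambda>y. gauss3 t (fst x - fst y) * of_bool (snd y = snd x))" if "0 < t"
    using that by (auto simp: heat1_def fun_eq_iff)
  show "integrable particle_measure (heat1 t x)"
  proof (cases "0 < t")
    case True
    then show ?thesis unfolding e[OF True] by (intro particle_integrable gauss3_integral s)
  next
    case False
    then have "heat1 t x = (\<lambda>_. 0)" by (auto simp: heat1_def)
    then show ?thesis by simp
  qed
  show "(LINT y|particle_measure. heat1 t x y) = 1" if "0 < t"
    unfolding e[OF that] using particle_integral[OF gauss3_integral(1)[OF that] s] gauss3_integral(2)[OF that] by simp
qed

interpretation heat1: heat_kernel particle_measure heat1
proof
  show "(\<lambda>(t, x, y). heat1 t x y) \<in> borel_measurable (borel \<Otimes>\<^sub>M (particle_measure \<Otimes>\<^sub>M particle_measure))"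
    by measurable
qed (use heat1_nonneg heat1_sym heat1_integrable heat1_integral in \<open>auto simp: heat1_def\<close>)

text \<open>A plane wave in position and a Kronecker delta in spin, so the transform leaves the spin
  as it is.\<close>

definition wave1 :: "particle \<Rightarrow> particle \<Rightarrow> complex" where
  "wave1 \<eta> x = of_bool (snd \<eta> = snd x) * cis (fst \<eta> \<bullet> fst x)"

lemma measurable_wave1 [measurable (raw)]:
  assumes [measurable]: "g \<in> measurable L particle_measure" "h \<in> measurable L particle_measure"
  shows "(\<lambda>w. wave1 (g w) (h w)) \<in> borel_measurable L"
proof -
  have "continuous_on UNIV cis" by (intro continuous_intros)
  then have [measurable]: "cis \<in> borel_measurable borel" by (rule borel_measurable_continuous_onI)
  show ?thesis unfolding wave1_def of_bool_def by measurable
qed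

lemma heat1_spectral:
  assumes t: "0 < t" and x: "x \<in> space particle_measure" and y: "y \<in> space particle_measure"
  shows "integrable particle_measure (\<lambda>\<eta>. complex_of_real (exp (- (t * ((norm (fst \<eta>))\<^sup>2 / 2)))) * wave1 \<eta> x * cnj (wave1 \<eta> y))"
    and "complex_of_real (heat1 t x y) = complex_of_real ((1 / (2 * pi)) ^ 3) *
      (LINT \<eta>|particle_measure. complex_of_real (exp (- (t * ((norm (fst \<eta>))\<^sup>2 / 2)))) * wave1 \<eta> x * cnj (wave1 \<eta> y))"
proof -
  let ?h = "\<lambda>\<eta>. complex_of_real (exp (- (t * ((norm (fst \<eta>))\<^sup>2 / 2)))) * wave1 \<eta> x * cnj (wave1 \<eta> y)"
  let ?f = "\<lambda>\<xi>. complex_of_real (exp (- (t * (norm \<xi>)\<^sup>2 / 2))) * cis (\<xi> \<bullet> (fst x - fst y))"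
  have "integrable particle_measure ?h \<and> complex_of_real (heat1 t x y) = complex_of_real ((1 / (2 * pi)) ^ 3) * (LINT \<eta>|particle_measure. ?h \<eta>)"
  proof (cases "snd x = snd y")
    case True
    have s: "snd x \<in> spins" using x by (auto simp: space_particle)
    have "cis (\<xi> \<bullet> fst x) * cnj (cis (\<xi> \<bullet> fst y)) = cis (\<xi> \<bullet> (fst x - fst y))" for \<xi>
      by (simp add: cis_cnj cis_mult inner_diff_right)
    then have e: "?h \<eta> = ?f (fst \<eta>) * of_bool (snd \<eta> = snd x)" for \<eta>
      using True by (auto simp: wave1_def mult.assoc)
    show ?thesis unfolding e
      using particle_integrable[OF gauss3_fourier(1)[OF t] s] particle_integral[OF gauss3_fourier(1)[OF t] s]
        gauss3_fourier(2)[OF t, of "fst x - fst y"] True t by (simp add: heat1_def)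
  next
    case False
    then have "?h = (\<lambda>_. 0)" by (auto simp: wave1_def)
    then show ?thesis using False by (simp add: heat1_def)
  qed
  then show "integrable particle_measure ?h"
    "complex_of_real (heat1 t x y) = complex_of_real ((1 / (2 * pi)) ^ 3) * (LINT \<eta>|particle_measure. ?h \<eta>)" by auto
qed

section \<open>The heat kernel of N particles and its spectral representation\<close>

lemma measurable_heatN [measurable (raw)]:
  assumes [measurable]: "f \<in> borel_measurable L" "g \<in> measurable L (config_measure N)" "h \<in> measurable L (config_measure N)"
  shows "(\<lambda>w. heatN N (f w) (g w) (h w)) \<in> borel_measurable L"
proof -
  have "(\<lambda>w. g w i) \<in> measurable L particle_measure" "(\<lambda>w. h w i) \<in> measurable L particle_measure" if "i < N" for i
    using measurable_compose[OF assms(2) measurable_config_component[OF that]]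
      measurable_compose[OF assms(3) measurable_config_component[OF that]] by auto
  then have [measurable]: "(\<lambda>w. \<Prod>i<N. heat1 (f w) (g w i) (h w i)) \<in> borel_measurable L"
    by (intro borel_measurable_prod measurable_heat1) auto
  show ?thesis unfolding heatN_def by measurable
qed

lemma heatN_nonneg: "0 \<le> heatN N t x y"
  by (simp add: heatN_def prod_nonneg heat1_nonneg)

lemma heatN_sym: "heatN N t x y = heatN N t y x"
  by (simp add: heatN_def heat1_sym[of t "x _"])

lemma
  assumes x: "x \<in> space (config_measure N)"
  shows heatN_integrable: "integrable (config_measure N) (heatN N t x)"
    and heatN_integral: "0 < t \<Longrightarrow> (LINT y|config_measure N. heatN N t x y) = 1"
proof -
  have e: "heatN N t x = (\<lambda>y. \<Prod>i<N. heat1 t (x i) (y i))" if "0 < t"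
    using that by (auto simp: heatN_def)
  have i: "integrable particle_measure (heat1 t (x i))" if "i \<in> {..<N}" for i
    using that by (intro heat1_integrable space_configD[OF x]) auto
  show "integrable (config_measure N) (heatN N t x)"
  proof (cases "0 < t")
    case True
    show ?thesis unfolding e[OF True] config_measure_def
      by (rule particles.product_integrable_prod[OF _ i]) auto
  next
    case False
    then have "heatN N t x = (\<lambda>_. 0)" by (auto simp: heatN_def)
    then show ?thesis by simp
  qed
  show "(LINT y|config_measure N. heatN N t x y) = 1" if "0 < t"
    unfolding e[OF that] config_measure_def
    by (subst particles.product_integral_prod[OF _ i])
       (auto intro!: prod.neutral heat1_integral that space_configD[OF x])
qed

definition energy :: "nat \<Rightarrow> config \<Rightarrow> real" where
  "energy N \<eta> = (\<Sum>i<N. (norm (fst (\<eta> i)))\<^sup>2 / 2)"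

definition waveN :: "nat \<Rightarrow> config \<Rightarrow> config \<Rightarrow> complex" where
  "waveN N \<eta> x = (\<Prod>i<N. wave1 (\<eta> i) (x i))"

interpretation heatN: spectral_heat_kernel "config_measure N" "heatN N" "waveN N" "energy N" "((1 / (2 * pi)) ^ 3) ^ N" for N
proof (intro spectral_heat_kernel.intro heat_kernel.intro spectral_heat_kernel_axioms.intro
    heat_kernel_axioms.intro sigma_finite_config heatN_integrable heatN_integral)
  show "(\<lambda>(t, x, y). heatN N t x y) \<in> borel_measurable (borel \<Otimes>\<^sub>M (config_measure N \<Otimes>\<^sub>M config_measure N))"
    by measurable
  show "0 \<le> heatN N t x y" for t x y by (rule heatN_nonneg)
  show "heatN N t x y = heatN N t y x" for t x y by (rule heatN_sym)
  show "heatN N t x y = 0" if "t \<le> 0" for t x y using that by (simp add: heatN_def)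
  have comp: "(\<lambda>w. f w i) \<in> measurable L particle_measure" if "f \<in> measurable L (config_measure N)" "i < N"
    for f :: "_ \<Rightarrow> config" and L i
    using measurable_compose[OF that(1) measurable_config_component[OF that(2)]] .
  show "(\<lambda>(\<eta>, x). waveN N \<eta> x) \<in> borel_measurable (config_measure N \<Otimes>\<^sub>M config_measure N)"
    unfolding waveN_def case_prod_beta'
    by (intro borel_measurable_prod measurable_wave1 comp) auto
  have "cmod (wave1 \<eta> x) \<le> 1" for \<eta> x by (simp add: wave1_def norm_mult)
  then show "cmod (waveN N \<eta> x) \<le> 1" for \<eta> x
    unfolding waveN_def prod_norm[symmetric] by (intro prod_le_1) auto
  have "(\<lambda>\<eta>. (norm (fst (\<eta> i)))\<^sup>2 / 2) \<in> borel_measurable (config_measure N)" if "i < N" for i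
    using that by measurable
  then show "energy N \<in> borel_measurable (config_measure N)"
    unfolding energy_def[abs_def] by (intro borel_measurable_sum) auto
  show "0 \<le> energy N \<eta>" for \<eta> by (simp add: energy_def sum_nonneg)
  show "0 < ((1 / (2 * pi)) ^ 3) ^ N" by simp
  show "integrable (config_measure N) (\<lambda>\<eta>. exp (- (t * energy N \<eta>)))" if t: "0 < t" for t
  proof -
    have "integrable particle_measure (\<lambda>\<eta>. exp (- (t * ((norm (fst \<eta>))\<^sup>2 / 2))))"
    proof -
      \<comment> \<open>At position 0 the product of the waves reduces to the indicator of spin
        \<open>s\<close>; summing over both spins recovers the bare Gaussian in the
        frequency.\<close>
      have "integrable particle_measure (\<lambda>\<eta>. complex_of_real (exp (- (t * ((norm (fst \<eta>))\<^sup>2 / 2)))) * wave1 \<eta> (0, s) * cnj (wave1 \<eta> (0, s)))"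
        if "s \<in> spins" for s
        using that by (intro heat1_spectral t) (auto simp: space_particle)
      then have "integrable particle_measure (\<lambda>\<eta>. \<Sum>s\<in>spins. Re (complex_of_real (exp (- (t * ((norm (fst \<eta>))\<^sup>2 / 2)))) * wave1 \<eta> (0, s) * cnj (wave1 \<eta> (0, s))))"
        by (intro Bochner_Integration.integrable_sum integrable_Re)
      then show ?thesis
        by (rule Bochner_Integration.integrable_cong[THEN iffD1, rotated 2])
           (auto simp: space_particle wave1_def)
    qed
    then have "integrable (config_measure N) (\<lambda>\<eta>. \<Prod>i<N. exp (- (t * ((norm (fst (\<eta> i)))\<^sup>2 / 2))))"
      unfolding config_measure_def by (intro particles.product_integrable_prod) auto
    then show ?thesis by (simp add: energy_def exp_sum[symmetric] sum_negf sum_distrib_left)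
  qed
  show "complex_of_real (heatN N t x y) = complex_of_real (((1 / (2 * pi)) ^ 3) ^ N) *
      (LINT \<eta>|config_measure N. complex_of_real (exp (- (t * energy N \<eta>))) * waveN N \<eta> x * cnj (waveN N \<eta> y))"
    if t: "0 < t" and x: "x \<in> space (config_measure N)" and y: "y \<in> space (config_measure N)" for t x y
  proof -
    let ?h = "\<lambda>i \<eta>. complex_of_real (exp (- (t * ((norm (fst \<eta>))\<^sup>2 / 2)))) * wave1 \<eta> (x i) * cnj (wave1 \<eta> (y i))"
    have "complex_of_real (heatN N t x y) = (\<Prod>i<N. complex_of_real ((1 / (2 * pi)) ^ 3) * (LINT \<eta>|particle_measure. ?h i \<eta>))"
      using t x y by (auto simp only: heatN_def of_real_prod if_True intro!: prod.cong heat1_spectral(2) space_configD)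
    also have "\<dots> = complex_of_real (((1 / (2 * pi)) ^ 3) ^ N) * (\<Prod>i<N. (LINT \<eta>|particle_measure. ?h i \<eta>))"
      by (simp only: prod.distrib prod_constant card_lessThan of_real_power)
    also have "(\<Prod>i<N. (LINT \<eta>|particle_measure. ?h i \<eta>)) = (LINT \<eta>|config_measure N. (\<Prod>i<N. ?h i (\<eta> i)))"
      unfolding config_measure_def using t x y
      by (intro particles.product_integral_prod[symmetric] heat1_spectral(1) space_configD) auto
    also have "(\<lambda>\<eta>. \<Prod>i<N. ?h i (\<eta> i)) = (\<lambda>\<eta>. complex_of_real (exp (- (t * energy N \<eta>))) * waveN N \<eta> x * cnj (waveN N \<eta> y))"
      by (simp add: prod.distrib waveN_def energy_def sum_distrib_left exp_sum[symmetric] sum_negf flip: of_real_prod)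
    finally show ?thesis .
  qed
qed

section \<open>Integration by parts for test functions\<close>

lemma shift_0 [simp]: "shift i k 0 x = x"
  by (simp add: shift_def)

lemma shift_shift: "shift i k h' (shift i k h x) = shift i k (h + h') x"
  by (simp add: shift_def scaleR_left_distrib add.assoc)

lemma shift_in_space:
  "i < N \<Longrightarrow> x \<in> space (config_measure N) \<Longrightarrow> shift i k h x \<in> space (config_measure N)"
  by (fastforce simp: shift_def space_config PiE_iff extensional_def mem_Times_iff)

lemma distr_particle_translation:
  "distr particle_measure particle_measure (\<lambda>p. (fst p + c, snd p)) = particle_measure"
proof -
  have "distr lborel lborel ((+) c) = lborel"
    using lborel_distr_plus[of c] by (simp cong: distr_cong)
  moreover have "distr (count_space spins) (count_space spins) (\<lambda>x. x) = count_space spins"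
    by (rule distr_id)
  moreover have "distr (lborel :: (real ^ 3) measure) lborel ((+) c) \<Otimes>\<^sub>M distr (count_space spins) (count_space spins) (\<lambda>x. x) =
      distr (lborel \<Otimes>\<^sub>M count_space spins) (lborel \<Otimes>\<^sub>M count_space spins) (\<lambda>(x, y). (c + x, y))"
    by (rule pair_measure_distr) (auto simp: distr_id sigma_finite_measure_count_space_finite)
  ultimately show ?thesis
    by (simp add: particle_measure_def case_prod_beta' add.commute)
qed

lemma measurable_shift:
  assumes i: "i < N"
  shows "shift i k h \<in> measurable (config_measure N) (config_measure N)"
proof -
  have T: "(\<lambda>p. (fst p + h *\<^sub>R axis k 1, snd p)) \<in> measurable particle_measure particle_measure"
    unfolding particle_measure_def by measurable
  show ?thesis
    unfolding config_measure_def
  proof (rule measurable_PiM_single')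
    fix j assume "j \<in> {..<N}"
    then show "(\<lambda>x. shift i k h x j) \<in> measurable (PiM {..<N} (\<lambda>_. particle_measure)) particle_measure"
      using i measurable_compose[OF measurable_component_singleton[of i "{..<N}" "\<lambda>_. particle_measure"] T]
      by (cases "j = i") (auto simp: shift_def)
  next
    show "shift i k h \<in> space (PiM {..<N} (\<lambda>_. particle_measure)) \<rightarrow> (\<Pi>\<^sub>E i\<in>{..<N}. space particle_measure)"
      unfolding space_PiM[symmetric] config_measure_def[symmetric] using shift_in_space[OF i] by blast
  qed
qed

text \<open>Equality of the measures is checked on boxes. The preimage of a box is the box
  \<open>B\<close>, in which only side i is translated, and
  \<open>distr_particle_translation\<close> leaves the measure of that side unchanged.\<close>

lemma distr_shift:
  assumes i: "i < N"
  shows "distr (config_measure N) (config_measure N) (shift i k h) = config_measure N"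
  unfolding config_measure_def
proof (rule particles.PiM_eqI)
  let ?T = "\<lambda>p. (fst p + h *\<^sub>R axis k 1, snd p) :: particle"
  have T: "?T \<in> measurable particle_measure particle_measure"
    unfolding particle_measure_def by measurable
  note m = measurable_shift[OF i, of k h, unfolded config_measure_def]
  fix A :: "nat \<Rightarrow> particle set" assume A: "\<And>j. j \<in> {..<N} \<Longrightarrow> A j \<in> sets particle_measure"
  define B where "B = A(i := ?T -` A i \<inter> space particle_measure)"
  have B: "B j \<in> sets particle_measure" if "j \<in> {..<N}" for j
    using A[OF that] measurable_sets[OF T, of "A i"] A i by (auto simp: B_def)
  have "shift i k h -` PiE {..<N} A \<inter> space (PiM {..<N} (\<lambda>_. particle_measure)) = PiE {..<N} B"
  proof (intro set_eqI iffI)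
    fix x assume x: "x \<in> PiE {..<N} B"
    then have xs: "x \<in> space (config_measure N)"
      using B sets.sets_into_space unfolding config_measure_def space_PiM PiE_iff by blast
    have "shift i k h x j \<in> A j" if "j < N" for j
      using x that i by (cases "j = i") (auto simp: shift_def B_def PiE_iff split: if_splits)
    then show "x \<in> shift i k h -` PiE {..<N} A \<inter> space (PiM {..<N} (\<lambda>_. particle_measure))"
      using xs shift_in_space[OF i xs, of k h] by (auto simp: config_measure_def space_PiM PiE_iff)
  next
    fix x assume x: "x \<in> shift i k h -` PiE {..<N} A \<inter> space (PiM {..<N} (\<lambda>_. particle_measure))"
    have "x j \<in> B j" if j: "j < N" for j
    proof (cases "j = i")
      case True
      have "shift i k h x i \<in> A i" "x i \<in> space particle_measure" using x i by (auto simp: space_PiM)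
      then show ?thesis using True by (simp add: B_def shift_def)
    next
      case False
      have "shift i k h x j \<in> A j" using x j by auto
      then show ?thesis using False by (simp add: B_def shift_def)
    qed
    then show "x \<in> PiE {..<N} B" using x by (auto simp: space_PiM PiE_iff)
  qed
  then have "emeasure (distr (PiM {..<N} (\<lambda>_. particle_measure)) (PiM {..<N} (\<lambda>_. particle_measure)) (shift i k h)) (PiE {..<N} A)
      = (\<Prod>j<N. emeasure particle_measure (B j))"
    using particles.emeasure_PiM[OF finite_lessThan B] A by (simp add: emeasure_distr[OF m] sets_PiM_I_finite)
  also have "\<dots> = (\<Prod>j<N. emeasure particle_measure (A j))"
  proof (intro prod.cong refl)
    fix j assume "j \<in> {..<N}"
    then show "emeasure particle_measure (B j) = emeasure particle_measure (A j)"
      using emeasure_distr[OF T, of "A i"] A distr_particle_translation[of "h *\<^sub>R axis k 1"]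
      by (cases "j = i") (auto simp: B_def)
  qed
  finally show "emeasure (distr (PiM {..<N} (\<lambda>_. particle_measure)) (PiM {..<N} (\<lambda>_. particle_measure)) (shift i k h)) (PiE {..<N} A)
      = (\<Prod>j<N. emeasure particle_measure (A j))" .
qed simp_all

lemma
  fixes f :: "config \<Rightarrow> complex"
  assumes i: "i < N" and f: "integrable (config_measure N) f"
  shows integrable_shift: "integrable (config_measure N) (\<lambda>x. f (shift i k h x))"
    and integral_shift: "(LINT x|config_measure N. f (shift i k h x)) = (LINT x|config_measure N. f x)"
proof -
  note m = measurable_shift[OF i, of k h]
  have fm: "f \<in> borel_measurable (config_measure N)" using f by auto
  show "integrable (config_measure N) (\<lambda>x. f (shift i k h x))"
    using f integrable_distr_eq[OF m fm] by (simp add: distr_shift[OF i])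
  show "(LINT x|config_measure N. f (shift i k h x)) = (LINT x|config_measure N. f x)"
    using integral_distr[OF m fm] by (simp add: distr_shift[OF i])
qed

text \<open>Borel sets of the function space are measurable for configurations; coordinates beyond N
  are constantly \<open>undefined\<close>. This makes continuous functions measurable, and
  \<open>measurable_config_borel\<close> is the converse.\<close>

lemma measurable_config_id: "(\<lambda>x. x) \<in> measurable (config_measure N) borel"
proof (rule measurable_coordinatewise_then_product)
  fix i
  show "(\<lambda>x. x i) \<in> borel_measurable (config_measure N)"
  proof (cases "i < N")
    case True
    have "(\<lambda>p. (fst p, snd p)) \<in> measurable particle_measure (borel \<Otimes>\<^sub>M borel)"
      by measurable
    then have "(\<lambda>p. p) \<in> measurable particle_measure borel" by (simp add: borel_prod)
    from measurable_compose[OF measurable_config_component[OF True] this] show ?thesis .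
  next
    case False
    then have "x i = undefined" if "x \<in> space (config_measure N)" for x
      using that by (auto simp: space_config PiE_iff extensional_def)
    then show ?thesis by (subst measurable_cong[where g = "\<lambda>_. undefined"]) auto
  qed
qed

lemma continuous_on_config_measurable:
  fixes f :: "config \<Rightarrow> complex"
  assumes "continuous_on (space (config_measure N)) f"
  shows "f \<in> borel_measurable (config_measure N)"
  using measurable_compose[OF measurable_restrict_space2[OF _ measurable_config_id]
      borel_measurable_continuous_on_restrict[OF assms]] by auto

definition config_ball :: "nat \<Rightarrow> real \<Rightarrow> config set" where
  "config_ball N R = PiE {..<N} (\<lambda>_. cball 0 R \<times> spins)"

lemma config_ball_iff:
  "x \<in> config_ball N R \<longleftrightarrow> x \<in> space (config_measure N) \<and> (\<forall>i<N. norm (fst (x i)) \<le> R)"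
  by (auto simp: config_ball_def space_config PiE_iff mem_Times_iff)

text \<open>Tychonoff's theorem, after the set is written as a product over all indices in which
  each factor beyond N is the singleton of \<open>undefined\<close>.\<close>

lemma compact_config_ball: "compact (config_ball N R)"
proof -
  define S where "S = (\<lambda>i. if i < N then cball 0 R \<times> spins else {undefined :: particle})"
  have "compactin (product_topology (\<lambda>i. euclidean) UNIV) (PiE UNIV S)"
    unfolding compactin_PiE by (auto simp: S_def compactin_euclidean_iff intro!: compact_Times)
  moreover have "config_ball N R = PiE UNIV S"
  proof (intro set_eqI iffI)
    fix x assume x: "x \<in> config_ball N R"
    have "x i \<in> S i" for i
      using x by (cases "i < N") (simp_all add: config_ball_def S_def PiE_iff extensional_def)
    then show "x \<in> PiE UNIV S" by (simp add: PiE_iff)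
  next
    fix x assume "x \<in> PiE UNIV S"
    then have x: "x i \<in> S i" for i by auto
    have "x i \<in> cball 0 R \<times> spins" if "i < N" for i using x[of i] that by (simp only: S_def if_True)
    moreover have "x i = undefined" if "\<not> i < N" for i using x[of i] that by (simp add: S_def)
    ultimately show "x \<in> config_ball N R"
      unfolding config_ball_def by (intro PiE_I) (simp_all only: lessThan_iff not_less)
  qed
  ultimately show ?thesis by (simp add: euclidean_product_topology)
qed

lemma
  shows sets_config_ball [measurable]: "config_ball N R \<in> sets (config_measure N)"
    and emeasure_config_ball: "emeasure (config_measure N) (config_ball N R) < \<infinity>"
proof -
  have s: "cball 0 R \<times> spins \<in> sets particle_measure"
    unfolding particle_measure_def by (intro pair_measureI) auto
  show "config_ball N R \<in> sets (config_measure N)"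
    unfolding config_ball_def config_measure_def using s by (intro sets_PiM_I_finite) auto
  interpret sigma_finite_measure "count_space spins" by (rule sigma_finite_measure_count_space_finite) simp
  have "emeasure particle_measure (cball 0 R \<times> spins) = emeasure lborel (cball (0 :: real ^ 3) R) * emeasure (count_space spins) spins"
    unfolding particle_measure_def by (rule emeasure_pair_measure_Times) auto
  also have "\<dots> < \<infinity>"
    using emeasure_lborel_cball_finite[of "0 :: real ^ 3" R] by (auto simp: ennreal_mult_less_top)
  finally show "emeasure (config_measure N) (config_ball N R) < \<infinity>"
    unfolding config_ball_def config_measure_def using s
    by (subst particles.emeasure_PiM) (auto simp: power_less_top_ennreal)
qed

lemma continuous_on_config_bounded:
  fixes f :: "config \<Rightarrow> complex"
  assumes f: "continuous_on (space (config_measure N)) f"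
    and z: "\<And>x. x \<in> space (config_measure N) \<Longrightarrow> x \<notin> config_ball N R \<Longrightarrow> f x = 0"
  obtains B where "0 \<le> B" "\<And>x. x \<in> space (config_measure N) \<Longrightarrow> cmod (f x) \<le> B * indicator (config_ball N R) x"
proof -
  have "continuous_on (config_ball N R) f"
    using f by (rule continuous_on_subset) (auto simp: config_ball_iff)
  then have "bounded (f ` config_ball N R)"
    by (intro compact_imp_bounded compact_continuous_image compact_config_ball)
  then obtain B where B: "0 < B" "\<And>x. x \<in> config_ball N R \<Longrightarrow> cmod (f x) \<le> B"
    by (auto simp: bounded_pos)
  show thesis
    by (rule that[of B]) (use B z in \<open>auto split: split_indicator\<close>)
qed

lemma has_vector_derivative_quotient_tendsto:
  assumes "(g has_vector_derivative D) (at (0::real))"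
  shows "(\<lambda>n. (g (1 / real (Suc n)) - g 0) /\<^sub>R (1 / real (Suc n))) \<longlonglongrightarrow> D"
proof -
  define d where "d = (\<lambda>n. 1 / real (Suc n))"
  have "((\<lambda>h. norm (g (0 + h) - g 0 - h *\<^sub>R D) / norm h) \<longlongrightarrow> 0) (at 0)"
    using assms by (simp add: has_vector_derivative_def has_derivative_at)
  moreover have "d \<longlonglongrightarrow> 0" unfolding d_def by (rule LIMSEQ_Suc[OF lim_1_over_n])
  then have "filterlim d (at 0) sequentially" by (simp add: filterlim_at d_def)
  ultimately have "(\<lambda>n. norm (g (0 + d n) - g 0 - d n *\<^sub>R D) / norm (d n)) \<longlonglongrightarrow> 0"
    by (rule filterlim_compose)
  moreover have "norm (g (0 + d n) - g 0 - d n *\<^sub>R D) / norm (d n) = norm ((g (d n) - g 0) /\<^sub>R d n - D)" for n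
  proof -
    have d: "0 < d n" by (simp add: d_def)
    then have "(g (d n) - g 0) /\<^sub>R d n - D = (g (0 + d n) - g 0 - d n *\<^sub>R D) /\<^sub>R d n"
      by (simp add: scaleR_right_diff_distrib)
    then show ?thesis using d by (simp add: divide_inverse mult.commute)
  qed
  ultimately have "(\<lambda>n. (g (d n) - g 0) /\<^sub>R d n - D) \<longlonglongrightarrow> 0"
    by (simp add: tendsto_norm_zero_iff)
  then show ?thesis unfolding d_def by (rule LIM_zero_cancel)
qed

definition line_derivative :: "nat \<Rightarrow> nat \<Rightarrow> 3 \<Rightarrow> (config \<Rightarrow> complex) \<Rightarrow> (config \<Rightarrow> complex) \<Rightarrow> bool" where
  "line_derivative N i k f f' \<longleftrightarrow>
    (\<forall>x\<in>space (config_measure N). ((\<lambda>h. f (shift i k h x)) has_vector_derivative f' x) (at 0))"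

text \<open>Shifts along a line compose additively, so derivatives at parameter 0 at all points give
  derivatives at every parameter.\<close>

lemma line_derivative_at:
  assumes f: "line_derivative N i k f f'" and x: "x \<in> space (config_measure N)" and i: "i < N"
  shows "((\<lambda>h. f (shift i k h x)) has_vector_derivative f' (shift i k h x)) (at h)"
proof -
  have "((\<lambda>s. f (shift i k s (shift i k h x))) has_vector_derivative f' (shift i k h x)) (at (h - h))"
    using f shift_in_space[OF i x] by (simp add: line_derivative_def)
  moreover have "((\<lambda>s. s - h) has_vector_derivative 1) (at h)"
    by (auto intro!: derivative_eq_intros)
  ultimately show ?thesis
    using vector_diff_chain_at[of "\<lambda>s. s - h" 1 h "\<lambda>s. f (shift i k s (shift i k h x))"]
    by (simp add: comp_def shift_shift)
qed

text \<open>By translation invariance each difference quotient of \<open>f\<close> has integral 0,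
  and dominated convergence passes to the derivative. The mean value inequality provides the
  majorant; steps of length at most 1 explain the radius R + 1.\<close>

lemma integral_line_derivative:
  assumes i: "i < N" and D: "line_derivative N i k f f'"
    and fc: "continuous_on (space (config_measure N)) f" and fc': "continuous_on (space (config_measure N)) f'"
    and z: "\<And>x. x \<in> space (config_measure N) \<Longrightarrow> x \<notin> config_ball N R \<Longrightarrow> f x = 0"
    and z': "\<And>x. x \<in> space (config_measure N) \<Longrightarrow> x \<notin> config_ball N R \<Longrightarrow> f' x = 0"
  shows "(LINT x|config_measure N. f' x) = 0"
proof -
  let ?M = "config_measure N"
  obtain B where B: "0 \<le> B" "\<And>x. x \<in> space ?M \<Longrightarrow> cmod (f' x) \<le> B * indicator (config_ball N R) x"
    using continuous_on_config_bounded[OF fc' z'] by blast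
  have [measurable]: "f \<in> borel_measurable ?M" "f' \<in> borel_measurable ?M"
    using fc fc' by (auto intro: continuous_on_config_measurable)
  have intb: "integrable ?M (\<lambda>x. C * indicator (config_ball N r) x :: real)" for C r
    using emeasure_config_ball by (intro integrable_mult_right integrable_real_indicator) auto
  obtain C where C: "\<And>x. x \<in> space ?M \<Longrightarrow> cmod (f x) \<le> C * indicator (config_ball N R) x"
    using continuous_on_config_bounded[OF fc z] by blast
  have fi: "integrable ?M f"
  proof (rule Bochner_Integration.integrable_bound[OF intb])
    show "AE x in ?M. norm (f x) \<le> norm (C * indicator (config_ball N R) x)"
      using C by (intro AE_I2) (metis abs_ge_self order.trans real_norm_def)
  qed measurable
  define q where "q = (\<lambda>n x. (f (shift i k (1 / real (Suc n)) x) - f x) /\<^sub>R (1 / real (Suc n)))"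
  have q0: "(LINT x|?M. q n x) = 0" for n
    unfolding q_def using integrable_shift[OF i fi] integral_shift[OF i fi] fi by simp
  have "(\<lambda>n. LINT x|?M. q n x) \<longlonglongrightarrow> (LINT x|?M. f' x)"
  proof (rule integral_dominated_convergence[where w = "\<lambda>x. B * indicator (config_ball N (R + 1)) x"])
    show "f' \<in> borel_measurable ?M" by measurable
    have [measurable]: "(\<lambda>x. f (shift i k h x)) \<in> borel_measurable ?M" for h
      using integrable_shift[OF i fi] by auto
    show "q n \<in> borel_measurable ?M" for n
      unfolding q_def by measurable
    show "integrable ?M (\<lambda>x. B * indicator (config_ball N (R + 1)) x)" by (rule intb)
    show "AE x in ?M. (\<lambda>n. q n x) \<longlonglongrightarrow> f' x"
    proof (rule AE_I2)
      fix x assume "x \<in> space ?M"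
      then have "((\<lambda>h. f (shift i k h x)) has_vector_derivative f' x) (at 0)"
        using D by (simp add: line_derivative_def)
      from has_vector_derivative_quotient_tendsto[OF this] show "(\<lambda>n. q n x) \<longlonglongrightarrow> f' x"
        by (simp add: q_def)
    qed
    show "AE x in ?M. norm (q n x) \<le> B * indicator (config_ball N (R + 1)) x" for n
    proof (rule AE_I2)
      fix x assume x: "x \<in> space ?M"
      define h where "h = 1 / real (Suc n)"
      have h: "0 < h" "h \<le> 1" by (auto simp: h_def)
      show "norm (q n x) \<le> B * indicator (config_ball N (R + 1)) x"
      proof (cases "x \<in> config_ball N (R + 1)")
        case True
        have "norm (f (shift i k h x) - f (shift i k 0 x)) \<le> B * norm (h - 0)"
        proof (rule differentiable_bound[of UNIV _ "\<lambda>s r. r *\<^sub>R f' (shift i k s x)"])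
          show "((\<lambda>h. f (shift i k h x)) has_derivative (\<lambda>r. r *\<^sub>R f' (shift i k s x))) (at s within UNIV)" for s
            using line_derivative_at[OF D x i] by (simp add: has_vector_derivative_def)
          show "onorm (\<lambda>r. r *\<^sub>R f' (shift i k s x)) \<le> B" for s
          proof (rule onorm_bound[OF B(1)])
            fix r :: real
            have "cmod (f' (shift i k s x)) \<le> B * indicator (config_ball N R) (shift i k s x)"
              by (rule B(2)[OF shift_in_space[OF i x]])
            also have "\<dots> \<le> B" using B(1) by (auto split: split_indicator)
            finally show "norm (r *\<^sub>R f' (shift i k s x)) \<le> B * norm r"
              using mult_left_mono[of "cmod (f' (shift i k s x))" B "\<bar>r\<bar>"] by (simp add: mult.commute[of B])
          qed
        qed auto
        then have "cmod (f (shift i k h x) - f x) / h \<le> B" using h by (simp add: divide_le_eq)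
        then show ?thesis using True h
          unfolding q_def h_def[symmetric] by (simp add: divide_inverse mult.commute)
      next
        case False
        then obtain j where j: "j < N" "norm (fst (x j)) > R + 1" using x by (auto simp: config_ball_iff not_le)
        have "norm (fst (shift i k h x j)) \<ge> norm (fst (x j)) - h"
        proof (cases "j = i")
          case True
          have "norm (fst (x i)) \<le> norm (fst (x i) + h *\<^sub>R axis k 1) + norm (h *\<^sub>R axis k (1::real) :: real ^ 3)"
            using norm_triangle_ineq4[of "fst (x i) + h *\<^sub>R axis k 1" "h *\<^sub>R axis k 1"] by simp
          then show ?thesis using True h by (simp add: shift_def)
        qed (use h in \<open>simp add: shift_def\<close>)
        then have "R < norm (fst (shift i k h x j))" using h j by linarith
        then have "f (shift i k h x) = 0"
          using z[OF shift_in_space[OF i x]] j by (meson config_ball_iff not_le)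
        moreover have "f x = 0" using z[OF x] j by (meson config_ball_iff not_le less_trans less_add_one)
        ultimately show ?thesis using False by (simp add: q_def h_def)
      qed
    qed
  qed
  then have "(\<lambda>n. 0) \<longlonglongrightarrow> (LINT x|?M. f' x)" by (simp add: q0)
  then show ?thesis by (simp add: LIMSEQ_const_iff)
qed

definition smooth_in_ball :: "nat \<Rightarrow> real \<Rightarrow> (config \<Rightarrow> complex) \<Rightarrow> bool" where
  "smooth_in_ball N R f \<longleftrightarrow> continuous_on (space (config_measure N)) f \<and>
     (\<forall>x\<in>space (config_measure N). x \<notin> config_ball N R \<longrightarrow> f x = 0) \<and>
     (\<forall>i<N. \<forall>k. line_derivative N i k f (partial i k f))"

text \<open>The complement of the closed ball is open along each line, so \<open>f\<close> vanishes
  near \<open>x\<close> on that line.\<close>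

lemma partial_vanishes:
  assumes x: "x \<in> space (config_measure N)" "x \<notin> config_ball N R" and i: "i < N"
    and z: "\<And>x. x \<in> space (config_measure N) \<Longrightarrow> x \<notin> config_ball N R \<Longrightarrow> f x = 0"
  shows "partial i k f x = 0"
proof -
  obtain j where j: "j < N" "norm (fst (x j)) > R" using x by (auto simp: config_ball_iff not_le)
  have "isCont (\<lambda>h. norm (fst (shift i k h x j))) 0"
    unfolding shift_def by (cases "j = i") (auto intro!: continuous_intros)
  then have "((\<lambda>h. norm (fst (shift i k h x j))) \<longlongrightarrow> norm (fst (shift i k 0 x j))) (nhds 0)"
    using tendsto_at_iff_tendsto_nhds[of "\<lambda>h. norm (fst (shift i k h x j))" 0] by (simp add: isCont_def)
  then have "((\<lambda>h. norm (fst (shift i k h x j))) \<longlongrightarrow> norm (fst (x j))) (nhds 0)"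
    by simp
  from order_tendstoD(1)[OF this j(2)] have "\<forall>\<^sub>F h in nhds 0. f (shift i k h x) = 0"
  proof eventually_elim
    case (elim h)
    show ?case using z[OF shift_in_space[OF i x(1)]] elim j by (meson config_ball_iff not_le)
  qed
  then have "((\<lambda>h. f (shift i k h x)) has_vector_derivative 0) (at 0)"
    by (subst has_vector_derivative_cong_ev[where g = "\<lambda>_. 0"]) (auto elim!: eventually_mono dest: eventually_nhds_x_imp_x)
  then show ?thesis unfolding partial_def by (rule vector_derivative_at)
qed

lemma test_function_smooth:
  assumes "test_function N \<phi>"
  obtains R where "\<And>ks. set ks \<subseteq> {..<N} \<times> UNIV \<Longrightarrow> smooth_in_ball N R (iter_partial ks \<phi>)"
proof -
  obtain R where "\<forall>x\<in>space (config_measure N). (\<exists>i<N. norm (fst (x i)) > R) \<longrightarrow> \<phi> x = 0"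
    using assms unfolding test_function_def by blast
  then have R: "\<And>x. x \<in> space (config_measure N) \<Longrightarrow> x \<notin> config_ball N R \<Longrightarrow> \<phi> x = 0"
    by (auto simp: config_ball_iff not_le)
  have z: "\<forall>x\<in>space (config_measure N). x \<notin> config_ball N R \<longrightarrow> iter_partial ks \<phi> x = 0"
    if "set ks \<subseteq> {..<N} \<times> UNIV" for ks
    using that
  proof (induction ks)
    case (Cons p ks)
    then show ?case
      by (cases p) (auto simp: iter_partial_def intro!: partial_vanishes[where N = N and R = R])
  qed (use R in \<open>auto simp: iter_partial_def\<close>)
  show thesis
  proof (rule that[of R])
    fix ks :: "(nat \<times> 3) list" assume ks: "set ks \<subseteq> {..<N} \<times> UNIV"
    show "smooth_in_ball N R (iter_partial ks \<phi>)"
      using assms ks z[OF ks]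
      by (auto simp: smooth_in_ball_def test_function_def line_derivative_def partial_def vector_derivative_works[symmetric])
  qed
qed

lemma smooth_in_ball_line_derivative:
  "smooth_in_ball N R f \<Longrightarrow> i < N \<Longrightarrow> line_derivative N i k f (partial i k f)"
  by (simp add: smooth_in_ball_def)

lemma smooth_in_ball_L2:
  assumes "smooth_in_ball N R f"
  shows "f \<in> L2 (config_measure N)"
proof -
  have c: "continuous_on (space (config_measure N)) f" using assms by (simp add: smooth_in_ball_def)
  obtain B where B: "0 \<le> B" "\<And>x. x \<in> space (config_measure N) \<Longrightarrow> cmod (f x) \<le> B * indicator (config_ball N R) x"
    using continuous_on_config_bounded[OF c] assms unfolding smooth_in_ball_def by metis
  have "(\<lambda>x. indicator (config_ball N R) x :: complex) \<in> L2 (config_measure N)"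
  proof -
    have "(\<lambda>x. (cmod (indicator (config_ball N R) x))\<^sup>2) = (indicator (config_ball N R) :: config \<Rightarrow> real)"
      by (auto split: split_indicator)
    then show ?thesis using emeasure_config_ball[of N R] by (simp add: L2_def)
  qed
  then show ?thesis
  proof (rule L2_bounded[where C = B])
    show "cmod (f x) \<le> B * cmod (indicator (config_ball N R) x)" if "x \<in> space (config_measure N)" for x
      using B(2)[OF that] by (simp split: split_indicator split_indicator_asm)
  qed (rule continuous_on_config_measurable[OF c])
qed

text \<open>Green's identity: f g'' - f'' g is the derivative of f g' - f' g, so its integral
  vanishes by \<open>integral_line_derivative\<close>.\<close>

lemma second_partial_symmetric:
  assumes f: "smooth_in_ball N R f" and f': "smooth_in_ball N R (partial i k f)"
    and f'': "smooth_in_ball N R (partial i k (partial i k f))"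
    and g: "smooth_in_ball N R g" and g': "smooth_in_ball N R (partial i k g)"
    and g'': "smooth_in_ball N R (partial i k (partial i k g))"
    and i: "i < N"
  shows "(LINT x|config_measure N. f x * partial i k (partial i k g) x) =
    (LINT x|config_measure N. partial i k (partial i k f) x * g x)"
proof -
  let ?D = "partial i k"
  have "(LINT x|config_measure N. f x * ?D (?D g) x - ?D (?D f) x * g x) = 0"
  proof (rule integral_line_derivative[OF i, where f = "\<lambda>x. f x * ?D g x - ?D f x * g x" and R = R])
    show "line_derivative N i k (\<lambda>x. f x * ?D g x - ?D f x * g x) (\<lambda>x. f x * ?D (?D g) x - ?D (?D f) x * g x)"
      using smooth_in_ball_line_derivative[OF f i, of k] smooth_in_ball_line_derivative[OF f' i, of k]
        smooth_in_ball_line_derivative[OF g i, of k] smooth_in_ball_line_derivative[OF g' i, of k]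
      unfolding line_derivative_def by (auto intro!: derivative_eq_intros)
  qed (use f f' f'' g g' g'' in \<open>auto simp: smooth_in_ball_def intro!: continuous_intros\<close>)
  then show ?thesis
    using smooth_in_ball_L2[OF f] smooth_in_ball_L2[OF f''] smooth_in_ball_L2[OF g] smooth_in_ball_L2[OF g'']
    by (subst (asm) Bochner_Integration.integral_diff) (auto intro: L2_prod_integrable)
qed

text \<open>This puts test functions into the domain of T, so that the left inverse applies to them;
  the right inverse is deduced from that.\<close>

lemma kinetic_test_function:
  assumes \<phi>: "test_function N \<phi>"
  shows "kinetic N \<phi> (kinetic_test N \<phi>)"
  unfolding kinetic_def
proof (intro conjI allI impI)
  have s: "\<phi> \<in> L2 (config_measure N) \<and> (\<forall>i<N. \<forall>k. partial i k (partial i k \<phi>) \<in> L2 (config_measure N))"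
    if \<phi>: "test_function N \<phi>" for \<phi>
  proof -
    obtain R where R: "\<And>ks. set ks \<subseteq> {..<N} \<times> UNIV \<Longrightarrow> smooth_in_ball N R (iter_partial ks \<phi>)"
      using test_function_smooth[OF \<phi>] by blast
    have "\<phi> \<in> L2 (config_measure N)"
      using smooth_in_ball_L2[OF R[of "[]"]] by (simp add: iter_partial_def)
    moreover have "partial i k (partial i k \<phi>) \<in> L2 (config_measure N)" if "i < N" for i k
      using smooth_in_ball_L2[OF R[of "[(i, k), (i, k)]"]] that by (simp add: iter_partial_def)
    ultimately show ?thesis by blast
  qed
  show "\<phi> \<in> L2 (config_measure N)" using s[OF \<phi>] by simp
  show "kinetic_test N \<phi> \<in> L2 (config_measure N)"
    unfolding kinetic_test_def laplacian_def using s[OF \<phi>] by (intro L2_scale L2_sum) auto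
  fix \<psi> assume \<psi>: "test_function N \<psi>"
  obtain R where R: "\<And>ks. set ks \<subseteq> {..<N} \<times> UNIV \<Longrightarrow> smooth_in_ball N R (iter_partial ks \<phi>)"
    using test_function_smooth[OF \<phi>] by blast
  obtain R' where R': "\<And>ks. set ks \<subseteq> {..<N} \<times> UNIV \<Longrightarrow> smooth_in_ball N R' (iter_partial ks \<psi>)"
    using test_function_smooth[OF \<psi>] by blast
  have mono: "smooth_in_ball N (max R R') f" if "smooth_in_ball N R f \<or> smooth_in_ball N R' f" for f
  proof -
    have "x \<in> config_ball N R \<Longrightarrow> x \<in> config_ball N (max R R')" "x \<in> config_ball N R' \<Longrightarrow> x \<in> config_ball N (max R R')" for x
      by (auto simp: config_ball_iff)
    then show ?thesis using that unfolding smooth_in_ball_def by blast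
  qed
  have p: "(LINT x|config_measure N. \<phi> x * partial i k (partial i k \<psi>) x) =
      (LINT x|config_measure N. partial i k (partial i k \<phi>) x * \<psi> x)" if "i < N" for i k
  proof (rule second_partial_symmetric[where R = "max R R'", OF _ _ _ _ _ _ that])
    show "smooth_in_ball N (max R R') \<phi>" "smooth_in_ball N (max R R') (partial i k \<phi>)"
      "smooth_in_ball N (max R R') (partial i k (partial i k \<phi>))"
      using R[of "[]"] R[of "[(i, k)]"] R[of "[(i, k), (i, k)]"] that by (auto intro!: mono simp: iter_partial_def)
    show "smooth_in_ball N (max R R') \<psi>" "smooth_in_ball N (max R R') (partial i k \<psi>)"
      "smooth_in_ball N (max R R') (partial i k (partial i k \<psi>))"
      using R'[of "[]"] R'[of "[(i, k)]"] R'[of "[(i, k), (i, k)]"] that by (auto intro!: mono simp: iter_partial_def)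
  qed
  have 1: "integrable (config_measure N) (\<lambda>x. \<phi> x * partial i k (partial i k \<psi>) x)"
    "integrable (config_measure N) (\<lambda>x. partial i k (partial i k \<phi>) x * \<psi> x)" if "i < N" for i k
    using s[OF \<phi>] s[OF \<psi>] that by (auto intro: L2_prod_integrable)
  have "(LINT x|config_measure N. \<phi> x * kinetic_test N \<psi> x) =
      (LINT x|config_measure N. - (1 / 2) * (\<Sum>i<N. \<Sum>k\<in>UNIV. \<phi> x * partial i k (partial i k \<psi>) x))"
    by (simp add: kinetic_test_def laplacian_def sum_distrib_left mult.left_commute)
  also have "\<dots> = - (1 / 2) * (\<Sum>i<N. \<Sum>k\<in>UNIV. (LINT x|config_measure N. \<phi> x * partial i k (partial i k \<psi>) x))"
    using 1 by (simp add: Bochner_Integration.integral_sum)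
  also have "\<dots> = - (1 / 2) * (\<Sum>i<N. \<Sum>k\<in>UNIV. (LINT x|config_measure N. partial i k (partial i k \<phi>) x * \<psi> x))"
    using p by simp
  also have "\<dots> = (LINT x|config_measure N. - (1 / 2) * (\<Sum>i<N. \<Sum>k\<in>UNIV. partial i k (partial i k \<phi>) x * \<psi> x))"
    using 1 by (simp add: Bochner_Integration.integral_sum)
  also have "\<dots> = (LINT x|config_measure N. kinetic_test N \<phi> x * \<psi> x)"
    by (simp add: kinetic_test_def laplacian_def sum_distrib_right mult.assoc)
  finally show "(LINT x|config_measure N. \<phi> x * kinetic_test N \<psi> x) = (LINT x|config_measure N. kinetic_test N \<phi> x * \<psi> x)" .
qed

section \<open>Smooth cutoff of Gaussians\<close>

text \<open>The derivative is an existential witness at each stage, so closure properties are proved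
  by exhibiting derivatives instead of computing with iterated \<open>deriv\<close>.\<close>

fun times_differentiable :: "nat \<Rightarrow> (real \<Rightarrow> real) \<Rightarrow> bool" where
  "times_differentiable 0 f \<longleftrightarrow> True"
| "times_differentiable (Suc n) f \<longleftrightarrow>
    (\<exists>f'. (\<forall>x. (f has_real_derivative f' x) (at x)) \<and> times_differentiable n f')"

definition smooth :: "(real \<Rightarrow> real) \<Rightarrow> bool" where
  "smooth f \<longleftrightarrow> (\<forall>n. times_differentiable n f)"

lemma times_differentiable_SucD: "times_differentiable (Suc n) f \<Longrightarrow> times_differentiable n f"
proof (induction n arbitrary: f)
  case (Suc n)
  then show ?case by (metis times_differentiable.simps(2))
qed simp

lemma times_differentiable_const: "times_differentiable n (\<lambda>x. c)"
  by (induction n arbitrary: c) (auto intro!: exI[of _ "\<lambda>x. 0"])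

lemma times_differentiable_add:
  "times_differentiable n f \<Longrightarrow> times_differentiable n g \<Longrightarrow> times_differentiable n (\<lambda>x. f x + g x)"
proof (induction n arbitrary: f g)
  case (Suc n)
  then obtain f' g' where "\<forall>x. (f has_real_derivative f' x) (at x)" "times_differentiable n f'"
    "\<forall>x. (g has_real_derivative g' x) (at x)" "times_differentiable n g'" by auto
  then show ?case using Suc.IH
    by (auto intro!: exI[of _ "\<lambda>x. f' x + g' x"] derivative_eq_intros)
qed simp

lemma times_differentiable_mult:
  "times_differentiable n f \<Longrightarrow> times_differentiable n g \<Longrightarrow> times_differentiable n (\<lambda>x. f x * g x)"
proof (induction n arbitrary: f g)
  case (Suc n)
  then obtain f' g' where d: "\<forall>x. (f has_real_derivative f' x) (at x)" "times_differentiable n f'"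
    "\<forall>x. (g has_real_derivative g' x) (at x)" "times_differentiable n g'" by auto
  have "times_differentiable n f" "times_differentiable n g"
    using Suc.prems by (blast intro: times_differentiable_SucD)+
  then have "times_differentiable n (\<lambda>x. f' x * g x + f x * g' x)"
    using d by (intro times_differentiable_add Suc.IH)
  then show ?case using d
    by (auto intro!: exI[of _ "\<lambda>x. f' x * g x + f x * g' x"] derivative_eq_intros)
qed simp

lemma times_differentiable_affine:
  "times_differentiable n f \<Longrightarrow> times_differentiable n (\<lambda>x. f (a * x + b))"
proof (induction n arbitrary: f)
  case (Suc n)
  then obtain f' where d: "\<forall>x. (f has_real_derivative f' x) (at x)" "times_differentiable n f'" by auto
  have "times_differentiable n (\<lambda>x. a * f' (a * x + b))"
    by (intro times_differentiable_mult times_differentiable_const Suc.IH d)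
  moreover have "((\<lambda>x. f (a * x + b)) has_real_derivative a * f' (a * x + b)) (at x)" for x
  proof -
    have "((\<lambda>x. a * x + b) has_real_derivative a) (at x)" by (auto intro!: derivative_eq_intros)
    from DERIV_chain2[OF d(1)[rule_format] this] show ?thesis by (simp add: mult.commute)
  qed
  ultimately show ?case by (auto intro!: exI[of _ "\<lambda>x. a * f' (a * x + b)"])
qed simp

lemma smooth_deriv:
  assumes "smooth f"
  shows "(f has_real_derivative deriv f x) (at x)" "smooth (deriv f)"
proof -
  have "\<exists>f'. (\<forall>x. (f has_real_derivative f' x) (at x)) \<and> times_differentiable n f'" for n
    using assms unfolding smooth_def by (metis times_differentiable.simps(2))
  then have *: "(\<forall>x. (f has_real_derivative deriv f x) (at x)) \<and> times_differentiable n (deriv f)" for n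
    by (metis DERIV_imp_deriv ext)
  show "(f has_real_derivative deriv f x) (at x)" "smooth (deriv f)"
    using * by (auto simp: smooth_def)
qed

lemma smooth_mult: "smooth f \<Longrightarrow> smooth g \<Longrightarrow> smooth (\<lambda>x. f x * g x)"
  by (simp add: smooth_def times_differentiable_mult)

lemma smooth_affine: "smooth f \<Longrightarrow> smooth (\<lambda>x. f (a * x + b))"
  by (simp add: smooth_def times_differentiable_affine)

lemma smooth_const: "smooth (\<lambda>x. c)"
  by (simp add: smooth_def times_differentiable_const)

text \<open>Polynomial multiples of a Gaussian are closed under differentiation, which makes the
  induction go through.\<close>

lemma smooth_gauss: "smooth (gauss t)"
proof -
  have "times_differentiable n (\<lambda>x. poly p x * exp (- x\<^sup>2 * c))" for n p c
  proof (induction n arbitrary: p)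
    case (Suc n)
    have "((\<lambda>x. poly p x * exp (- x\<^sup>2 * c)) has_real_derivative
        poly (pderiv p + p * [:0, - 2 * c:]) x * exp (- x\<^sup>2 * c)) (at x)" for x
      by (auto intro!: derivative_eq_intros poly_DERIV simp: algebra_simps)
    then show ?case
      using Suc.IH[of "pderiv p + p * [:0, - 2 * c:]"]
      by (auto simp only: times_differentiable.simps
          intro!: exI[of _ "\<lambda>x. poly (pderiv p + p * [:0, - 2 * c:]) x * exp (- x\<^sup>2 * c)"])
  qed simp
  from this[of _ "[:1 / sqrt (2 * pi * (sqrt t)\<^sup>2):]" "1 / (2 * (sqrt t)\<^sup>2)"]
  show ?thesis unfolding smooth_def normal_density_def[abs_def] by simp
qed

text \<open>The polynomial makes this family of functions closed under differentiation.\<close>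

definition flat :: "real poly \<Rightarrow> real \<Rightarrow> real" where
  "flat p x = (if x \<le> 0 then 0 else poly p (1 / x) * exp (- (1 / x)))"

lemma poly_exp_tendsto_0: "((\<lambda>u. u ^ k * poly p u * exp (- u)) \<longlongrightarrow> 0) at_top" for p :: "real poly"
proof (induction p arbitrary: k)
  case (pCons a p)
  have "((\<lambda>u. u ^ k / exp u) \<longlongrightarrow> 0) (at_top :: real filter)" by (rule tendsto_power_div_exp_0)
  then have "((\<lambda>u. a * (u ^ k / exp u) + u ^ Suc k * poly p u * exp (- u)) \<longlongrightarrow> a * 0 + 0) at_top"
    by (intro tendsto_intros pCons.IH)
  then show ?case
    by (simp add: algebra_simps exp_minus divide_inverse)
qed simp

text \<open>With u = 1 / x the derivative of u is - u^2, so p(u) exp (- u) becomes u^2 (p - p')(u)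
  exp (- u), and \<open>[:0, 0, 1:]\<close> is u^2. At x = 0 the right-hand difference quotient is u
  p(u) exp (- u), which tends to 0 by \<open>poly_exp_tendsto_0\<close>.\<close>

lemma flat_DERIV: "(flat p has_real_derivative flat ([:0, 0, 1:] * (p - pderiv p)) x) (at x)"
proof -
  consider "x < 0" | "x = 0" | "x > 0" by linarith
  then show ?thesis
  proof cases
    case 1
    have "((\<lambda>_. 0) has_real_derivative 0) (at x)" by simp
    then have "(flat p has_real_derivative 0) (at x)"
      by (rule has_field_derivative_transform_within_open[of _ _ _ "{..<0}"]) (use 1 in \<open>auto simp: flat_def\<close>)
    then show ?thesis using 1 by (simp add: flat_def)
  next
    case 3
    have "((\<lambda>x. poly p (1 / x) * exp (- (1 / x))) has_real_derivative
        flat ([:0, 0, 1:] * (p - pderiv p)) x) (at x)"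
    proof -
      have "((\<lambda>x. 1 / x) has_real_derivative - 1 / x\<^sup>2) (at x)"
        using 3 by (auto intro!: derivative_eq_intros simp: power2_eq_square)
      from DERIV_chain2[OF poly_DERIV this, of p]
      have "((\<lambda>x. poly p (1 / x)) has_real_derivative poly (pderiv p) (1 / x) * (- 1 / x\<^sup>2)) (at x)" .
      then show ?thesis using 3
        by (auto intro!: derivative_eq_intros simp: flat_def power2_eq_square field_simps)
    qed
    then show ?thesis
      by (rule has_field_derivative_transform_within_open[of _ _ _ "{0<..}"]) (use 3 in \<open>auto simp: flat_def\<close>)
  next
    case 2
    have "((\<lambda>h. flat p h / h) \<longlongrightarrow> 0) (at_right 0)"
    proof (rule Lim_transform_eventually)
      show "((\<lambda>h. (1 / h) ^ 1 * poly p (1 / h) * exp (- (1 / h))) \<longlongrightarrow> 0) (at_right 0)"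
        using filterlim_compose[OF poly_exp_tendsto_0[of 1 p] filterlim_inverse_at_top_right]
        by (simp add: inverse_eq_divide)
      show "\<forall>\<^sub>F h in at_right 0. (1 / h) ^ 1 * poly p (1 / h) * exp (- (1 / h)) = flat p h / h"
        using eventually_at_right_less[of 0] by eventually_elim (simp add: flat_def)
    qed
    moreover have "((\<lambda>h. flat p h / h) \<longlongrightarrow> 0) (at_left 0)"
      by (rule tendsto_eventually) (auto simp: eventually_at_left_field flat_def intro!: exI[of _ "- 1"])
    ultimately have "((\<lambda>h. flat p h / h) \<longlongrightarrow> 0) (at 0)" by (simp add: filterlim_split_at)
    then show ?thesis using 2 by (simp add: has_field_derivative_iff flat_def)
  qed
qed

lemma smooth_flat: "smooth (flat p)"
proof -
  have "times_differentiable n (flat p)" for n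
    by (induction n arbitrary: p) (use flat_DERIV in \<open>auto simp only: times_differentiable.simps\<close>)
  then show ?thesis by (simp add: smooth_def)
qed

text \<open>The product of \<open>flat 1\<close> at 1 + s and at 1 - s, normalised at 0. No plateau
  around 0 is required: after rescaling to s / (m + 1) only the value at 0 survives in the limit.
  Compact support makes the derivatives bounded.\<close>

lemma smooth_bump:
  obtains \<zeta> :: "real \<Rightarrow> real" and A where "smooth \<zeta>" "\<zeta> 0 = 1" "\<And>s. \<bar>s\<bar> \<ge> 1 \<Longrightarrow> \<zeta> s = 0"
    "\<And>s. \<bar>\<zeta> s\<bar> \<le> A" "\<And>s. \<bar>deriv \<zeta> s\<bar> \<le> A" "\<And>s. \<bar>deriv (deriv \<zeta>) s\<bar> \<le> A"
proof -
  define a where "a = flat 1 1"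
  define \<zeta> where "\<zeta> = (\<lambda>s. 1 / a\<^sup>2 * (flat 1 (1 * s + 1) * flat 1 ((- 1) * s + 1)))"
  have sm: "smooth \<zeta>" unfolding \<zeta>_def by (intro smooth_mult smooth_const smooth_affine smooth_flat)
  have z: "\<zeta> s = 0" if "\<bar>s\<bar> \<ge> 1" for s using that by (auto simp: \<zeta>_def flat_def)
  have one: "\<zeta> 0 = 1" by (simp add: \<zeta>_def a_def power2_eq_square) (simp add: flat_def)
  \<comment> \<open>The strict inequality describes an open set, on which the derivative inherits
    the zeros.\<close>
  have zd: "(deriv f) s = 0" if f: "smooth f" "\<And>s. \<bar>s\<bar> > 1 \<Longrightarrow> f s = 0" and s: "\<bar>s\<bar> > 1" for f s
  proof (rule DERIV_imp_deriv)
    have "((\<lambda>_. 0) has_real_derivative 0) (at s)" by simp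
    then show "(f has_real_derivative 0) (at s)"
    proof (rule has_field_derivative_transform_within_open[of _ _ _ "{s. \<bar>s\<bar> > 1}"])
      have "open {s :: real. 1 < \<bar>s\<bar>}" by (intro open_Collect_less continuous_intros)
      then show "open {s :: real. \<bar>s\<bar> > 1}" .
    qed (use f s in auto)
  qed
  have bd: "\<exists>A. \<forall>s. \<bar>f s\<bar> \<le> A" if f: "smooth f" "\<And>s. \<bar>s\<bar> > 1 \<Longrightarrow> f s = 0" for f
  proof -
    have "continuous_on {-1..1} f"
      using smooth_deriv(1)[OF f(1)] by (meson DERIV_isCont continuous_at_imp_continuous_on)
    then have "bounded (f ` {-1..1})" by (intro compact_imp_bounded compact_continuous_image) auto
    then obtain A where A: "A > 0" "\<forall>s\<in>{-1..1}. \<bar>f s\<bar> \<le> A" by (auto simp: bounded_pos)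
    have "\<bar>f s\<bar> \<le> A" for s using A f(2)[of s] by (cases "s \<in> {-1..1}") (auto simp: abs_if)
    then show ?thesis by blast
  qed
  have z0: "\<And>s. \<bar>s\<bar> > 1 \<Longrightarrow> \<zeta> s = 0" using z by auto
  note z1 = zd[OF sm z0] and z2 = zd[OF smooth_deriv(2)[OF sm] zd[OF sm z0]]
  obtain A0 where A0: "\<forall>s. \<bar>\<zeta> s\<bar> \<le> A0" using bd[OF sm z0] by blast
  obtain A1 where A1: "\<forall>s. \<bar>deriv \<zeta> s\<bar> \<le> A1" using bd[OF smooth_deriv(2)[OF sm] z1] by blast
  obtain A2 where A2: "\<forall>s. \<bar>deriv (deriv \<zeta>) s\<bar> \<le> A2" using bd[OF smooth_deriv(2)[OF smooth_deriv(2)[OF sm]] z2] by blast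
  show thesis
    by (rule that[OF sm one z, of "max A0 (max A1 A2)"]) (use A0 A1 A2 in \<open>auto simp: le_max_iff_disj\<close>)
qed

lemma gauss_DERIV: "0 < t \<Longrightarrow> (gauss t has_real_derivative - (a / t) * gauss t a) (at a)"
  unfolding normal_density_def[abs_def]
  by (auto intro!: derivative_eq_intros simp: field_simps)

lemma x_exp_bound: "0 \<le> x \<Longrightarrow> x * exp (- x) \<le> (1::real)"
proof -
  have "x \<le> exp x" using exp_ge_add_one_self[of x] by linarith
  then show ?thesis by (simp add: exp_minus divide_simps)
qed

text \<open>Halving the exponent leaves a factor exp (- q) with q = a^2 / (4 t), which absorbs
  polynomials in \<open>a\<close>. Hence the Gaussian and its first two derivatives are dominated by
  a Gaussian of twice the variance, the source of the majorant in \<open>kinetic_heatN\<close>. The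
  factor sqrt 2 between the normalisations is rounded up to 2.\<close>

lemma gauss_double_bound:
  assumes t: "0 < t"
  shows "gauss t a \<le> 2 * gauss (2 * t) a" "\<bar>a / t * gauss t a\<bar> \<le> (2 / t + 8) * gauss (2 * t) a"
    "\<bar>(a\<^sup>2 / t\<^sup>2 - 1 / t) * gauss t a\<bar> \<le> 10 / t * gauss (2 * t) a"
proof -
  define q where "q = a\<^sup>2 / (4 * t)"
  have q0: "0 \<le> q" using t by (simp add: q_def)
  have g: "gauss t a = sqrt 2 * gauss (2 * t) a * exp (- q)"
  proof -
    have "exp (- a\<^sup>2 / (2 * t)) = exp (- a\<^sup>2 / (2 * (2 * t))) * exp (- q)"
      using t by (simp add: q_def exp_add[symmetric] field_simps)
    moreover have "1 / sqrt (2 * pi * t) = sqrt 2 * (1 / sqrt (2 * pi * (2 * t)))"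
      using t by (simp add: real_sqrt_mult field_simps)
    ultimately show ?thesis using t by (simp add: gauss_eq)
  qed
  have s2: "sqrt 2 \<le> 2" using real_sqrt_le_iff[of 2 4] by simp
  have key: "\<bar>c * gauss t a\<bar> \<le> 2 * B * gauss (2 * t) a" if c: "\<bar>c\<bar> * exp (- q) \<le> B" for c B
  proof -
    have "\<bar>c * gauss t a\<bar> = sqrt 2 * (\<bar>c\<bar> * exp (- q)) * gauss (2 * t) a"
      unfolding g by (simp add: abs_mult)
    also have "\<dots> \<le> 2 * B * gauss (2 * t) a"
      using c s2 by (intro mult_right_mono mult_mono) auto
    finally show ?thesis .
  qed
  show "gauss t a \<le> 2 * gauss (2 * t) a"
    using key[of 1 1] q0 by simp
  have qe: "q * exp (- q) \<le> 1" by (rule x_exp_bound[OF q0])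
  have e1: "exp (- q) \<le> 1" using q0 by simp
  have "\<bar>a / t\<bar> * exp (- q) \<le> 1 / t + 4"
  proof -
    have "\<bar>a\<bar> \<le> 1 + a\<^sup>2" using sum_squares_bound[of "\<bar>a\<bar>" 1] by simp
    then have "\<bar>a / t\<bar> \<le> 1 / t + 4 * q" using t by (simp add: q_def field_simps)
    then have "\<bar>a / t\<bar> * exp (- q) \<le> (1 / t + 4 * q) * exp (- q)" by (rule mult_right_mono) simp
    also have "\<dots> = 1 / t * exp (- q) + 4 * (q * exp (- q))" by (simp add: algebra_simps)
    also have "\<dots> \<le> 1 / t * 1 + 4 * 1"
      using qe e1 t by (intro add_mono mult_left_mono) auto
    finally show ?thesis by simp
  qed
  from key[OF this] show "\<bar>a / t * gauss t a\<bar> \<le> (2 / t + 8) * gauss (2 * t) a" by (simp add: algebra_simps)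
  have "\<bar>a\<^sup>2 / t\<^sup>2 - 1 / t\<bar> * exp (- q) \<le> 5 / t"
  proof -
    have "\<bar>a\<^sup>2 / t\<^sup>2 - 1 / t\<bar> \<le> a\<^sup>2 / t\<^sup>2 + 1 / t" using t by (simp add: abs_le_iff)
    also have "\<dots> = 1 / t * (4 * q + 1)" using t by (simp add: q_def power2_eq_square field_simps)
    finally have "\<bar>a\<^sup>2 / t\<^sup>2 - 1 / t\<bar> * exp (- q) \<le> 1 / t * (4 * q + 1) * exp (- q)" by (rule mult_right_mono) simp
    also have "\<dots> = 1 / t * (4 * (q * exp (- q)) + exp (- q))" by (simp add: algebra_simps)
    also have "\<dots> \<le> 1 / t * 5"
    proof (rule mult_left_mono)
      show "4 * (q * exp (- q)) + exp (- q) \<le> 5" using qe e1 by linarith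
    qed (use t in simp)
    finally show ?thesis by simp
  qed
  from key[OF this] show "\<bar>(a\<^sup>2 / t\<^sup>2 - 1 / t) * gauss t a\<bar> \<le> 10 / t * gauss (2 * t) a" by simp
qed

text \<open>The function is the Gaussian centred at y times the bump at s / (m + 1). The cut-off is
  centred at 0 for every y, so the support bound depends on m alone. Each derivative that falls on
  the cut-off carries a factor 1 / (m + 1), which is why the second derivatives converge to that of
  the Gaussian.\<close>

lemma gauss_cutoff:
  assumes t: "0 < t"
  obtains g :: "real \<Rightarrow> nat \<Rightarrow> real \<Rightarrow> real" and C where "0 \<le> C" "\<And>y m. smooth (g y m)"
    "\<And>y m s. \<bar>s\<bar> > real (Suc m) \<Longrightarrow> g y m s = 0"
    "\<And>y m s. \<bar>g y m s\<bar> \<le> C * gauss (2 * t) (s - y)"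
    "\<And>y m s. \<bar>deriv (deriv (g y m)) s\<bar> \<le> C * gauss (2 * t) (s - y)"
    "\<And>y s. (\<lambda>m. g y m s) \<longlonglongrightarrow> gauss t (s - y)"
    "\<And>y s. (\<lambda>m. deriv (deriv (g y m)) s) \<longlonglongrightarrow> ((s - y)\<^sup>2 / t\<^sup>2 - 1 / t) * gauss t (s - y)"
proof -
  obtain \<zeta> A where \<zeta>: "smooth \<zeta>" "\<zeta> 0 = 1" "\<And>s. \<bar>s\<bar> \<ge> 1 \<Longrightarrow> \<zeta> s = 0"
    "\<And>s. \<bar>\<zeta> s\<bar> \<le> A" "\<And>s. \<bar>deriv \<zeta> s\<bar> \<le> A" "\<And>s. \<bar>deriv (deriv \<zeta>) s\<bar> \<le> A"
    using smooth_bump by metis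
  define c where "c = (\<lambda>m::nat. 1 / real (Suc m))"
  define \<zeta>1 where "\<zeta>1 = deriv \<zeta>"
  define \<zeta>2 where "\<zeta>2 = deriv \<zeta>1"
  define n where "n = (\<lambda>y s. gauss t (s - y))"
  define n1 where "n1 = (\<lambda>y s. - ((s - y) / t) * gauss t (s - y))"
  define n2 where "n2 = (\<lambda>y s. ((s - y)\<^sup>2 / t\<^sup>2 - 1 / t) * gauss t (s - y))"
  have d\<zeta>: "(\<zeta> has_real_derivative \<zeta>1 x) (at x)" "(\<zeta>1 has_real_derivative \<zeta>2 x) (at x)" for x
    unfolding \<zeta>1_def \<zeta>2_def using smooth_deriv \<zeta>(1) by auto
  have dn: "(n y has_real_derivative n1 y s) (at s)" for y s
  proof -
    have "((\<lambda>s. s - y) has_real_derivative 1) (at s)" by (auto intro!: derivative_eq_intros)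
    from DERIV_chain2[OF gauss_DERIV[OF t] this] show ?thesis by (simp add: n_def[abs_def] n1_def)
  qed
  have dn1: "(n1 y has_real_derivative n2 y s) (at s)" for y s
  proof -
    have "((\<lambda>s. - ((s - y) / t)) has_real_derivative - (1 / t)) (at s)"
      using t by (auto intro!: derivative_eq_intros)
    from DERIV_mult[OF this dn] have "(n1 y has_real_derivative - (1 / t) * n y s + n1 y s * - ((s - y) / t)) (at s)"
      by (simp add: n1_def[abs_def] n_def)
    moreover have "- (1 / t) * n y s + n1 y s * - ((s - y) / t) = n2 y s"
      using t by (simp add: n1_def n2_def n_def field_simps power2_eq_square)
    ultimately show ?thesis by simp
  qed
  have dc: "((\<lambda>s. f (c m * s)) has_real_derivative c m * f' (c m * s)) (at s)"
    if "\<And>x. (f has_real_derivative f' x) (at x)" for f f' s m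
  proof -
    have "((\<lambda>s. c m * s) has_real_derivative c m) (at s)" by (auto intro!: derivative_eq_intros)
    from DERIV_chain2[OF that this] show ?thesis by (simp add: mult.commute)
  qed
  define g where "g = (\<lambda>y m s. n y s * \<zeta> (c m * s))"
  note dz = dc[OF d\<zeta>(1)] and dz1 = dc[OF d\<zeta>(2)]
  have d1: "deriv (g y m) = (\<lambda>s. n1 y s * \<zeta> (c m * s) + n y s * (c m * \<zeta>1 (c m * s)))" for y m
    unfolding g_def using DERIV_imp_deriv[OF DERIV_mult[OF dn dz]] by (auto simp: fun_eq_iff algebra_simps)
  have d2: "deriv (deriv (g y m)) s = n2 y s * \<zeta> (c m * s) + 2 * c m * n1 y s * \<zeta>1 (c m * s) + (c m)\<^sup>2 * n y s * \<zeta>2 (c m * s)" for y m s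
    unfolding d1 DERIV_imp_deriv[OF DERIV_add[OF DERIV_mult[OF dn1 dz] DERIV_mult[OF dn DERIV_cmult[OF dz1]]]]
    by (simp add: power2_eq_square algebra_simps)
  have c01: "0 \<le> c m" "c m \<le> 1" for m by (auto simp: c_def)
  have A0: "0 \<le> A" using \<zeta>(4)[of 0] by linarith
  have c0: "c \<longlonglongrightarrow> 0" unfolding c_def by (rule LIMSEQ_Suc[OF lim_1_over_n])
  have lim: "(\<lambda>m. f (c m * s)) \<longlonglongrightarrow> f 0" if "\<And>x. (f has_real_derivative f' x) (at x)" for f f' s
  proof -
    have "(\<lambda>m. c m * s) \<longlonglongrightarrow> 0 * s" by (intro tendsto_intros c0)
    then have "(\<lambda>m. c m * s) \<longlonglongrightarrow> 0" by simp
    from isCont_tendsto_compose[OF DERIV_isCont[OF that] this] show ?thesis .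
  qed
  have l\<zeta>2: "(\<lambda>m. (c m)\<^sup>2 * n y s * \<zeta>2 (c m * s)) \<longlonglongrightarrow> 0" for y s
  proof (rule Lim_null_comparison)
    show "(\<lambda>m. (c m)\<^sup>2 * (n y s * A)) \<longlonglongrightarrow> 0"
      using tendsto_mult_right[OF tendsto_power[OF c0, of 2], of "n y s * A"] by simp
    show "\<forall>\<^sub>F m in sequentially. norm ((c m)\<^sup>2 * n y s * \<zeta>2 (c m * s)) \<le> (c m)\<^sup>2 * (n y s * A)"
      using \<zeta>(6) by (intro always_eventually allI)
        (auto simp: abs_mult n_def \<zeta>2_def \<zeta>1_def mult.assoc intro!: mult_left_mono)
  qed
  define G where "G = (\<lambda>y s. gauss (2 * t) (s - y))"
  have b: "\<bar>n y s\<bar> \<le> 2 * G y s" "\<bar>n1 y s\<bar> \<le> (2 / t + 8) * G y s" "\<bar>n2 y s\<bar> \<le> 10 / t * G y s" for y s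
    using gauss_double_bound[OF t, of "s - y"] by (auto simp: n_def n1_def n2_def G_def)
  have G0: "0 \<le> G y s" for y s by (simp add: G_def)
  \<comment> \<open>One summand for each term of the product rule: both derivatives on the Gaussian,
    one on each factor, both on the cut-off.\<close>
  define C where "C = A * (10 / t + 2 * (2 / t + 8) + 2)"
  have C0: "0 \<le> C" using A0 t by (simp add: C_def)
  show thesis
  proof (rule that[of C g])
    show "smooth (g y m)" for y m
      using smooth_mult[OF smooth_affine[OF smooth_gauss, of t 1 "- y"] smooth_affine[OF \<zeta>(1), of "c m" 0]]
      by (simp add: g_def n_def)
    show "g y m s = 0" if "\<bar>s\<bar> > real (Suc m)" for y m s
      using \<zeta>(3)[of "c m * s"] that by (simp add: g_def c_def abs_mult field_simps)
    show "\<bar>g y m s\<bar> \<le> C * gauss (2 * t) (s - y)" for y m s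
    proof -
      have "\<bar>g y m s\<bar> \<le> 2 * G y s * A"
        unfolding g_def abs_mult using b \<zeta>(4) G0 by (intro mult_mono) auto
      also have "\<dots> \<le> C * G y s" using A0 G0[of y s] t by (simp add: C_def algebra_simps)
      finally show ?thesis by (simp add: G_def)
    qed
    show "\<bar>deriv (deriv (g y m)) s\<bar> \<le> C * gauss (2 * t) (s - y)" for y m s
    proof -
      have "\<bar>n2 y s * \<zeta> (c m * s)\<bar> \<le> 10 / t * G y s * A"
        unfolding abs_mult using b \<zeta>(4) G0 t by (intro mult_mono) auto
      moreover have "\<bar>2 * c m * n1 y s * \<zeta>1 (c m * s)\<bar> \<le> 2 * 1 * ((2 / t + 8) * G y s) * A"
        unfolding abs_mult \<zeta>1_def using b \<zeta>(5) c01 G0[of y s] t by (intro mult_mono) auto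
      moreover have "\<bar>(c m)\<^sup>2 * n y s * \<zeta>2 (c m * s)\<bar> \<le> 1 * (2 * G y s) * A"
        unfolding abs_mult \<zeta>1_def \<zeta>2_def using b \<zeta>(6) c01 G0[of y s]
        by (intro mult_mono) (auto simp: power_le_one)
      ultimately have "\<bar>deriv (deriv (g y m)) s\<bar> \<le> 10 / t * G y s * A + 2 * 1 * ((2 / t + 8) * G y s) * A + 1 * (2 * G y s) * A"
        unfolding d2 by linarith
      also have "\<dots> = C * G y s" by (simp add: C_def algebra_simps)
      finally show ?thesis by (simp add: G_def)
    qed
    show "(\<lambda>m. g y m s) \<longlonglongrightarrow> gauss t (s - y)" for y s
      using tendsto_mult_left[OF lim[OF d\<zeta>(1)], of "n y s" s] \<zeta>(2) by (simp add: g_def n_def)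
    show "(\<lambda>m. deriv (deriv (g y m)) s) \<longlonglongrightarrow> ((s - y)\<^sup>2 / t\<^sup>2 - 1 / t) * gauss t (s - y)" for y s
    proof -
      have "(\<lambda>m. n2 y s * \<zeta> (c m * s) + 2 * c m * n1 y s * \<zeta>1 (c m * s) + (c m)\<^sup>2 * n y s * \<zeta>2 (c m * s))
          \<longlonglongrightarrow> n2 y s * \<zeta> 0 + 2 * 0 * n1 y s * \<zeta>1 0 + 0"
        by (intro tendsto_intros lim[OF d\<zeta>(1)] lim[OF d\<zeta>(2)] c0 l\<zeta>2)
      then show ?thesis using \<zeta>(2) unfolding d2 by (simp add: n2_def)
    qed
  qed (rule C0)
qed

section \<open>The heat kernel as a limit of test functions\<close>

text \<open>The polynomial \<open>2 \<sigma> s + 1/2\<close> is the indicator of \<open>s = \<sigma>\<close> on \<open>{- 1/2, 1/2}\<close> and is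
  visibly continuous.\<close>

definition spin_factor :: "nat \<Rightarrow> (nat \<Rightarrow> real) \<Rightarrow> config \<Rightarrow> real" where
  "spin_factor N \<sigma> x = (\<Prod>i<N. 2 * \<sigma> i * snd (x i) + 1 / 2)"

text \<open>Products of functions of one coordinate, indexed by particle and direction. A partial
  derivative changes a single factor, so iterated partial derivatives stay in this class and the
  conditions on test functions reduce to one variable.\<close>

definition product_function :: "nat \<Rightarrow> (nat \<Rightarrow> real) \<Rightarrow> (nat \<times> 3 \<Rightarrow> real \<Rightarrow> real) \<Rightarrow> config \<Rightarrow> complex" where
  "product_function N \<sigma> G x =
    complex_of_real (spin_factor N \<sigma> x * (\<Prod>p\<in>{..<N}\<times>UNIV. G p (fst (x (fst p)) $ snd p)))"

lemma spin_factor_indicator: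
  "s \<in> spins \<Longrightarrow> s' \<in> spins \<Longrightarrow> 2 * s * s' + 1 / 2 = of_bool (s' = s)"
  by (elim insertE emptyE; hypsubst; simp)

lemma spin_factor_eq:
  assumes "x \<in> space (config_measure N)" "y \<in> space (config_measure N)"
  shows "spin_factor N (\<lambda>i. snd (y i)) x = (\<Prod>i<N. of_bool (snd (x i) = snd (y i)))"
  unfolding spin_factor_def
proof (intro prod.cong refl)
  fix i assume "i \<in> {..<N}"
  then have "snd (x i) \<in> spins" "snd (y i) \<in> spins"
    using space_configD[OF assms(1), of i] space_configD[OF assms(2), of i] by (auto simp: space_particle)
  then show "2 * snd (y i) * snd (x i) + 1 / 2 = of_bool (snd (x i) = snd (y i))"
    by (intro spin_factor_indicator)
qed

lemma product_function_shift:
  assumes i: "i < N"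
  shows "product_function N \<sigma> G (shift i k h x) = complex_of_real (spin_factor N \<sigma> x *
    (G (i, k) (fst (x i) $ k + h) * (\<Prod>p\<in>{..<N}\<times>UNIV-{(i, k)}. G p (fst (x (fst p)) $ snd p))))"
proof -
  have s: "spin_factor N \<sigma> (shift i k h x) = spin_factor N \<sigma> x"
    unfolding spin_factor_def by (intro prod.cong refl) (auto simp: shift_def)
  have c: "fst (shift i k h x (fst p)) $ snd p = fst (x (fst p)) $ snd p + (if p = (i, k) then h else 0)" for p
    by (cases p) (auto simp: shift_def axis_def)
  have "(\<Prod>p\<in>{..<N}\<times>UNIV. G p (fst (shift i k h x (fst p)) $ snd p)) =
      G (i, k) (fst (x i) $ k + h) * (\<Prod>p\<in>{..<N}\<times>UNIV-{(i, k)}. G p (fst (shift i k h x (fst p)) $ snd p))"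
    using i c[of "(i, k)"] by (subst prod.remove[of _ "(i, k)"]) auto
  also have "(\<Prod>p\<in>{..<N}\<times>UNIV-{(i, k)}. G p (fst (shift i k h x (fst p)) $ snd p)) =
      (\<Prod>p\<in>{..<N}\<times>UNIV-{(i, k)}. G p (fst (x (fst p)) $ snd p))"
    by (intro prod.cong refl) (auto simp: c)
  finally show ?thesis by (simp add: product_function_def s)
qed

lemma product_function_line:
  assumes i: "i < N" and G: "\<And>s. (G (i, k) has_real_derivative G' s) (at s)"
  shows "((\<lambda>h. product_function N \<sigma> G (shift i k h x)) has_vector_derivative
    product_function N \<sigma> (G((i, k) := G')) x) (at 0)"
proof -
  define c where "c = (\<Prod>p\<in>{..<N}\<times>UNIV-{(i, k)}. G p (fst (x (fst p)) $ snd p))"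
  have "((\<lambda>h. fst (x i) $ k + h) has_real_derivative 1) (at 0)" by (auto intro!: derivative_eq_intros)
  then have "((\<lambda>h. G (i, k) (fst (x i) $ k + h)) has_real_derivative G' (fst (x i) $ k)) (at 0)"
    using DERIV_chain2[of "G (i, k)" "G' (fst (x i) $ k)" "\<lambda>h. fst (x i) $ k + h" 0 1] G by simp
  then have "((\<lambda>h. spin_factor N \<sigma> x * (G (i, k) (fst (x i) $ k + h) * c)) has_real_derivative
      spin_factor N \<sigma> x * (G' (fst (x i) $ k) * c)) (at 0)"
    by (intro DERIV_cmult DERIV_cmult_right)
  then have "((\<lambda>h. complex_of_real (spin_factor N \<sigma> x * (G (i, k) (fst (x i) $ k + h) * c))) has_vector_derivative
      complex_of_real (spin_factor N \<sigma> x * (G' (fst (x i) $ k) * c))) (at 0)"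
    by (intro has_vector_derivative_of_real) (simp add: has_real_derivative_iff_has_vector_derivative)
  moreover have "product_function N \<sigma> (G((i, k) := G')) x = complex_of_real (spin_factor N \<sigma> x * (G' (fst (x i) $ k) * c))"
  proof -
    have "(\<Prod>p\<in>{..<N}\<times>UNIV-{(i, k)}. (G((i, k) := G')) p (fst (x (fst p)) $ snd p)) = c"
      unfolding c_def by (intro prod.cong refl) auto
    then show ?thesis
      using product_function_shift[OF i, of \<sigma> "G((i, k) := G')" k 0 x] by simp
  qed
  ultimately show ?thesis by (simp add: product_function_shift[OF i] c_def)
qed

lemma partial_product_function:
  assumes "i < N" "smooth (G (i, k))"
  shows "partial i k (product_function N \<sigma> G) = product_function N \<sigma> (G((i, k) := deriv (G (i, k))))"
  unfolding partial_def
  using product_function_line[of i N G k "deriv (G (i, k))", OF assms(1) smooth_deriv(1)[OF assms(2)]] by (intro ext vector_derivative_at)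

lemma iter_partial_product_function:
  assumes G: "\<And>p. smooth (G p)" and ks: "set ks \<subseteq> {..<N} \<times> UNIV"
  shows "\<exists>G'. (\<forall>p. smooth (G' p)) \<and> iter_partial ks (product_function N \<sigma> G) = product_function N \<sigma> G'"
  using ks
proof (induction ks)
  case Nil
  then show ?case using G by (auto simp: iter_partial_def)
next
  case (Cons p ks)
  obtain i k where p: "p = (i, k)" by (cases p)
  obtain G' where G': "\<And>p. smooth (G' p)" "iter_partial ks (product_function N \<sigma> G) = product_function N \<sigma> G'"
    using Cons by auto
  have "iter_partial (p # ks) (product_function N \<sigma> G) = product_function N \<sigma> (G'((i, k) := deriv (G' (i, k))))"
    using Cons.prems partial_product_function[OF _ G'(1)] G'(2) p by (simp add: iter_partial_def)
  moreover have "smooth ((G'((i, k) := deriv (G' (i, k)))) q)" for q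
    using G'(1) smooth_deriv(2)[OF G'(1)] by simp
  ultimately show ?case by blast
qed

lemma smooth_continuous: "smooth f \<Longrightarrow> continuous_on UNIV f"
  using smooth_deriv(1) by (meson DERIV_isCont continuous_at_imp_continuous_on)

lemma continuous_product_function:
  assumes G: "\<And>p. smooth (G p)"
  shows "continuous_on S (product_function N \<sigma> G)"
proof -
  have x: "continuous_on S (\<lambda>x :: config. x i)" for i
    by (rule continuous_on_subset[OF continuous_on_product_coordinates]) simp
  have nth: "continuous_on S (\<lambda>x :: config. fst (x i) $ k)" for i k
    by (intro continuous_on_component continuous_on_fst x)
  have "continuous_on S (\<lambda>x. G p (fst (x (fst p)) $ snd p))" for p
    using continuous_on_compose2[OF smooth_continuous[OF G] nth] by auto
  then show ?thesis
    unfolding product_function_def[abs_def] spin_factor_def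
    by (intro continuous_intros continuous_on_snd x) auto
qed

lemma test_function_product:
  assumes G: "\<And>p. smooth (G p)" and z: "\<And>p s. \<bar>s\<bar> > r \<Longrightarrow> G p s = 0"
  shows "test_function N (product_function N \<sigma> G)"
  unfolding test_function_def
proof (intro conjI allI impI)
  fix ks :: "(nat \<times> 3) list" assume ks: "set ks \<subseteq> {..<N} \<times> UNIV"
  obtain G' where G': "\<And>p. smooth (G' p)" "iter_partial ks (product_function N \<sigma> G) = product_function N \<sigma> G'"
    using iter_partial_product_function[of G, OF G ks] by blast
  show "continuous_on (space (config_measure N)) (iter_partial ks (product_function N \<sigma> G))"
    unfolding G'(2) by (rule continuous_product_function[OF G'(1)])
  show "\<forall>x\<in>space (config_measure N). \<forall>i<N. \<forall>k. (\<lambda>h. iter_partial ks (product_function N \<sigma> G) (shift i k h x)) differentiable at 0"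
    unfolding G'(2)
  proof (intro ballI allI impI)
    fix x i k assume "i < N"
    from product_function_line[of i N G' k "deriv (G' (i, k))", OF this smooth_deriv(1)[OF G'(1)]]
    show "(\<lambda>h. product_function N \<sigma> G' (shift i k h x)) differentiable at 0"
      by (rule differentiableI_vector)
  qed
next
  show "\<exists>R. \<forall>x\<in>space (config_measure N). (\<exists>i<N. R < norm (fst (x i))) \<longrightarrow> product_function N \<sigma> G x = 0"
  \<comment> \<open>A vector of norm above 3 r has a component above r in absolute value, by the l1
    bound on the norm, and the factor of that component vanishes.\<close>
  proof (intro exI[of _ "real CARD(3) * r"] ballI impI)
    fix x :: config assume "\<exists>i<N. real CARD(3) * r < norm (fst (x i))"
    then obtain i where i: "i < N" "real CARD(3) * r < norm (fst (x i))" by blast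
    have "\<exists>k. \<bar>fst (x i) $ k\<bar> > r"
    proof (rule ccontr)
      assume "\<not> ?thesis"
      then have "(\<Sum>k\<in>UNIV. \<bar>fst (x i) $ k\<bar>) \<le> (\<Sum>k\<in>(UNIV :: 3 set). r)"
        by (intro sum_mono) (simp add: not_less)
      then show False using i(2) norm_le_l1_cart[of "fst (x i)"] by simp
    qed
    then obtain k where "G (i, k) (fst (x i) $ k) = 0" using z by blast
    then have "(\<Prod>p\<in>{..<N}\<times>UNIV. G p (fst (x (fst p)) $ snd p)) = 0"
      using i by (intro prod_zero) (auto intro!: bexI[of _ "(i, k)"])
    then show "product_function N \<sigma> G x = 0" by (simp add: product_function_def)
  qed
qed

lemma kinetic_test_product_function:
  assumes G: "\<And>p. smooth (G p)"
  shows "kinetic_test N (product_function N \<sigma> G) x =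
    - (1 / 2) * (\<Sum>p\<in>{..<N}\<times>UNIV. product_function N \<sigma> (G(p := deriv (deriv (G p)))) x)"
proof -
  have "partial i k (partial i k (product_function N \<sigma> G)) x =
      product_function N \<sigma> (G((i, k) := deriv (deriv (G (i, k))))) x" if i: "i < N" for i k
    unfolding partial_product_function[OF i G]
    by (subst partial_product_function[OF i]) (auto simp: smooth_deriv(2)[OF G])
  then have "(\<Sum>i<N. \<Sum>k\<in>UNIV. partial i k (partial i k (product_function N \<sigma> G)) x) =
      (\<Sum>i<N. \<Sum>k\<in>UNIV. product_function N \<sigma> (G((i, k) := deriv (deriv (G (i, k))))) x)"
    by (intro sum.cong refl) auto
  then show ?thesis
    by (simp add: kinetic_test_def laplacian_def sum.cartesian_product case_prod_beta)
qed

lemma norm_square_components: "(norm v)\<^sup>2 = (\<Sum>k\<in>UNIV. (v $ k)\<^sup>2)" for v :: "real ^ 'n"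
  by (simp add: norm_vec_def L2_set_def sum_nonneg)

lemma gauss3_components:
  assumes t: "0 < t"
  shows "gauss3 t v = (\<Prod>k\<in>UNIV. gauss t (v $ k))"
proof -
  have "(\<Prod>k\<in>UNIV. gauss t (v $ k)) = (\<Prod>k\<in>(UNIV :: 3 set). 1 / sqrt (2 * pi * t)) * exp (\<Sum>k\<in>UNIV. - (v $ k)\<^sup>2 / (2 * t))"
    by (simp only: gauss_eq[OF t] prod.distrib exp_sum finite)
  also have "(\<Sum>k\<in>UNIV. - (v $ k)\<^sup>2 / (2 * t)) = - (norm v)\<^sup>2 / (2 * t)"
    by (simp add: norm_square_components sum_negf sum_divide_distrib)
  finally show ?thesis by (simp add: gauss3_def)
qed

lemma heatN_product:
  assumes t: "0 < t" and x: "x \<in> space (config_measure N)" and y: "y \<in> space (config_measure N)"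
  shows "heatN N t x y = spin_factor N (\<lambda>i. snd (y i)) x *
    (\<Prod>p\<in>{..<N}\<times>UNIV. gauss t (fst (x (fst p)) $ snd p - fst (y (fst p)) $ snd p))"
proof -
  have "heatN N t x y = (\<Prod>i<N. of_bool (snd (x i) = snd (y i)) *
      (\<Prod>k\<in>UNIV. gauss t (fst (x i) $ k - fst (y i) $ k)))"
    using t by (simp add: heatN_def heat1_def gauss3_components mult.commute)
  then show ?thesis
    unfolding spin_factor_eq[OF x y] by (simp add: prod.distrib prod.cartesian_product case_prod_beta)
qed

section \<open>Explicit form and time derivative of the kernel\<close>

definition config_dist2 :: "nat \<Rightarrow> config \<Rightarrow> config \<Rightarrow> real" where
  "config_dist2 N x y = (\<Sum>i<N. (norm (fst (x i) - fst (y i)))\<^sup>2)"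

text \<open>By the heat equation one formula serves for two quantities: the time derivative of
  \<open>heatN\<close>, as in \<open>heatN_DERIV\<close>, and half its Laplacian, as in
  \<open>kinetic_heatN\<close>.\<close>

definition heatN_dt :: "nat \<Rightarrow> real \<Rightarrow> config \<Rightarrow> config \<Rightarrow> real" where
  "heatN_dt N t x y = (config_dist2 N x y / (2 * t\<^sup>2) - 3 * real N / (2 * t)) * heatN N t x y"

lemma measurable_config_dist2 [measurable (raw)]:
  assumes [measurable]: "f \<in> measurable L (config_measure N)" "g \<in> measurable L (config_measure N)"
  shows "(\<lambda>w. config_dist2 N (f w) (g w)) \<in> borel_measurable L"
proof -
  have "(\<lambda>w. (norm (fst (f w i) - fst (g w i)))\<^sup>2) \<in> borel_measurable L" if "i < N" for i
  proof -
    have [measurable]: "(\<lambda>w. f w i) \<in> measurable L particle_measure" "(\<lambda>w. g w i) \<in> measurable L particle_measure"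
      using measurable_compose[OF assms(1) measurable_config_component[OF that]]
        measurable_compose[OF assms(2) measurable_config_component[OF that]] by auto
    show ?thesis by measurable
  qed
  then show ?thesis unfolding config_dist2_def by (intro borel_measurable_sum) auto
qed

lemma measurable_heatN_dt [measurable (raw)]:
  assumes [measurable]: "h \<in> borel_measurable L" "f \<in> measurable L (config_measure N)" "g \<in> measurable L (config_measure N)"
  shows "(\<lambda>w. heatN_dt N (h w) (f w) (g w)) \<in> borel_measurable L"
  unfolding heatN_dt_def by measurable

lemma heatN_explicit:
  assumes "0 < t"
  shows "heatN N t x y = of_bool (\<forall>i<N. snd (x i) = snd (y i)) * ((1 / sqrt (2 * pi * t)) ^ 3) ^ N *
    exp (- config_dist2 N x y / (2 * t))"
proof (cases "\<forall>i<N. snd (x i) = snd (y i)")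
  case True
  have "heatN N t x y = (\<Prod>i<N. (1 / sqrt (2 * pi * t)) ^ 3 * exp (- (norm (fst (x i) - fst (y i)))\<^sup>2 / (2 * t)))"
    using assms True by (simp add: heatN_def heat1_def gauss3_def)
  also have "\<dots> = ((1 / sqrt (2 * pi * t)) ^ 3) ^ N * exp (\<Sum>i<N. - (norm (fst (x i) - fst (y i)))\<^sup>2 / (2 * t))"
    by (simp only: prod.distrib prod_constant card_lessThan exp_sum finite_lessThan)
  finally show ?thesis
    using True by (simp add: config_dist2_def sum_negf sum_divide_distrib)
next
  case False
  then have "heatN N t x y = 0" using assms by (auto simp: heatN_def heat1_def)
  then show ?thesis using False by simp
qed

lemma heatN_le: "0 < t \<Longrightarrow> heatN N t x y \<le> ((1 / sqrt (2 * pi * t)) ^ 3) ^ N"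
  by (auto simp: heatN_explicit config_dist2_def sum_nonneg divide_nonneg_pos intro!: mult_left_le)

lemma heatN_L2:
  assumes x: "x \<in> space (config_measure N)"
  shows "(\<lambda>y. complex_of_real (heatN N t x y)) \<in> L2 (config_measure N)"
proof -
  have [measurable]: "heatN N t x \<in> borel_measurable (config_measure N)" using heatN_integrable[OF x] by auto
  have "integrable (config_measure N) (\<lambda>y. (heatN N t x y)\<^sup>2)"
  proof (cases "0 < t")
    case True
    show ?thesis
    proof (rule Bochner_Integration.integrable_bound)
      show "integrable (config_measure N) (\<lambda>y. ((1 / sqrt (2 * pi * t)) ^ 3) ^ N * heatN N t x y)"
        using heatN_integrable[OF x] by simp
      show "AE y in config_measure N. norm ((heatN N t x y)\<^sup>2) \<le> norm (((1 / sqrt (2 * pi * t)) ^ 3) ^ N * heatN N t x y)"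
      proof (rule AE_I2)
        fix y
        have "heatN N t x y * heatN N t x y \<le> ((1 / sqrt (2 * pi * t)) ^ 3) ^ N * heatN N t x y"
          by (intro mult_right_mono heatN_le[OF True] heatN_nonneg)
        then show "norm ((heatN N t x y)\<^sup>2) \<le> norm (((1 / sqrt (2 * pi * t)) ^ 3) ^ N * heatN N t x y)"
          using True heatN_nonneg[of N t x y] unfolding power2_eq_square real_norm_def
          by (simp only: abs_of_nonneg mult_nonneg_nonneg zero_le_power zero_le_divide_1_iff real_sqrt_ge_zero
              pi_ge_zero less_imp_le zero_le_numeral)
      qed
    qed measurable
  qed (simp add: heatN_def)
  then show ?thesis by (simp add: L2_def heatN_nonneg)
qed

text \<open>The distributional equation extended from test functions to the Gaussian, which lacks
  compact support. The limit requires a majorant that is independent of m and integrable against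
  \<open>u\<close> and \<open>v\<close>; the square-integrable function \<open>W\<close> supplies
  it.\<close>

lemma kinetic_heatN:
  assumes uv: "kinetic N u v" and t: "0 < t" and y: "y \<in> space (config_measure N)"
  shows "(LINT x|config_measure N. u x * complex_of_real (heatN_dt N t x y)) =
    - (LINT x|config_measure N. v x * complex_of_real (heatN N t x y))"
proof (rule gauss_cutoff[OF t])
  fix g :: "real \<Rightarrow> nat \<Rightarrow> real \<Rightarrow> real" and C :: real
  assume gC: "0 \<le> C" "\<And>y m. smooth (g y m)"
    "\<And>y m s. \<bar>s\<bar> > real (Suc m) \<Longrightarrow> g y m s = 0"
    "\<And>y m s. \<bar>g y m s\<bar> \<le> C * gauss (2 * t) (s - y)"
    "\<And>y m s. \<bar>deriv (deriv (g y m)) s\<bar> \<le> C * gauss (2 * t) (s - y)"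
    "\<And>y s. (\<lambda>m. g y m s) \<longlonglongrightarrow> gauss t (s - y)"
    "\<And>y s. (\<lambda>m. deriv (deriv (g y m)) s) \<longlonglongrightarrow> ((s - y)\<^sup>2 / t\<^sup>2 - 1 / t) * gauss t (s - y)"
  let ?M = "config_measure N"
  let ?I = "{..<N} \<times> (UNIV :: 3 set)"
  have u: "u \<in> L2 ?M" and v: "v \<in> L2 ?M" using uv by (auto simp: kinetic_def)
  note [measurable] = L2_measurable[OF u] L2_measurable[OF v]
  define Y where "Y = (\<lambda>p :: nat \<times> 3. fst (y (fst p)) $ snd p)"
  define \<sigma> where "\<sigma> = (\<lambda>i. snd (y i))"
  define G where "G = (\<lambda>m p. g (Y p) m)"
  define \<phi> where "\<phi> = (\<lambda>m. product_function N \<sigma> (G m))"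
  have sG: "smooth (G m p)" for m p unfolding G_def by (rule gC(2))
  have test: "test_function N (\<phi> m)" for m
    unfolding \<phi>_def using gC(3) by (intro test_function_product[where r = "real (Suc m)"] sG) (auto simp: G_def)
  \<comment> \<open>Each of the 3 N factors is bounded by \<open>C\<close> times a Gaussian of
    variance 2 t, also after replacement by its second derivative; \<open>W\<close> collects these
    bounds.\<close>
  define W where "W = (\<lambda>x. C ^ card ?I * heatN N (2 * t) x y)"
  have W0: "0 \<le> W x" for x using gC(1) by (simp add: W_def heatN_nonneg)
  have pb: "cmod (product_function N \<sigma> H x) \<le> W x"
    if x: "x \<in> space ?M" and H: "\<And>p s. \<bar>H p s\<bar> \<le> C * gauss (2 * t) (s - Y p)" for H x
  proof -
    have "0 \<le> spin_factor N \<sigma> x"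
      unfolding \<sigma>_def spin_factor_eq[OF x y] by (simp add: prod_nonneg)
    then have "cmod (product_function N \<sigma> H x) = spin_factor N \<sigma> x * (\<Prod>p\<in>?I. \<bar>H p (fst (x (fst p)) $ snd p)\<bar>)"
      by (simp add: product_function_def abs_mult abs_prod del: of_real_mult)
    also have "\<dots> \<le> spin_factor N \<sigma> x * (\<Prod>p\<in>?I. C * gauss (2 * t) (fst (x (fst p)) $ snd p - Y p))"
      using H \<open>0 \<le> spin_factor N \<sigma> x\<close> by (intro mult_left_mono prod_mono) auto
    also have "\<dots> = W x"
      using t by (simp add: W_def heatN_product[OF _ x y] Y_def \<sigma>_def prod.distrib)
    finally show ?thesis .
  qed
  have Wm: "heatN N (2 * t) x y = heatN N (2 * t) y x" for x by (rule heatN_sym)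
  have WL: "(\<lambda>x. complex_of_real (W x)) \<in> L2 ?M"
    using L2_scale[OF heatN_L2[OF y, of "2 * t"], of "complex_of_real (C ^ card ?I)"] by (simp add: W_def Wm)
  have dom: "integrable ?M (\<lambda>x. cmod (f x) * W x)" if "f \<in> L2 ?M" for f
    using integrable_norm[OF L2_prod_integrable[OF that WL]] W0 by (simp add: norm_mult)
  have \<phi>L: "\<phi> m \<in> L2 ?M" "kinetic_test N (\<phi> m) \<in> L2 ?M" for m
    using kinetic_test_function[OF test] by (auto simp: kinetic_def)
  have [measurable]: "\<phi> m \<in> borel_measurable ?M" "kinetic_test N (\<phi> m) \<in> borel_measurable ?M" for m
    using \<phi>L by (auto dest: L2_measurable)
  have [measurable]: "(\<lambda>x. heatN N t x y) \<in> borel_measurable ?M" "(\<lambda>x. heatN_dt N t x y) \<in> borel_measurable ?M"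
    using y by measurable
  have lim1: "(\<lambda>m. \<phi> m x) \<longlonglongrightarrow> complex_of_real (heatN N t x y)" if x: "x \<in> space ?M" for x
    unfolding heatN_product[OF t x y] \<phi>_def product_function_def G_def \<sigma>_def
    by (intro tendsto_of_real tendsto_mult_left tendsto_prod) (use gC(6) in \<open>auto simp: Y_def\<close>)
  have lim2: "(\<lambda>m. kinetic_test N (\<phi> m) x) \<longlonglongrightarrow> - complex_of_real (heatN_dt N t x y)" if x: "x \<in> space ?M" for x
  proof -
    define a where "a = (\<lambda>p. fst (x (fst p)) $ snd p - Y p)"
    have 1: "(\<lambda>m. product_function N \<sigma> ((G m)(p := deriv (deriv (G m p)))) x)
        \<longlonglongrightarrow> complex_of_real (((a p)\<^sup>2 / t\<^sup>2 - 1 / t) * heatN N t x y)" if p: "p \<in> ?I" for p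
    proof -
      have "(\<lambda>m. \<Prod>q\<in>?I. ((G m)(p := deriv (deriv (G m p)))) q (fst (x (fst q)) $ snd q))
          \<longlonglongrightarrow> (\<Prod>q\<in>?I. (if q = p then ((a p)\<^sup>2 / t\<^sup>2 - 1 / t) else 1) * gauss t (a q))"
      proof (rule tendsto_prod)
        fix q
        show "(\<lambda>m. ((G m)(p := deriv (deriv (G m p)))) q (fst (x (fst q)) $ snd q))
            \<longlonglongrightarrow> (if q = p then ((a p)\<^sup>2 / t\<^sup>2 - 1 / t) else 1) * gauss t (a q)"
          using gC(6)[of "Y q"] gC(7)[of "Y p"] by (simp add: G_def a_def)
      qed
      also have "(\<Prod>q\<in>?I. (if q = p then ((a p)\<^sup>2 / t\<^sup>2 - 1 / t) else 1) * gauss t (a q)) =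
          ((a p)\<^sup>2 / t\<^sup>2 - 1 / t) * (\<Prod>q\<in>?I. gauss t (a q))"
        using p by (simp add: prod.distrib prod.delta)
      finally have "(\<lambda>m. \<Prod>q\<in>?I. ((G m)(p := deriv (deriv (G m p)))) q (fst (x (fst q)) $ snd q))
          \<longlonglongrightarrow> ((a p)\<^sup>2 / t\<^sup>2 - 1 / t) * (\<Prod>q\<in>?I. gauss t (a q))" .
      from tendsto_of_real[OF tendsto_mult_left[OF this, of "spin_factor N \<sigma> x"]] show ?thesis
        unfolding product_function_def heatN_product[OF t x y]
        by (simp add: a_def Y_def \<sigma>_def mult.left_commute del: of_real_mult of_real_prod)
    qed
    \<comment> \<open>Summed over the 3 N coordinates this is twice the factor in
      \<open>heatN_dt\<close>; the 2 cancels against the 1/2 in \<open>kinetic_test\<close>.\<close>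
    have s: "(\<Sum>p\<in>?I. ((a p)\<^sup>2 / t\<^sup>2 - 1 / t)) = 2 * (config_dist2 N x y / (2 * t\<^sup>2) - 3 * real N / (2 * t))"
    proof -
      have "(\<Sum>p\<in>?I. (a p)\<^sup>2) = config_dist2 N x y"
      proof -
        have "(\<Sum>p\<in>?I. (a p)\<^sup>2) = (\<Sum>i<N. \<Sum>k\<in>UNIV. (a (i, k))\<^sup>2)"
          by (simp add: sum.cartesian_product case_prod_beta)
        then show ?thesis by (simp add: config_dist2_def a_def Y_def norm_square_components)
      qed
      then show ?thesis
        by (simp add: sum_subtractf sum_divide_distrib[symmetric] card_cartesian_product)
    qed
    have "(\<lambda>m. kinetic_test N (\<phi> m) x) \<longlonglongrightarrow> - (1 / 2) * (\<Sum>p\<in>?I. complex_of_real (((a p)\<^sup>2 / t\<^sup>2 - 1 / t) * heatN N t x y))"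
      unfolding \<phi>_def kinetic_test_product_function[OF sG] by (intro tendsto_mult_left tendsto_sum 1)
    also have "(\<Sum>p\<in>?I. complex_of_real (((a p)\<^sup>2 / t\<^sup>2 - 1 / t) * heatN N t x y)) = complex_of_real (2 * heatN_dt N t x y)"
      unfolding of_real_sum[symmetric] sum_distrib_right[symmetric] s heatN_dt_def by (simp only: mult.assoc)
    finally show ?thesis by simp
  qed
  have b1: "cmod (\<phi> m x) \<le> W x" if "x \<in> space ?M" for m x
    unfolding \<phi>_def using gC(4) by (intro pb[OF that]) (simp add: G_def)
  have b2: "cmod (kinetic_test N (\<phi> m) x) \<le> real (card ?I) * W x" if x: "x \<in> space ?M" for m x
  proof -
    have "cmod (kinetic_test N (\<phi> m) x) \<le> 1 * (\<Sum>p\<in>?I. W x)"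
      unfolding \<phi>_def kinetic_test_product_function[OF sG] norm_mult
      using gC(4,5) W0[of x] by (intro mult_mono sum_norm_le pb[OF x]) (auto simp: G_def intro!: sum_nonneg)
    then show ?thesis by simp
  qed
  have "(\<lambda>m. LINT x|?M. u x * kinetic_test N (\<phi> m) x) \<longlonglongrightarrow> (LINT x|?M. u x * - complex_of_real (heatN_dt N t x y))"
  proof (rule integral_dominated_convergence[where w = "\<lambda>x. real (card ?I) * (cmod (u x) * W x)"])
    show "integrable ?M (\<lambda>x. real (card ?I) * (cmod (u x) * W x))" by (intro integrable_mult_right dom u)
    show "AE x in ?M. norm (u x * kinetic_test N (\<phi> m) x) \<le> real (card ?I) * (cmod (u x) * W x)" for m
      using mult_left_mono[OF b2 norm_ge_zero] by (intro AE_I2) (simp add: norm_mult mult.left_commute)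
    show "AE x in ?M. (\<lambda>m. u x * kinetic_test N (\<phi> m) x) \<longlonglongrightarrow> u x * - complex_of_real (heatN_dt N t x y)"
      by (intro AE_I2 tendsto_mult_left lim2)
  qed measurable
  moreover have "(\<lambda>m. LINT x|?M. v x * \<phi> m x) \<longlonglongrightarrow> (LINT x|?M. v x * complex_of_real (heatN N t x y))"
  proof (rule integral_dominated_convergence[where w = "\<lambda>x. cmod (v x) * W x"])
    show "integrable ?M (\<lambda>x. cmod (v x) * W x)" by (rule dom[OF v])
    show "AE x in ?M. norm (v x * \<phi> m x) \<le> cmod (v x) * W x" for m
      using b1 by (intro AE_I2) (simp add: norm_mult mult_left_mono)
    show "AE x in ?M. (\<lambda>m. v x * \<phi> m x) \<longlonglongrightarrow> v x * complex_of_real (heatN N t x y)"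
      by (intro AE_I2 tendsto_mult_left lim1)
  qed measurable
  moreover have "(LINT x|?M. u x * kinetic_test N (\<phi> m) x) = (LINT x|?M. v x * \<phi> m x)" for m
    using uv test by (simp add: kinetic_def)
  ultimately have "(LINT x|?M. u x * - complex_of_real (heatN_dt N t x y)) = (LINT x|?M. v x * complex_of_real (heatN N t x y))"
    by (simp add: LIMSEQ_unique)
  then have "(LINT x|?M. v x * complex_of_real (heatN N t x y)) = - (LINT x|?M. u x * complex_of_real (heatN_dt N t x y))"
    by simp
  then show ?thesis by (simp only: minus_minus)
qed

section \<open>The heat flow\<close>

lemma inverse_sqrt_power_DERIV:
  assumes t: "0 < t"
  shows "((\<lambda>t. (1 / sqrt (2 * pi * t)) ^ n) has_real_derivative
    - (real n / (2 * t)) * (1 / sqrt (2 * pi * t)) ^ n) (at t)"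
proof (induction n)
  case (Suc n)
  have "((\<lambda>t. 1 / sqrt (2 * pi * t)) has_real_derivative - (1 / (2 * t)) * (1 / sqrt (2 * pi * t))) (at t)"
  proof -
    have "\<not> pi * t < 0" using mult_pos_pos[OF pi_gt_zero t] by linarith
    then show ?thesis using t by (auto intro!: derivative_eq_intros simp: field_simps)
  qed
  note d = DERIV_mult[OF this Suc]
  have "- (1 / (2 * t)) * R * P + - (real n / (2 * t)) * P * R = - (real (Suc n) / (2 * t)) * (R * P)" for R P
    using t by (simp add: field_simps)
  from DERIV_cong[OF d this] show ?case by (simp only: power_Suc)
qed simp

lemma heatN_DERIV:
  assumes t: "0 < t"
  shows "((\<lambda>t. heatN N t x y) has_real_derivative heatN_dt N t x y) (at t)"
proof -
  define S where "S = (of_bool (\<forall>i<N. snd (x i) = snd (y i)) :: real)"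
  define d where "d = config_dist2 N x y"
  define r where "r = (\<lambda>t. (1 / sqrt (2 * pi * t)) ^ (3 * N))"
  have e: "((\<lambda>t. exp (- d / (2 * t))) has_real_derivative d / (2 * t\<^sup>2) * exp (- d / (2 * t))) (at t)"
    using t by (auto intro!: derivative_eq_intros simp: power2_eq_square field_simps)
  have rd: "(r has_real_derivative - (real (3 * N) / (2 * t)) * r t) (at t)"
    unfolding r_def by (rule inverse_sqrt_power_DERIV[OF t])
  have rk: "((1 / sqrt (2 * pi * s)) ^ 3) ^ N = r s" for s by (simp only: r_def power_mult)
  have "((\<lambda>t. S * (r t * exp (- d / (2 * t)))) has_real_derivative heatN_dt N t x y) (at t)"
    by (rule DERIV_cong[OF DERIV_cmult[OF DERIV_mult[OF rd e]]])
       (simp only: heatN_dt_def heatN_explicit[OF t] S_def[symmetric] d_def[symmetric] rk, simp add: algebra_simps)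
  then show ?thesis
  proof (rule has_field_derivative_transform_within_open[of _ _ _ "{0<..}"])
    show "S * (r s * exp (- d / (2 * s))) = heatN N s x y" if "s \<in> {0<..}" for s
      using that by (simp only: heatN_explicit greaterThan_iff S_def d_def rk mult.assoc[of "of_bool _"])
  qed (use t in auto)
qed

lemma config_dist2_nonneg: "0 \<le> config_dist2 N x y"
  by (simp add: config_dist2_def sum_nonneg)

text \<open>A majorant for all t in [a, b] at once, for use with Fubini's theorem. There d / (2 t)
  is at least 2 q with q = d / (4 b). One factor exp (- q) belongs to the kernel at time 2 b, the
  other absorbs the d in the time derivative, and the lower end \<open>a\<close> controls the
  negative powers of t.\<close>

lemma heatN_dt_bound:
  assumes a: "0 < a"
  obtains C where "\<And>t x y. a \<le> t \<Longrightarrow> t \<le> b \<Longrightarrow>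
    heatN N t x y \<le> C * heatN N (2 * b) x y \<and> \<bar>heatN_dt N t x y\<bar> \<le> C * heatN N (2 * b) x y"
proof -
  define k where "k = (\<lambda>t. ((1 / sqrt (2 * pi * t)) ^ 3) ^ N)"
  define C0 where "C0 = k a / k (2 * b)"
  define C where "C = C0 * (2 * b / a\<^sup>2 + 3 * real N / (2 * a) + 1)"
  show thesis
  proof (rule that[of C])
    fix t :: real and x y :: config assume t: "a \<le> t" "t \<le> b"
    define S where "S = (of_bool (\<forall>i<N. snd (x i) = snd (y i)) :: real)"
    define d where "d = config_dist2 N x y"
    have d0: "0 \<le> d" by (simp add: d_def config_dist2_nonneg)
    have tp: "0 < t" "0 < b" using t a by auto
    have kp: "0 < k s" if "0 < s" for s using that by (simp add: k_def)
    define q where "q = d / (4 * b)"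
    have q0: "0 \<le> q" using d0 tp by (simp add: q_def)
    have ht: "heatN N t x y \<le> S * (C0 * k (2 * b) * (exp (- q) * exp (- q)))"
    proof -
      have "k t \<le> k a"
        unfolding k_def using a t by (intro power_mono frac_le) auto
      moreover have "exp (- d / (2 * t)) \<le> exp (- q) * exp (- q)"
      proof -
        have "d / (2 * b) \<le> d / (2 * t)" using t tp d0 by (intro divide_left_mono) auto
        then show ?thesis using tp by (simp add: q_def exp_add[symmetric])
      qed
      ultimately have "k t * exp (- d / (2 * t)) \<le> k a * (exp (- q) * exp (- q))"
        using kp[OF tp(1)] kp[OF a] by (intro mult_mono) auto
      then show ?thesis
        using tp kp[of "2 * b"] by (simp add: heatN_explicit S_def d_def k_def C0_def)
    qed
    have h2: "heatN N (2 * b) x y = S * (k (2 * b) * exp (- q))"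
      using tp by (simp add: heatN_explicit S_def d_def k_def q_def)
    have C00: "0 \<le> C0" using kp[OF a] kp[of "2 * b"] tp by (simp add: C0_def)
    have S0: "0 \<le> S" by (simp add: S_def)
    have ht2: "heatN N t x y \<le> C0 * heatN N (2 * b) x y * exp (- q)"
      unfolding h2 using ht by (simp only: mult_ac)
    have h20: "0 \<le> C0 * heatN N (2 * b) x y" using C00 by (simp add: heatN_nonneg)
    have ht3: "heatN N t x y \<le> C0 * heatN N (2 * b) x y"
      using ht2 mult_left_mono[OF _ h20, of "exp (- q)" 1] q0 by simp
    have n0: "0 \<le> 2 * b / a\<^sup>2" "0 \<le> 3 * real N / (2 * a)" using a tp by auto
    have dt: "d / (2 * t\<^sup>2) * heatN N t x y \<le> 2 * b / a\<^sup>2 * (C0 * heatN N (2 * b) x y)"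
    proof -
      have "d / (2 * t\<^sup>2) \<le> d / (2 * a\<^sup>2)"
        using a t d0 by (intro divide_left_mono mult_left_mono power_mono) auto
      also have "\<dots> = 2 * b / a\<^sup>2 * q" using tp by (simp add: q_def)
      finally have "d / (2 * t\<^sup>2) * heatN N t x y \<le> 2 * b / a\<^sup>2 * q * (C0 * heatN N (2 * b) x y * exp (- q))"
        using ht2 heatN_nonneg mult_nonneg_nonneg[OF n0(1) q0] by (intro mult_mono) auto
      also have "\<dots> = 2 * b / a\<^sup>2 * (C0 * heatN N (2 * b) x y) * (q * exp (- q))" by (simp add: mult_ac)
      also have "\<dots> \<le> 2 * b / a\<^sup>2 * (C0 * heatN N (2 * b) x y) * 1"
        using mult_nonneg_nonneg[OF n0(1) h20] by (intro mult_left_mono x_exp_bound q0) auto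
      finally show ?thesis by simp
    qed
    have nt: "3 * real N / (2 * t) * heatN N t x y \<le> 3 * real N / (2 * a) * (C0 * heatN N (2 * b) x y)"
      using ht3 heatN_nonneg n0 a t by (intro mult_mono frac_le) auto
    have "\<bar>heatN_dt N t x y\<bar> \<le> d / (2 * t\<^sup>2) * heatN N t x y + 3 * real N / (2 * t) * heatN N t x y"
    proof -
      have "0 \<le> d / (2 * t\<^sup>2) * heatN N t x y" "0 \<le> 3 * real N / (2 * t) * heatN N t x y"
        using d0 tp heatN_nonneg by (auto intro!: mult_nonneg_nonneg)
      then show ?thesis unfolding heatN_dt_def d_def[symmetric] left_diff_distrib by linarith
    qed
    then have 1: "\<bar>heatN_dt N t x y\<bar> \<le> (2 * b / a\<^sup>2 + 3 * real N / (2 * a)) * (C0 * heatN N (2 * b) x y)"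
      using dt nt by (simp add: distrib_right)
    have Ce: "C * heatN N (2 * b) x y = (2 * b / a\<^sup>2 + 3 * real N / (2 * a)) * (C0 * heatN N (2 * b) x y) + C0 * heatN N (2 * b) x y"
      by (simp add: C_def algebra_simps)
    have "0 \<le> (2 * b / a\<^sup>2 + 3 * real N / (2 * a)) * (C0 * heatN N (2 * b) x y)"
      by (intro mult_nonneg_nonneg[OF add_nonneg_nonneg[OF n0] h20])
    then show "heatN N t x y \<le> C * heatN N (2 * b) x y \<and> \<bar>heatN_dt N t x y\<bar> \<le> C * heatN N (2 * b) x y"
      using 1 ht3 h20 unfolding Ce by linarith
  qed
qed

lemma heat_op_eq: "heatN.heat_op N t u y = (LINT x|config_measure N. u x * complex_of_real (heatN N t x y))"
  unfolding heatN.heat_op_def integral_op_def by (simp add: mult.commute heatN_sym[of N t y])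

text \<open>Integrated form of \<open>d/dt (exp (\<mu> t) P\<^sub>t u) = - exp (\<mu> t) P\<^sub>t (v - \<mu> u)\<close> for \<open>T u = v\<close>.\<close>

lemma heat_flow_pointwise:
  assumes uv: "kinetic N u v" and a: "0 < a" "a \<le> b" and y: "y \<in> space (config_measure N)"
  shows "complex_of_real (exp (\<mu> * a)) * heatN.heat_op N a u y - complex_of_real (exp (\<mu> * b)) * heatN.heat_op N b u y =
    (LINT t|lborel. complex_of_real (indicator {a..b} t * exp (\<mu> * t)) *
      heatN.heat_op N t (\<lambda>x. v x - complex_of_real \<mu> * u x) y)"
proof (rule heatN_dt_bound[OF a(1), of b N])
  fix C assume C: "\<And>t x y. a \<le> t \<Longrightarrow> t \<le> b \<Longrightarrow>
    heatN N t x y \<le> C * heatN N (2 * b) x y \<and> \<bar>heatN_dt N t x y\<bar> \<le> C * heatN N (2 * b) x y"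
  let ?M = "config_measure N"
  interpret T: pair_sigma_finite lborel ?M
    by (intro pair_sigma_finite.intro sigma_finite_lborel sigma_finite_config)
  have u: "u \<in> L2 ?M" and v: "v \<in> L2 ?M" using uv by (auto simp: kinetic_def)
  note [measurable] = L2_measurable[OF u] L2_measurable[OF v]
  have hL: "(\<lambda>x. complex_of_real (heatN N t x y)) \<in> L2 ?M" for t
    using heatN_L2[OF y, of t] by (simp add: heatN_sym[of N t _ y])
  have hi: "integrable ?M (\<lambda>x. f x * complex_of_real (heatN N t x y))" if "f \<in> L2 ?M" for f t
    by (rule L2_prod_integrable[OF that hL])
  define D where "D = (\<lambda>t x. exp (\<mu> * t) * (\<mu> * heatN N t x y + heatN_dt N t x y))"
  have Dd: "((\<lambda>t. exp (\<mu> * t) * heatN N t x y) has_real_derivative D t x) (at t)" if "0 < t" for t x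
    unfolding D_def by (auto intro!: derivative_eq_intros heatN_DERIV[OF that] simp: algebra_simps)
  have Dc: "isCont (\<lambda>t. D t x) t" if "0 < t" for t x
  proof -
    have 1: "isCont (\<lambda>t. heatN N t x y) t" using DERIV_isCont[OF heatN_DERIV[OF that]] .
    show ?thesis unfolding D_def heatN_dt_def using that by (intro continuous_intros 1) auto
  qed
  have ftc: "has_bochner_integral lborel (\<lambda>t. D t x * indicator {a..b} t) (exp (\<mu> * b) * heatN N b x y - exp (\<mu> * a) * heatN N a x y)" for x
    using a by (intro has_bochner_integral_FTC_Icc_real Dd Dc) auto
  define E where "E = exp (\<bar>\<mu>\<bar> * b) * ((\<bar>\<mu>\<bar> + 1) * C)"
  have Db: "\<bar>D t x\<bar> \<le> E * heatN N (2 * b) x y" if "a \<le> t" "t \<le> b" for t x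
  proof -
    have "\<bar>D t x\<bar> \<le> exp (\<mu> * t) * (\<bar>\<mu>\<bar> * heatN N t x y + \<bar>heatN_dt N t x y\<bar>)"
      unfolding D_def abs_mult using heatN_nonneg[of N t x y] abs_triangle_ineq[of "\<mu> * heatN N t x y" "heatN_dt N t x y"]
      by (simp add: abs_mult)
    also have "\<dots> \<le> exp (\<bar>\<mu>\<bar> * b) * (\<bar>\<mu>\<bar> * (C * heatN N (2 * b) x y) + C * heatN N (2 * b) x y)"
    proof (intro mult_mono add_mono mult_left_mono)
      have "\<mu> * t \<le> \<bar>\<mu>\<bar> * t" using that a by (intro mult_right_mono) auto
      also have "\<dots> \<le> \<bar>\<mu>\<bar> * b" using that by (intro mult_left_mono) auto
      finally show "exp (\<mu> * t) \<le> exp (\<bar>\<mu>\<bar> * b)" by simp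
    qed (use C[OF that] heatN_nonneg in auto)
    also have "\<dots> = E * heatN N (2 * b) x y" by (simp add: E_def algebra_simps)
    finally show ?thesis .
  qed
  define F where "F = (\<lambda>t x. complex_of_real (D t x * indicator {a..b} t) * u x)"
  have int: "integrable (lborel \<Otimes>\<^sub>M ?M) (\<lambda>(t, x). F t x)"
  proof (rule Bochner_Integration.integrable_bound)
    show "integrable (lborel \<Otimes>\<^sub>M ?M) (\<lambda>(t, x). complex_of_real (indicator {a..b} t) * (u x * complex_of_real (heatN N (2 * b) x y) * complex_of_real E))"
      using a by (intro T.integrable_times integrable_mult_left hi u) (auto intro!: integrable_real_indicator)
    show "(\<lambda>(t, x). F t x) \<in> borel_measurable (lborel \<Otimes>\<^sub>M ?M)"
      unfolding F_def D_def using y by measurable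
    have "cmod (F t x) \<le> cmod (complex_of_real (indicator {a..b} t) * (u x * complex_of_real (heatN N (2 * b) x y) * complex_of_real E))" for t x
    proof (cases "t \<in> {a..b}")
      case True
      then have "\<bar>D t x\<bar> \<le> \<bar>E * heatN N (2 * b) x y\<bar>" using Db[of t x] by (simp add: abs_le_iff)
      then show ?thesis
        using True mult_left_mono[of "\<bar>D t x\<bar>" "\<bar>E * heatN N (2 * b) x y\<bar>" "cmod (u x)"]
        by (simp add: F_def norm_mult abs_mult mult_ac)
    qed (simp add: F_def)
    then show "AE p in lborel \<Otimes>\<^sub>M ?M. norm (case p of (t, x) \<Rightarrow> F t x) \<le>
        norm (case p of (t, x) \<Rightarrow> complex_of_real (indicator {a..b} t) * (u x * complex_of_real (heatN N (2 * b) x y) * complex_of_real E))"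
      by (intro AE_I2) auto
  qed
  have "complex_of_real (exp (\<mu> * b)) * heatN.heat_op N b u y - complex_of_real (exp (\<mu> * a)) * heatN.heat_op N a u y =
      (LINT x|?M. complex_of_real (exp (\<mu> * b)) * (u x * complex_of_real (heatN N b x y)) - complex_of_real (exp (\<mu> * a)) * (u x * complex_of_real (heatN N a x y)))"
    using hi[OF u] by (simp add: heat_op_eq)
  \<comment> \<open>The fundamental theorem of calculus in t, for each x. After Fubini's theorem,
    \<open>kinetic_heatN\<close> replaces \<open>u\<close> paired with the time derivative of the
    kernel by - v paired with the kernel.\<close>
  also have "\<dots> = (LINT x|?M. LINT t|lborel. F t x)"
  proof (intro Bochner_Integration.integral_cong refl)
    fix x
    have "(LINT t|lborel. F t x) = complex_of_real (exp (\<mu> * b) * heatN N b x y - exp (\<mu> * a) * heatN N a x y) * u x"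
      unfolding F_def integral_mult_left_zero integral_complex_of_real
      using ftc[of x] by (simp add: has_bochner_integral_iff)
    then show "complex_of_real (exp (\<mu> * b)) * (u x * complex_of_real (heatN N b x y)) - complex_of_real (exp (\<mu> * a)) * (u x * complex_of_real (heatN N a x y))
        = (LINT t|lborel. F t x)" by (simp add: algebra_simps)
  qed
  also have "\<dots> = (LINT t|lborel. LINT x|?M. F t x)"
    by (rule T.Fubini_integral[OF int])
  also have "\<dots> = (LINT t|lborel. - (complex_of_real (indicator {a..b} t * exp (\<mu> * t)) *
      heatN.heat_op N t (\<lambda>x. v x - complex_of_real \<mu> * u x) y))"
  proof (intro Bochner_Integration.integral_cong refl)
    fix t
    show "(LINT x|?M. F t x) = - (complex_of_real (indicator {a..b} t * exp (\<mu> * t)) *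
      heatN.heat_op N t (\<lambda>x. v x - complex_of_real \<mu> * u x) y)"
    proof (cases "t \<in> {a..b}")
      case True
      then have t: "0 < t" using a by auto
      have dti: "integrable ?M (\<lambda>x. u x * complex_of_real (heatN_dt N t x y))"
      proof (rule Bochner_Integration.integrable_bound)
        show "integrable ?M (\<lambda>x. u x * complex_of_real (heatN N (2 * b) x y) * complex_of_real C)"
          by (intro integrable_mult_left hi u)
        show "(\<lambda>x. u x * complex_of_real (heatN_dt N t x y)) \<in> borel_measurable ?M" using y by measurable
        have "\<bar>heatN_dt N t x y\<bar> \<le> \<bar>C * heatN N (2 * b) x y\<bar>" for x
          using C[of t x y] True by (auto intro: order.trans[OF _ abs_ge_self])
        then show "AE x in ?M. norm (u x * complex_of_real (heatN_dt N t x y)) \<le> norm (u x * complex_of_real (heatN N (2 * b) x y) * complex_of_real C)"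
          by (intro AE_I2) (simp add: norm_mult abs_mult mult.assoc mult.commute[of _ "\<bar>C\<bar>"] mult_left_mono)
      qed
      have "(LINT x|?M. F t x) = (LINT x|?M. complex_of_real (exp (\<mu> * t)) *
          (complex_of_real \<mu> * (u x * complex_of_real (heatN N t x y)) + u x * complex_of_real (heatN_dt N t x y)))"
        using True by (intro Bochner_Integration.integral_cong refl) (simp add: F_def D_def algebra_simps)
      also have "\<dots> = complex_of_real (exp (\<mu> * t)) * (complex_of_real \<mu> * (LINT x|?M. u x * complex_of_real (heatN N t x y)) +
          (LINT x|?M. u x * complex_of_real (heatN_dt N t x y)))"
        using hi[OF u, of t] dti by simp
      also have "\<dots> = - (complex_of_real (exp (\<mu> * t)) * ((LINT x|?M. v x * complex_of_real (heatN N t x y)) -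
          complex_of_real \<mu> * (LINT x|?M. u x * complex_of_real (heatN N t x y))))"
        unfolding kinetic_heatN[OF uv t y] by (simp add: algebra_simps)
      also have "(LINT x|?M. v x * complex_of_real (heatN N t x y)) - complex_of_real \<mu> * (LINT x|?M. u x * complex_of_real (heatN N t x y))
          = heatN.heat_op N t (\<lambda>x. v x - complex_of_real \<mu> * u x) y"
        using hi[OF u, of t] hi[OF v, of t] by (simp add: heat_op_eq left_diff_distrib mult.assoc)
      finally show ?thesis using True by simp
    qed (simp add: F_def)
  qed
  finally have "complex_of_real (exp (\<mu> * b)) * heatN.heat_op N b u y - complex_of_real (exp (\<mu> * a)) * heatN.heat_op N a u y =
      - (LINT t|lborel. complex_of_real (indicator {a..b} t * exp (\<mu> * t)) * heatN.heat_op N t (\<lambda>x. v x - complex_of_real \<mu> * u x) y)"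
    by simp
  then show ?thesis by (simp add: algebra_simps)
qed

text \<open>The weak form of \<open>heat_flow_pointwise\<close>, by Fubini's theorem in t and y.
  Pairing with \<open>h\<close> is what makes the limit a \<rightarrow> 0 accessible in
  \<open>green_left_inverse\<close>.\<close>

lemma heat_flow_pairing:
  fixes \<mu> :: real
  assumes uv: "kinetic N u v" and a: "0 < a" "a \<le> b" and h: "h \<in> L2 (config_measure N)"
  defines "g \<equiv> \<lambda>x. v x - complex_of_real \<mu> * u x"
  shows "complex_of_real (exp (\<mu> * a)) * (LINT y|config_measure N. heatN.heat_op N a u y * h y) -
      complex_of_real (exp (\<mu> * b)) * (LINT y|config_measure N. heatN.heat_op N b u y * h y) =
    (LINT t|lborel. complex_of_real (indicator {a..b} t * exp (\<mu> * t)) *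
      (LINT y|config_measure N. heatN.heat_op N t g y * h y))"
proof -
  let ?M = "config_measure N"
  interpret T: pair_sigma_finite lborel ?M
    by (intro pair_sigma_finite.intro sigma_finite_lborel sigma_finite_config)
  have u: "u \<in> L2 ?M" and v: "v \<in> L2 ?M" using uv by (auto simp: kinetic_def)
  have g: "g \<in> L2 ?M" unfolding g_def by (intro L2_diff L2_scale u v)
  note [measurable] = L2_measurable[OF u] L2_measurable[OF v] L2_measurable[OF g] L2_measurable[OF h]
  have P: "integrable ?M (\<lambda>y. heatN.heat_op N t f y * h y)" if "f \<in> L2 ?M" for f t
    by (intro L2_prod_integrable heatN.heat_op_L2 that h)
  define F where "F = (\<lambda>t y. complex_of_real (indicator {a..b} t * exp (\<mu> * t)) * heatN.heat_op N t g y * h y)"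
  define E where "E = exp (\<bar>\<mu>\<bar> * b) * (l2norm ?M g * l2norm ?M h)"
  have int: "integrable (lborel \<Otimes>\<^sub>M ?M) (\<lambda>(t, y). F t y)"
  proof (rule T.Fubini_integrable)
    show m: "(\<lambda>(t, y). F t y) \<in> borel_measurable (lborel \<Otimes>\<^sub>M ?M)"
      unfolding F_def heatN.heat_op_def integral_op_def by measurable
    show "integrable lborel (\<lambda>t. LINT y|?M. norm (case (t, y) of (t, y) \<Rightarrow> F t y))"
    proof (rule Bochner_Integration.integrable_bound)
      show "integrable lborel (\<lambda>t. indicator {a..b} t * E)"
        by (intro integrable_mult_left integrable_real_indicator) (auto simp: emeasure_lborel_Icc_eq)
      show "(\<lambda>t. LINT y|?M. norm (case (t, y) of (t, y) \<Rightarrow> F t y)) \<in> borel_measurable lborel"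
        using m by measurable
      have "(LINT y|?M. norm (F t y)) \<le> indicator {a..b} t * E" for t
      proof (cases "t \<in> {a..b}")
        case True
        have "(LINT y|?M. norm (F t y)) = exp (\<mu> * t) * (LINT y|?M. cmod (heatN.heat_op N t g y) * cmod (h y))"
          using True by (simp add: F_def norm_mult mult.assoc)
        also have "\<dots> \<le> exp (\<bar>\<mu>\<bar> * b) * (l2norm ?M g * l2norm ?M h)"
        proof (intro mult_mono)
          have "\<mu> * t \<le> \<bar>\<mu>\<bar> * t" using True a by (intro mult_right_mono) auto
          also have "\<dots> \<le> \<bar>\<mu>\<bar> * b" using True by (intro mult_left_mono) auto
          finally show "exp (\<mu> * t) \<le> exp (\<bar>\<mu>\<bar> * b)" by simp
          show "(LINT y|?M. cmod (heatN.heat_op N t g y) * cmod (h y)) \<le> l2norm ?M g * l2norm ?M h"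
            by (rule order.trans[OF L2_Cauchy_Schwarz_norm[OF heatN.heat_op_L2[OF g] h]
                mult_right_mono[OF heatN.heat_op_norm[OF g] l2norm_nonneg]])
        qed auto
        finally show ?thesis using True by (simp add: E_def)
      qed (simp add: F_def)
      then show "AE t in lborel. norm (LINT y|?M. norm (case (t, y) of (t, y) \<Rightarrow> F t y)) \<le> norm (indicator {a..b} t * E)"
        by (intro AE_I2) (simp add: order.trans[OF _ abs_ge_self])
    qed
    show "AE t in lborel. integrable ?M (\<lambda>y. case (t, y) of (t, y) \<Rightarrow> F t y)"
      using P[OF g] by (simp add: F_def mult.assoc)
  qed
  have "complex_of_real (exp (\<mu> * a)) * (LINT y|?M. heatN.heat_op N a u y * h y) -
      complex_of_real (exp (\<mu> * b)) * (LINT y|?M. heatN.heat_op N b u y * h y) =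
      (LINT y|?M. (complex_of_real (exp (\<mu> * a)) * heatN.heat_op N a u y - complex_of_real (exp (\<mu> * b)) * heatN.heat_op N b u y) * h y)"
    using P[OF u] by (simp add: left_diff_distrib mult.assoc)
  also have "\<dots> = (LINT y|?M. LINT t|lborel. F t y)"
  proof (intro Bochner_Integration.integral_cong refl)
    fix y assume y: "y \<in> space ?M"
    show "(complex_of_real (exp (\<mu> * a)) * heatN.heat_op N a u y - complex_of_real (exp (\<mu> * b)) * heatN.heat_op N b u y) * h y
        = (LINT t|lborel. F t y)"
      unfolding heat_flow_pointwise[OF uv a y] F_def g_def integral_mult_left_zero ..
  qed
  also have "\<dots> = (LINT t|lborel. LINT y|?M. F t y)"
    by (rule T.Fubini_integral[OF int])
  also have "\<dots> = (LINT t|lborel. complex_of_real (indicator {a..b} t * exp (\<mu> * t)) * (LINT y|?M. heatN.heat_op N t g y * h y))"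
    by (simp only: F_def mult.assoc integral_mult_right_zero)
  finally show ?thesis .
qed

section \<open>Approximation of the identity\<close>

text \<open>Among configurations with the spins of \<open>y\<close>, the product topology is as fine
  as the Euclidean distance requires: a basic neighbourhood contains a ball in each coordinate, the
  coordinates beyond N coincide, and the least of the N radii serves.\<close>

lemma open_config_neighbourhood:
  fixes U :: "config set"
  assumes U: "open U" and y: "y \<in> U" "y \<in> space (config_measure N)"
  obtains \<delta> where "0 < \<delta>"
    "\<And>x. x \<in> space (config_measure N) \<Longrightarrow> (\<forall>i<N. snd (x i) = snd (y i)) \<Longrightarrow> config_dist2 N x y < \<delta>\<^sup>2 \<Longrightarrow> x \<in> U"
proof -
  have "openin (product_topology (\<lambda>i. euclidean) UNIV) U"
    using U by (simp add: euclidean_product_topology)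
  then obtain X where X: "y \<in> PiE UNIV X" "\<forall>i. open (X i)" "PiE UNIV X \<subseteq> U"
    using product_topology_open_contains_basis[of "\<lambda>i. euclidean" UNIV U y] y by auto
  have "\<forall>i. \<exists>e>0. ball (y i) e \<subseteq> X i" using X by (auto simp: PiE_iff open_contains_ball)
  then obtain e where e: "\<And>i. 0 < e i" "\<And>i. ball (y i) (e i) \<subseteq> X i" by metis
  \<comment> \<open>The inserted 1 keeps the set nonempty for N = 0.\<close>
  define \<delta> where "\<delta> = Min (insert 1 (e ` {..<N}))"
  have \<delta>: "0 < \<delta>" "\<And>i. i < N \<Longrightarrow> \<delta> \<le> e i" using e by (auto simp: \<delta>_def)
  show thesis
  proof (rule that[OF \<delta>(1)])
    fix x assume x: "x \<in> space (config_measure N)" "\<forall>i<N. snd (x i) = snd (y i)" "config_dist2 N x y < \<delta>\<^sup>2"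
    have "x i \<in> X i" for i
    proof (cases "i < N")
      case True
      have "(norm (fst (x i) - fst (y i)))\<^sup>2 \<le> config_dist2 N x y"
        unfolding config_dist2_def using True by (intro member_le_sum) auto
      then have "(norm (fst (x i) - fst (y i)))\<^sup>2 < \<delta>\<^sup>2" using x(3) by linarith
      then have "norm (fst (x i) - fst (y i)) < \<delta>" using \<delta>(1) by (simp add: power_less_imp_less_base)
      then have "dist (y i) (x i) < e i"
        using x(2) True \<delta>(2)[OF True] by (simp add: dist_prod_def dist_norm norm_minus_commute)
      then show ?thesis using e(2)[of i] by auto
    next
      case False
      then have "x i = y i" using x(1) y(2) by (auto simp: space_config PiE_iff extensional_def)
      then show ?thesis using X(1) by auto
    qed
    then show "x \<in> U" using X(3) by auto
  qed
qed

text \<open>Half of the exponent gives the decay in \<delta>, the other half is the exponent at time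
  2 t. Comparing the normalisations costs sqrt 2 for each of the 3 N coordinates.\<close>

lemma heatN_tail:
  assumes t: "0 < t" and d: "\<delta>\<^sup>2 \<le> config_dist2 N x y"
  shows "heatN N t x y \<le> (sqrt 2 ^ 3) ^ N * exp (- \<delta>\<^sup>2 / (4 * t)) * heatN N (2 * t) x y"
proof -
  have r: "1 / sqrt (2 * pi * t) = sqrt 2 * (1 / sqrt (2 * pi * (2 * t)))"
    using t by (simp add: real_sqrt_mult field_simps)
  have "exp (- config_dist2 N x y / (2 * t)) \<le> exp (- \<delta>\<^sup>2 / (4 * t)) * exp (- config_dist2 N x y / (2 * (2 * t)))"
    using t d by (simp add: exp_add[symmetric] field_simps)
  then show ?thesis
    using t unfolding heatN_explicit[OF t] r power_mult_distrib
    by (subst heatN_explicit) (auto simp: mult_ac)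
qed

text \<open>The kernel has mass one, and outside \<open>U\<close> it is at most a vanishing multiple
  of the kernel at time 2 t, which has mass one again.\<close>

lemma heat_op_open_tendsto:
  fixes U :: "config set"
  assumes U: "open U" and y: "y \<in> U" "y \<in> space (config_measure N)"
  shows "(\<lambda>n. LINT x|config_measure N. heatN N (1 / real (Suc n)) y x * indicator U x) \<longlonglongrightarrow> 1"
proof -
  let ?M = "config_measure N"
  obtain \<delta> where \<delta>: "0 < \<delta>"
    "\<And>x. x \<in> space ?M \<Longrightarrow> (\<forall>i<N. snd (x i) = snd (y i)) \<Longrightarrow> config_dist2 N x y < \<delta>\<^sup>2 \<Longrightarrow> x \<in> U"
    using open_config_neighbourhood[OF U y] by blast
  have Um [measurable]: "(\<lambda>x. indicator U x :: real) \<in> borel_measurable ?M"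
    using measurable_compose[OF measurable_config_id, of "indicator U" borel N] U by simp
  have i: "integrable ?M (\<lambda>x. heatN N t y x * indicator U x)" for t
    by (rule Bochner_Integration.integrable_bound[OF heatN_integrable[OF y(2), of t]])
       (use heatN_integrable[OF y(2), of t] in \<open>auto split: split_indicator\<close>)
  define k where "k = (sqrt 2 ^ 3 :: real) ^ N"
  have bounds: "1 - k * exp (- (\<delta>\<^sup>2 / 4 * real (Suc n))) \<le> (LINT x|?M. heatN N (1 / real (Suc n)) y x * indicator U x)"
    "(LINT x|?M. heatN N (1 / real (Suc n)) y x * indicator U x) \<le> 1" for n
  proof -
    define t where "t = 1 / real (Suc n)"
    have t: "0 < t" by (simp add: t_def)
    have "(LINT x|?M. heatN N t y x * indicator U x) \<le> (LINT x|?M. heatN N t y x)"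
      using heatN_nonneg by (intro integral_mono i heatN_integrable[OF y(2)]) (auto split: split_indicator)
    then show "(LINT x|?M. heatN N (1 / real (Suc n)) y x * indicator U x) \<le> 1"
      using heatN_integral[OF y(2) t] by (simp add: t_def)
    have le: "heatN N t y x - heatN N t y x * indicator U x \<le> k * exp (- \<delta>\<^sup>2 / (4 * t)) * heatN N (2 * t) y x"
      if "x \<in> space ?M" for x
    proof (cases "x \<in> U \<or> heatN N t y x = 0")
      case True
      then show ?thesis using heatN_nonneg[of N "2 * t" y x] by (auto simp: k_def)
    next
      case False
      then have s: "\<forall>i<N. snd (x i) = snd (y i)" using t by (auto simp: heatN_explicit split: if_splits)
      have "\<delta>\<^sup>2 \<le> config_dist2 N x y" using \<delta>(2)[OF that s] False not_le by blast
      from heatN_tail[OF t this] show ?thesis using False by (simp add: heatN_sym[of N _ y x] k_def)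
    qed
    have "1 - (LINT x|?M. heatN N t y x * indicator U x) = (LINT x|?M. heatN N t y x - heatN N t y x * indicator U x)"
      using heatN_integral[OF y(2) t] i heatN_integrable[OF y(2)] by simp
    also have "\<dots> \<le> (LINT x|?M. k * exp (- \<delta>\<^sup>2 / (4 * t)) * heatN N (2 * t) y x)"
      using i heatN_integrable[OF y(2)] le by (intro integral_mono) auto
    also have "\<dots> = k * exp (- \<delta>\<^sup>2 / (4 * t))"
      using heatN_integral[OF y(2), of "2 * t"] t by simp
    also have "- \<delta>\<^sup>2 / (4 * t) = - (\<delta>\<^sup>2 / 4 * real (Suc n))" by (simp add: t_def)
    finally show "1 - k * exp (- (\<delta>\<^sup>2 / 4 * real (Suc n))) \<le> (LINT x|?M. heatN N (1 / real (Suc n)) y x * indicator U x)"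
      by (simp add: t_def)
  qed
  have "(\<lambda>n. 1 - k * exp (- (\<delta>\<^sup>2 / 4 * real (Suc n)))) \<longlonglongrightarrow> 1 - k * 0"
  proof (intro tendsto_intros)
    have "filterlim (\<lambda>n. \<delta>\<^sup>2 / 4 * real (Suc n)) at_top sequentially"
      using \<delta>(1) filterlim_Suc
      by (intro filterlim_tendsto_pos_mult_at_top[OF tendsto_const] filterlim_compose[OF filterlim_real_sequentially]) auto
    then show "(\<lambda>n. exp (- (\<delta>\<^sup>2 / 4 * real (Suc n)))) \<longlonglongrightarrow> 0"
      by (rule filterlim_compose[OF exp_at_bot filterlim_compose[OF filterlim_uminus_at_bot_at_top]])
  qed
  then have lower: "(\<lambda>n. 1 - k * exp (- (\<delta>\<^sup>2 / 4 * real (Suc n)))) \<longlonglongrightarrow> 1" by simp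
  show ?thesis
    by (rule tendsto_sandwich[OF _ _ lower tendsto_const]; intro always_eventually allI bounds)
qed

text \<open>Writing P for the heat operator, the square of the distance is expanded and
  contractivity bounds it by 2 <h, h> - 2 <P h, h>. Pointwise convergence then matters only inside
  the open set \<open>U\<close>, where \<open>heat_op_open_tendsto\<close> provides it, and the
  boundary of \<open>U\<close> causes no trouble.\<close>

lemma heat_op_indicator_tendsto:
  fixes U :: "config set"
  assumes U: "open U" and fin: "emeasure (config_measure N) (U \<inter> space (config_measure N)) < \<infinity>"
  defines "h \<equiv> \<lambda>x. complex_of_real (indicator U x)"
  shows "h \<in> L2 (config_measure N)"
    and "(\<lambda>n. l2norm (config_measure N) (\<lambda>x. heatN.heat_op N (1 / real (Suc n)) h x - h x)) \<longlonglongrightarrow> 0"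
proof -
  let ?M = "config_measure N"
  have "(\<lambda>x. x) -` U \<inter> space ?M \<in> sets ?M"
    by (rule measurable_sets[OF measurable_config_id]) (use U in simp)
  then have Us [measurable]: "U \<inter> space ?M \<in> sets ?M" by simp
  have Um [measurable]: "(\<lambda>x. indicator U x :: real) \<in> borel_measurable ?M"
    using measurable_compose[OF measurable_config_id, of "indicator U" borel N] U by simp
  have ind: "integrable ?M (\<lambda>x. indicator U x :: real)"
  proof -
    have "integrable ?M (indicator (U \<inter> space ?M) :: config \<Rightarrow> real)"
      using fin by (intro integrable_real_indicator) auto
    then show ?thesis
      by (rule Bochner_Integration.integrable_cong[THEN iffD1, rotated 2]) (auto split: split_indicator)
  qed
  have sq: "(cmod (h x))\<^sup>2 = indicator U x" for x by (auto simp: h_def split: split_indicator)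
  show h: "h \<in> L2 ?M" unfolding L2_def using ind by (auto simp: sq) (simp add: h_def)
  define q where "q = (\<lambda>n y. LINT x|?M. heatN N (1 / real (Suc n)) y x * indicator U x)"
  have qh: "heatN.heat_op N (1 / real (Suc n)) h y = complex_of_real (q n y)" for n y
    by (simp add: heatN.heat_op_def integral_op_def h_def q_def flip: of_real_mult)
  have qL: "(\<lambda>y. complex_of_real (q n y)) \<in> L2 ?M" for n
      proof -
    have "heatN.heat_op N (1 / real (Suc n)) h = (\<lambda>y. complex_of_real (q n y))"
      by (rule ext) (rule qh)
    then show ?thesis using heatN.heat_op_L2[OF h, of "1 / real (Suc n)"] by (simp only:)
  qed
  have q01: "0 \<le> q n y" for n y by (simp add: q_def heatN_nonneg)
  have q1: "q n y \<le> 1" if y: "y \<in> space ?M" for n y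
  proof -
    have "q n y \<le> (LINT x|?M. heatN N (1 / real (Suc n)) y x)"
      unfolding q_def using heatN_nonneg
      by (intro integral_mono' heatN_integrable[OF y]) (auto split: split_indicator)
    then show ?thesis using heatN_integral[OF y] by simp
  qed
  have [measurable]: "q n \<in> borel_measurable ?M" for n
    unfolding q_def by measurable
  have q2i: "integrable ?M (\<lambda>y. (q n y)\<^sup>2)" for n using L2_integrable[OF qL] by simp
  have qUi: "integrable ?M (\<lambda>y. q n y * indicator U y)" for n
    by (rule Bochner_Integration.integrable_bound[OF ind])
       (use q01 q1 in \<open>auto simp: abs_mult split: split_indicator\<close>)
  have lim: "(\<lambda>n. LINT y|?M. q n y * indicator U y) \<longlonglongrightarrow> (LINT y|?M. indicator U y)"
  proof (rule integral_dominated_convergence[where w = "\<lambda>y. indicator U y"])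
    show "AE y in ?M. (\<lambda>n. q n y * indicator U y) \<longlonglongrightarrow> indicator U y"
      using heat_op_open_tendsto[OF U] by (intro AE_I2) (auto simp: q_def split: split_indicator)
    show "AE y in ?M. norm (q n y * indicator U y) \<le> indicator U y" for n
      using q01 q1 by (intro AE_I2) (auto split: split_indicator)
  qed (use ind in auto)
  have le: "(l2norm ?M (\<lambda>x. heatN.heat_op N (1 / real (Suc n)) h x - h x))\<^sup>2 \<le>
      2 * (LINT y|?M. indicator U y) - 2 * (LINT y|?M. q n y * indicator U y)" for n
  proof -
    have "(cmod (heatN.heat_op N (1 / real (Suc n)) h x - h x))\<^sup>2 = (q n x)\<^sup>2 - 2 * (q n x * indicator U x) + indicator U x" for x
    proof -
      have "heatN.heat_op N (1 / real (Suc n)) h x - h x = complex_of_real (q n x - indicator U x)"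
        unfolding qh by (simp add: h_def)
      then show ?thesis by (simp only: norm_of_real power2_abs) (auto simp: power2_diff split: split_indicator)
    qed
    then have "(l2norm ?M (\<lambda>x. heatN.heat_op N (1 / real (Suc n)) h x - h x))\<^sup>2 =
        (LINT x|?M. (q n x)\<^sup>2) - 2 * (LINT x|?M. q n x * indicator U x) + (LINT x|?M. indicator U x)"
      unfolding l2norm_square using q2i qUi ind by simp
    moreover have "(LINT x|?M. (q n x)\<^sup>2) \<le> (LINT x|?M. indicator U x)"
      using power_mono[OF heatN.heat_op_norm[OF h, of "1 / real (Suc n)"] l2norm_nonneg, of 2]
      by (simp only: l2norm_square sq qh) simp
    ultimately show ?thesis by linarith
  qed
  have "(\<lambda>n. 2 * (LINT y|?M. indicator U y) - 2 * (LINT y|?M. q n y * indicator U y)) \<longlonglongrightarrow>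
      2 * (LINT y|?M. indicator U y) - 2 * (LINT y|?M. indicator U y :: real)"
    by (intro tendsto_intros lim)
  then have upper: "(\<lambda>n. 2 * (LINT y|?M. indicator U y) - 2 * (LINT y|?M. q n y * indicator U y)) \<longlonglongrightarrow> 0" by simp
  have "(\<lambda>n. (l2norm ?M (\<lambda>x. heatN.heat_op N (1 / real (Suc n)) h x - h x))\<^sup>2) \<longlonglongrightarrow> 0"
    by (rule tendsto_sandwich[OF _ _ tendsto_const upper]; intro always_eventually allI le zero_le_power2)
  from tendsto_real_sqrt[OF this]
  show "(\<lambda>n. l2norm ?M (\<lambda>x. heatN.heat_op N (1 / real (Suc n)) h x - h x)) \<longlonglongrightarrow> 0" by simp
qed

lemma AE_zero_real:
  fixes r :: "'a \<Rightarrow> real"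
  assumes r: "integrable M r" and z: "\<And>A. A \<in> sets M \<Longrightarrow> (LINT x|M. r x * indicator A x) = 0"
  shows "AE x in M. r x = 0"
proof -
  have [measurable]: "r \<in> borel_measurable M" using r by auto
  have half: "AE x in M. \<not> 0 < f x" if f: "f = r \<or> f = (\<lambda>x. - r x)" for f
  proof -
    have [measurable]: "f \<in> borel_measurable M" using f by auto
    define A where "A = {x \<in> space M. 0 < f x}"
    have A: "A \<in> sets M" unfolding A_def by measurable
    have "integrable M (\<lambda>x. f x * indicator A x)"
      using f r A by (auto intro!: integrable_real_mult_indicator)
    moreover have "(LINT x|M. f x * indicator A x) = 0" using f z[OF A] by auto
    moreover have "AE x in M. 0 \<le> f x * indicator A x" by (auto simp: A_def split: split_indicator)
    ultimately have "AE x in M. f x * indicator A x = 0"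
      by (simp add: integral_nonneg_eq_0_iff_AE)
    with AE_space show ?thesis by eventually_elim (auto simp: A_def split: split_indicator_asm)
  qed
  have "AE x in M. \<not> 0 < r x" "AE x in M. \<not> 0 < - r x"
    using half[of r] half[of "\<lambda>x. - r x"] by auto
  then show ?thesis by eventually_elim simp
qed

text \<open>Consequently every measurable set of configurations is the trace of a Borel set of the
  function space, which lets \<open>AE_zero_config\<close> reach all measurable sets from the open
  ones.\<close>

lemma measurable_config_borel:
  "(\<lambda>x. x) \<in> measurable (restrict_space borel (space (config_measure N))) (config_measure N)"
proof -
  let ?R = "restrict_space borel (space (config_measure N)) :: config measure"
  have sp: "space ?R = space (config_measure N)" by (simp add: space_restrict_space)
  have "(\<lambda>x. x i) \<in> measurable ?R particle_measure" if i: "i < N" for i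
  proof -
    have c: "(\<lambda>x :: config. x i) \<in> borel_measurable ?R"
      by (intro measurable_restrict_space1 borel_measurable_continuous_onI continuous_on_product_coordinates)
    have f: "(\<lambda>x. fst (x i)) \<in> borel_measurable ?R" "(\<lambda>x. snd (x i)) \<in> borel_measurable ?R"
      using measurable_compose[OF c borel_measurable_continuous_onI[OF continuous_on_fst[OF continuous_on_id]]]
        measurable_compose[OF c borel_measurable_continuous_onI[OF continuous_on_snd[OF continuous_on_id]]] by auto
    have s: "(\<lambda>x. snd (x i)) \<in> measurable ?R (count_space spins)"
    proof (subst measurable_count_space_eq2, simp, intro conjI ballI)
      show "(\<lambda>x. snd (x i)) \<in> space ?R \<rightarrow> spins"
        using space_configD[OF _ i] unfolding sp by (auto simp: space_particle mem_Times_iff)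
      show "(\<lambda>x. snd (x i)) -` {a} \<inter> space ?R \<in> sets ?R" for a
        by (rule measurable_sets[OF f(2)]) simp
    qed
    have "(\<lambda>x. (fst (x i), snd (x i))) \<in> measurable ?R (lborel \<Otimes>\<^sub>M count_space spins)"
      by (intro measurable_Pair s) (use f(1) in simp)
    then show ?thesis by (simp add: particle_measure_def)
  qed
  then show ?thesis
    unfolding config_measure_def
  proof (intro measurable_PiM_single')
    show "(\<lambda>x. x) \<in> space (restrict_space borel (space (PiM {..<N} (\<lambda>_. particle_measure)))) \<rightarrow> (\<Pi>\<^sub>E i\<in>{..<N}. space particle_measure)"
      by (auto simp: space_restrict_space space_PiM)
  qed auto
qed

text \<open>On a bounded open set \<open>w\<close> is integrable. The Borel sets over which its
  integral vanishes form a Dynkin system containing the open sets, which are stable under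
  intersection; hence they are all Borel sets and, by traces, all measurable ones. Countably many
  bounded open sets cover the space.\<close>

lemma AE_zero_config:
  assumes w: "w \<in> L2 (config_measure N)"
    and z: "\<And>U :: config set. open U \<Longrightarrow> emeasure (config_measure N) (U \<inter> space (config_measure N)) < \<infinity> \<Longrightarrow>
      (LINT x|config_measure N. w x * complex_of_real (indicator U x)) = 0"
  shows "AE x in config_measure N. w x = 0"
proof -
  let ?M = "config_measure N"
  note [measurable] = L2_measurable[OF w]
  have R: "AE x in ?M. x \<in> {x. \<forall>i<N. norm (fst (x i)) < real R} \<longrightarrow> w x = 0" for R :: nat
  proof -
    define B where "B = {x :: config. \<forall>i<N. norm (fst (x i)) < real R}"
    have "open {x :: config. norm (fst (x i)) < real R}" for i
      by (intro open_Collect_less continuous_intros continuous_on_product_coordinates)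
    moreover have "B = (\<Inter>i\<in>{..<N}. {x. norm (fst (x i)) < real R})" by (auto simp: B_def)
    ultimately have Bo: "open B" by (simp add: open_INT)
    have setsI: "U \<inter> space ?M \<in> sets ?M" if "U \<in> sets borel" for U :: "config set"
      using measurable_sets[OF measurable_config_id that, of N] by simp
    have Bfin: "emeasure ?M (V \<inter> space ?M) < \<infinity>" if "V \<subseteq> B" "V \<in> sets borel" for V
    proof -
      have "V \<inter> space ?M \<subseteq> config_ball N (real R)"
        using that by (auto simp: B_def config_ball_iff less_imp_le)
      then have "emeasure ?M (V \<inter> space ?M) \<le> emeasure ?M (config_ball N (real R))"
        by (intro emeasure_mono) auto
      then show ?thesis using emeasure_config_ball by (rule le_less_trans)
    qed
    define f where "f = (\<lambda>x. w x * complex_of_real (indicator B x))"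
    have fi: "integrable ?M f"
      unfolding f_def using Bo by (intro L2_prod_integrable w heat_op_indicator_tendsto(1) Bfin) auto
    have [measurable]: "f \<in> borel_measurable ?M" using fi by auto
    have indm: "(\<lambda>x. indicator A x :: real) \<in> borel_measurable ?M" if "A \<in> sets borel" for A
      using measurable_compose[OF measurable_config_id, of "indicator A" borel N] that by simp
    have fAi: "integrable ?M (\<lambda>x. f x * complex_of_real (indicator A x))" if "A \<in> sets borel" for A
    proof (rule Bochner_Integration.integrable_bound[OF fi])
      show "(\<lambda>x. f x * complex_of_real (indicator A x)) \<in> borel_measurable ?M" using indm[OF that] by measurable
    qed (auto simp: norm_mult split: split_indicator)
    have all: "(LINT x|?M. f x * complex_of_real (indicator A x)) = 0" if A: "A \<in> sets borel" for A
    proof -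
      have b: "(LINT x|?M. f x * complex_of_real (indicator U x)) = 0" if "open U" for U
      proof -
        have "(LINT x|?M. f x * complex_of_real (indicator U x)) = (LINT x|?M. w x * complex_of_real (indicator (B \<inter> U) x))"
          by (simp add: f_def indicator_inter_arith mult.assoc)
        also have "\<dots> = 0" using that Bo by (intro z Bfin) auto
        finally show ?thesis .
      qed
      have gen: "Int_stable {U :: config set. open U}" "{U :: config set. open U} \<subseteq> Pow UNIV"
        "A \<in> sigma_sets UNIV {U. open U}"
        using A by (auto simp: Int_stable_def borel_def)
      then show ?thesis
      proof (induction rule: sigma_sets_induct_disjoint)
        case (compl A)
        then have Ab: "A \<in> sets borel" by (simp add: borel_def)
        have "(\<lambda>x. f x * complex_of_real (indicator (UNIV - A) x)) = (\<lambda>x. f x * complex_of_real (indicator UNIV x) - f x * complex_of_real (indicator A x))"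
          by (auto split: split_indicator)
        then show ?case using compl b[of UNIV] fAi[OF Ab] fAi[of UNIV] by simp
      next
        case (union A)
        then have Ab: "A i \<in> sets borel" for i by (auto simp: borel_def)
        define A' where "A' = (\<lambda>i. A i \<inter> space ?M)"
        have e: "(LINT x:D \<inter> space ?M|?M. f x) = (LINT x|?M. f x * complex_of_real (indicator D x))" for D
          unfolding set_lebesgue_integral_def
          by (intro Bochner_Integration.integral_cong refl) (auto split: split_indicator)
        have "(LINT x:(\<Union>i. A' i)|?M. f x) = (\<Sum>i. (LINT x:(A' i)|?M. f x))"
        proof (rule lebesgue_integral_countable_add)
          show "A' i \<in> sets ?M" for i unfolding A'_def by (rule setsI[OF Ab])
          then have "(\<Union>i. A' i) \<in> sets ?M" by auto
          then show "set_integrable ?M (\<Union>i. A' i) f"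
            unfolding set_integrable_def by (intro integrable_mult_indicator fi)
          show "A' i \<inter> A' j = {}" if "i \<noteq> j" for i j
            using union(1) that by (auto simp: A'_def disjoint_family_on_def)
        qed
        moreover have "(\<Union>i. A' i) = (\<Union>i. A i) \<inter> space ?M" by (auto simp: A'_def)
        ultimately show ?case using union(3) by (simp add: e A'_def)
      qed (use b in auto)
    qed
    have sets: "(LINT x|?M. f x * complex_of_real (indicator A x)) = 0" if A: "A \<in> sets ?M" for A
    proof -
      have "A \<inter> space ?M \<in> sets (restrict_space borel (space ?M))"
        using measurable_sets[OF measurable_config_borel A] by (simp add: space_restrict_space)
      then obtain V where V: "V \<in> sets borel" "A = V \<inter> space ?M"
        using sets.sets_into_space[OF A] by (auto simp: sets_restrict_space Int_absorb2)
      have "(LINT x|?M. f x * complex_of_real (indicator A x)) = (LINT x|?M. f x * complex_of_real (indicator V x))"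
        using V(2) by (intro Bochner_Integration.integral_cong refl) (auto split: split_indicator)
      then show ?thesis using all[OF V(1)] by simp
    qed
    have fAi': "integrable ?M (\<lambda>x. f x * complex_of_real (indicator A x))" if "A \<in> sets ?M" for A
      by (rule Bochner_Integration.integrable_bound[OF fi]) (use that in \<open>auto simp: norm_mult split: split_indicator\<close>)
    have "AE x in ?M. Re (f x) = 0"
    proof (rule AE_zero_real)
      show "(LINT x|?M. Re (f x) * indicator A x) = 0" if "A \<in> sets ?M" for A
        using sets[OF that] integral_Re[OF fAi'[OF that]] by simp
    qed (use fi in auto)
    moreover have "AE x in ?M. Im (f x) = 0"
    proof (rule AE_zero_real)
      show "(LINT x|?M. Im (f x) * indicator A x) = 0" if "A \<in> sets ?M" for A
        using sets[OF that] integral_Im[OF fAi'[OF that]] by simp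
    qed (use fi in auto)
    ultimately show ?thesis
      by eventually_elim (auto simp: f_def B_def complex_eq_iff)
  qed
  have "AE x in ?M. \<forall>R. x \<in> {x. \<forall>i<N. norm (fst (x i)) < real R} \<longrightarrow> w x = 0"
    unfolding AE_all_countable using R by blast
  then show ?thesis
  proof eventually_elim
    case (elim x)
    obtain R :: nat where "(\<Sum>i<N. norm (fst (x i))) < real R" using reals_Archimedean2 by blast
    moreover have "norm (fst (x i)) \<le> (\<Sum>i<N. norm (fst (x i)))" if "i < N" for i
      using that by (intro member_le_sum) auto
    ultimately have "\<forall>i<N. norm (fst (x i)) < real R" by (meson le_less_trans)
    then show ?case using elim by blast
  qed
qed

section \<open>The Green's function\<close>

text \<open>\<open>heat_flow_pairing\<close> is taken from 1 / (n + 1) to n + 1. At the upper end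
  the exponential kills the term, at the lower end the flow returns \<open>u\<close>, and the
  integral tends to the pairing of the Green's operator by \<open>green_pairing\<close>.\<close>

lemma green_left_inverse:
  assumes \<mu>: "\<mu> < 0" and uv: "kinetic N u v"
  shows "AE x in config_measure N. heatN.green N \<mu> (\<lambda>y. v y - complex_of_real \<mu> * u y) x = u x"
proof -
  let ?M = "config_measure N"
  define g where "g = (\<lambda>y. v y - complex_of_real \<mu> * u y)"
  have u: "u \<in> L2 ?M" and v: "v \<in> L2 ?M" using uv by (auto simp: kinetic_def)
  have g: "g \<in> L2 ?M" unfolding g_def by (intro L2_diff L2_scale u v)
  have G: "heatN.green N \<mu> g \<in> L2 ?M" by (rule heatN.green_L2[OF \<mu> g])
  have "AE x in ?M. heatN.green N \<mu> g x - u x = 0"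
  proof (rule AE_zero_config)
    show "(\<lambda>x. heatN.green N \<mu> g x - u x) \<in> L2 ?M" by (intro L2_diff G u)
    fix U :: "config set" assume U: "open U" "emeasure ?M (U \<inter> space ?M) < \<infinity>"
    define h where "h = (\<lambda>x. complex_of_real (indicator U x))"
    have h: "h \<in> L2 ?M" unfolding h_def by (rule heat_op_indicator_tendsto(1)[OF U])
    define p where "p = (\<lambda>t. LINT y|?M. heatN.heat_op N t g y * h y)"
    define a where "a = (\<lambda>n::nat. 1 / real (Suc n))"
    have a: "0 < a n" "a n \<le> real (Suc n)" for n
    proof -
      show "0 < a n" by (simp add: a_def)
      have "a n \<le> 1" by (simp add: a_def)
      then show "a n \<le> real (Suc n)" by simp
    qed
    have a0: "a \<longlonglongrightarrow> 0" unfolding a_def by (rule LIMSEQ_Suc[OF lim_1_over_n])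
    \<comment> \<open>Symmetry transfers the heat operator from \<open>u\<close> to the indicator
      \<open>h\<close>, for which convergence in norm is known.\<close>
    have l1: "(\<lambda>n. LINT y|?M. heatN.heat_op N (a n) u y * h y) \<longlonglongrightarrow> (LINT y|?M. u y * h y)"
    proof -
      have n0: "(\<lambda>n. l2norm ?M u * l2norm ?M (\<lambda>x. heatN.heat_op N (a n) h x - h x)) \<longlonglongrightarrow> 0"
        using tendsto_mult_left[OF heat_op_indicator_tendsto(2)[OF U], of "l2norm ?M u"] by (simp add: h_def a_def)
      have "(LINT y|?M. heatN.heat_op N (a n) u y * h y) - (LINT y|?M. u y * h y) =
          (LINT y|?M. u y * (heatN.heat_op N (a n) h y - h y))" for n
        unfolding heatN.heat_op_symmetric[OF u h] right_diff_distrib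
        by (intro Bochner_Integration.integral_diff[symmetric] L2_prod_integrable u heatN.heat_op_L2 h)
      then have "norm ((LINT y|?M. heatN.heat_op N (a n) u y * h y) - (LINT y|?M. u y * h y))
          \<le> l2norm ?M u * l2norm ?M (\<lambda>x. heatN.heat_op N (a n) h x - h x)" for n
        using L2_Cauchy_Schwarz[OF u L2_diff[OF heatN.heat_op_L2[OF h] h]] by simp
      from Lim_null_comparison[OF always_eventually[OF allI[OF this]] n0] show ?thesis
        by (rule LIM_zero_cancel)
    qed
    have "(\<lambda>n. exp (\<mu> * a n)) \<longlonglongrightarrow> exp (\<mu> * 0)" by (intro tendsto_intros a0)
    from tendsto_mult[OF tendsto_of_real[OF this] l1]
    have L1: "(\<lambda>n. complex_of_real (exp (\<mu> * a n)) * (LINT y|?M. heatN.heat_op N (a n) u y * h y)) \<longlonglongrightarrow> (LINT y|?M. u y * h y)"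
      by simp
    have L2: "(\<lambda>n. complex_of_real (exp (\<mu> * real (Suc n))) * (LINT y|?M. heatN.heat_op N (real (Suc n)) u y * h y)) \<longlonglongrightarrow> 0"
    proof (rule Lim_null_comparison)
      have "filterlim (\<lambda>n. - \<mu> * real (Suc n)) at_top sequentially"
        using \<mu> filterlim_Suc
        by (intro filterlim_tendsto_pos_mult_at_top[OF tendsto_const] filterlim_compose[OF filterlim_real_sequentially]) auto
      then have "(\<lambda>n. exp (- (- \<mu> * real (Suc n)))) \<longlonglongrightarrow> 0"
        by (rule filterlim_compose[OF exp_at_bot filterlim_compose[OF filterlim_uminus_at_bot_at_top]])
      then have "(\<lambda>n. exp (\<mu> * real (Suc n)) * (l2norm ?M u * l2norm ?M h)) \<longlonglongrightarrow> 0 * (l2norm ?M u * l2norm ?M h)"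
        by (intro tendsto_mult_right) simp
      then show "(\<lambda>n. exp (\<mu> * real (Suc n)) * (l2norm ?M u * l2norm ?M h)) \<longlonglongrightarrow> 0" by simp
      show "\<forall>\<^sub>F n in sequentially. norm (complex_of_real (exp (\<mu> * real (Suc n))) * (LINT y|?M. heatN.heat_op N (real (Suc n)) u y * h y))
          \<le> exp (\<mu> * real (Suc n)) * (l2norm ?M u * l2norm ?M h)"
        using heatN.heat_op_pairing_bound[OF u h]
        by (intro always_eventually allI) (auto simp: norm_mult intro!: mult_left_mono)
    qed
    have pi: "integrable lborel (\<lambda>t. complex_of_real (exp (\<mu> * t)) * p t)"
      unfolding p_def by (rule heatN.green_pairing_integrable[OF \<mu> g h])
    have "(\<lambda>n. LINT t|lborel. complex_of_real (indicator {a n..real (Suc n)} t * exp (\<mu> * t)) * p t) \<longlonglongrightarrow>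
        (LINT t|lborel. complex_of_real (exp (\<mu> * t)) * p t)"
    proof (rule integral_dominated_convergence[where w = "\<lambda>t. norm (complex_of_real (exp (\<mu> * t)) * p t)"])
      show m: "(\<lambda>t. complex_of_real (exp (\<mu> * t)) * p t) \<in> borel_measurable lborel" using pi by auto
      show "integrable lborel (\<lambda>t. norm (complex_of_real (exp (\<mu> * t)) * p t))" by (rule integrable_norm[OF pi])
      show "(\<lambda>t. complex_of_real (indicator {a n..real (Suc n)} t * exp (\<mu> * t)) * p t) \<in> borel_measurable lborel" for n
        using borel_measurable_times[OF _ m, of "\<lambda>t. complex_of_real (indicator {a n..real (Suc n)} t)"]
        by (simp add: mult.assoc)
      show "AE t in lborel. norm (complex_of_real (indicator {a n..real (Suc n)} t * exp (\<mu> * t)) * p t) \<le>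
          norm (complex_of_real (exp (\<mu> * t)) * p t)" for n
        by (intro AE_I2) (auto simp: norm_mult split: split_indicator)
      show "AE t in lborel. (\<lambda>n. complex_of_real (indicator {a n..real (Suc n)} t * exp (\<mu> * t)) * p t) \<longlonglongrightarrow>
          complex_of_real (exp (\<mu> * t)) * p t"
      proof (intro AE_I2)
        fix t :: real
        show "(\<lambda>n. complex_of_real (indicator {a n..real (Suc n)} t * exp (\<mu> * t)) * p t) \<longlonglongrightarrow> complex_of_real (exp (\<mu> * t)) * p t"
        proof (cases "0 < t")
          case True
          have "\<forall>\<^sub>F n in sequentially. a n < t" using order_tendstoD(2)[OF a0 True] .
          moreover obtain m :: nat where m: "t < real m" using reals_Archimedean2 by blast
          have "\<forall>\<^sub>F n in sequentially. t \<le> real (Suc n)"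
            using eventually_ge_at_top[of m] by eventually_elim (use m in simp)
          ultimately have "\<forall>\<^sub>F n in sequentially. complex_of_real (indicator {a n..real (Suc n)} t * exp (\<mu> * t)) * p t = complex_of_real (exp (\<mu> * t)) * p t"
            by eventually_elim simp
          then show ?thesis by (rule tendsto_eventually)
        next
          case False
          then have "p t = 0" by (simp add: p_def heatN.heat_op_nonpos)
          then show ?thesis by simp
        qed
      qed
    qed
    moreover have "(LINT t|lborel. complex_of_real (exp (\<mu> * t)) * p t) = (LINT x|?M. heatN.green N \<mu> g x * h x)"
      unfolding p_def by (rule heatN.green_pairing[OF \<mu> g h, symmetric])
    moreover have "complex_of_real (exp (\<mu> * a n)) * (LINT y|?M. heatN.heat_op N (a n) u y * h y) -
        complex_of_real (exp (\<mu> * real (Suc n))) * (LINT y|?M. heatN.heat_op N (real (Suc n)) u y * h y) =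
        (LINT t|lborel. complex_of_real (indicator {a n..real (Suc n)} t * exp (\<mu> * t)) * p t)" for n
      unfolding p_def g_def by (rule heat_flow_pairing[OF uv a h])
    ultimately have "(LINT x|?M. heatN.green N \<mu> g x * h x) = (LINT y|?M. u y * h y) - 0"
      using LIMSEQ_unique[OF _ tendsto_diff[OF L1 L2]] by simp
    then show "(LINT x|?M. (heatN.green N \<mu> g x - u x) * complex_of_real (indicator U x)) = 0"
      using L2_prod_integrable[OF G h] L2_prod_integrable[OF u h] by (simp add: h_def left_diff_distrib)
  qed
  then show ?thesis by (simp add: g_def)
qed

text \<open>For a test function \<phi> the left inverse gives \<phi> = G \<psi> with \<psi> = T
  \<phi> - \<mu> \<phi>. Symmetry of G turns the pairing of f with \<phi> into that of G f with
  \<psi>, which is the weak form of (T - \<mu>) G f = f.\<close>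

lemma greens_function_green:
  assumes \<mu>: "\<mu> < 0"
  shows "greens_function N \<mu> (heatN.green N \<mu>)"
  unfolding greens_function_def
proof (intro conjI ballI allI impI)
  let ?M = "config_measure N"
  let ?G = "heatN.green N \<mu>"
  show "bounded_op ?M ?G" by (rule heatN.bounded_green[OF \<mu>])
  show "AE x in ?M. ?G (\<lambda>y. v y - complex_of_real \<mu> * u y) x = u x" if "kinetic N u v" for u v
    by (rule green_left_inverse[OF \<mu> that])
  fix f assume f: "f \<in> L2 ?M"
  have G: "?G f \<in> L2 ?M" by (rule heatN.green_L2[OF \<mu> f])
  define v where "v = (\<lambda>x. f x + complex_of_real \<mu> * ?G f x)"
  have v: "v \<in> L2 ?M" unfolding v_def by (intro L2_add L2_scale f G)
  have "kinetic N (?G f) v"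
    unfolding kinetic_def
  proof (intro conjI allI impI G v)
    fix \<phi> assume \<phi>: "test_function N \<phi>"
    note k = kinetic_test_function[OF \<phi>]
    have L: "\<phi> \<in> L2 ?M" "kinetic_test N \<phi> \<in> L2 ?M" using k by (auto simp: kinetic_def)
    define \<psi> where "\<psi> = (\<lambda>y. kinetic_test N \<phi> y - complex_of_real \<mu> * \<phi> y)"
    have \<psi>: "\<psi> \<in> L2 ?M" unfolding \<psi>_def by (intro L2_diff L2_scale L)
    have "(LINT x|?M. f x * \<phi> x) = (LINT x|?M. f x * ?G \<psi> x)"
    proof (rule integral_cong_AE)
      show "AE x in ?M. f x * \<phi> x = f x * ?G \<psi> x"
        using green_left_inverse[OF \<mu> k] unfolding \<psi>_def by eventually_elim simp
    qed (use f L heatN.green_L2[OF \<mu> \<psi>] in \<open>auto intro!: borel_measurable_times dest: L2_measurable\<close>)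
    also have "\<dots> = (LINT x|?M. ?G f x * \<psi> x)"
      by (rule heatN.green_symmetric[OF \<mu> f \<psi>, symmetric])
    also have "\<dots> = (LINT x|?M. ?G f x * kinetic_test N \<phi> x - complex_of_real \<mu> * (?G f x * \<phi> x))"
      by (simp add: \<psi>_def algebra_simps)
    also have "\<dots> = (LINT x|?M. ?G f x * kinetic_test N \<phi> x) - complex_of_real \<mu> * (LINT x|?M. ?G f x * \<phi> x)"
      using L2_prod_integrable[OF G L(1)] L2_prod_integrable[OF G L(2)] by simp
    finally have "(LINT x|?M. ?G f x * kinetic_test N \<phi> x) = (LINT x|?M. f x * \<phi> x) + complex_of_real \<mu> * (LINT x|?M. ?G f x * \<phi> x)"
      by simp
    also have "\<dots> = (LINT x|?M. v x * \<phi> x)"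
      using L2_prod_integrable[OF f L(1)] L2_prod_integrable[OF G L(1)] by (simp add: v_def distrib_right mult.assoc)
    finally show "(LINT x|?M. ?G f x * kinetic_test N \<phi> x) = (LINT x|?M. v x * \<phi> x)" .
  qed
  then show "\<exists>v. kinetic N (?G f) v \<and> (AE x in ?M. v x - complex_of_real \<mu> * ?G f x = f x)"
    by (intro exI[of _ v]) (simp add: v_def)
qed

text \<open>The semigroup law at the level of kernels. In \<open>green_norm_lower\<close> it turns
  norms and pairings of Gaussians into diagonal values of the kernel.\<close>

lemma heatN_convolution:
  assumes s: "0 < s" and t: "0 < t" and x: "x \<in> space (config_measure N)" and y: "y \<in> space (config_measure N)"
  shows "(LINT z|config_measure N. heatN N s x z * heatN N t z y) = heatN N (s + t) x y"
proof -
  have 1: "integrable particle_measure (\<lambda>z. heat1 s p z * heat1 t z q) \<and>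
      (LINT z|particle_measure. heat1 s p z * heat1 t z q) = heat1 (s + t) p q"
    if p: "p \<in> space particle_measure" for p q
  proof (cases "snd p = snd q")
    case True
    have sp: "snd p \<in> spins" using p by (auto simp: space_particle)
    have e: "heat1 s p z * heat1 t z q = gauss3 s (fst p - fst z) * gauss3 t (fst z - fst q) * of_bool (snd z = snd p)" for z
      using s t True by (auto simp: heat1_def)
    show ?thesis unfolding e
      using particle_integrable[OF gauss3_convolution(1)[OF s t] sp, of "fst p" "fst q"]
        particle_integral[OF gauss3_convolution(1)[OF s t] sp, of "fst p" "fst q"] gauss3_convolution(2)[OF s t] True s t
      by (simp add: heat1_def)
  next
    case False
    then have "(\<lambda>z. heat1 s p z * heat1 t z q) = (\<lambda>_. 0)" by (auto simp: heat1_def)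
    then show ?thesis using False by (simp add: heat1_def)
  qed
  have "(LINT z|config_measure N. heatN N s x z * heatN N t z y) = (LINT z|config_measure N. (\<Prod>i<N. heat1 s (x i) (z i) * heat1 t (z i) (y i)))"
    using s t by (simp add: heatN_def prod.distrib)
  also have "\<dots> = (\<Prod>i<N. (LINT z|particle_measure. heat1 s (x i) z * heat1 t z (y i)))"
    unfolding config_measure_def using 1 space_configD[OF x]
    by (intro particles.product_integral_prod) auto
  also have "\<dots> = (\<Prod>i<N. heat1 (s + t) (x i) (y i))"
    using 1 space_configD[OF x] by (intro prod.cong refl) auto
  finally show ?thesis using s t by (simp add: heatN_def)
qed

text \<open>Testing \<open>G\<close> on wide Gaussians \<open>K\<^sub>s(0, \<cdot>)\<close> gives the ratio
  \<open>\<integral> exp (\<mu> t) (2 s / (2 s + t))\<^bsup>3 N / 2\<^esup> dt\<close>, which tends to \<open>1 / - \<mu>\<close> as \<open>s \<rightarrow> \<infinity>\<close>.\<close>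

lemma green_norm_lower:
  assumes \<mu>: "\<mu> < 0"
  shows "1 / (- 2 * \<mu>) \<le> op_norm (config_measure N) (heatN.green N \<mu>)"
proof -
  let ?M = "config_measure N"
  \<comment> \<open>Any configuration would do as centre; it must be \<open>undefined\<close> beyond
    N to lie in the product space.\<close>
  define x0 where "x0 = (\<lambda>i. if i < N then (0, 1 / 2) else undefined :: particle)"
  have x0: "x0 \<in> space ?M" by (auto simp: x0_def space_config PiE_iff extensional_def)
  define f where "f = (\<lambda>s y. complex_of_real (heatN N s x0 y))"
  have f: "f s \<in> L2 ?M" for s unfolding f_def by (rule heatN_L2[OF x0])
  define \<kappa> where "\<kappa> = (\<lambda>s. ((1 / sqrt (2 * pi * s)) ^ 3) ^ N)"
  have diag: "heatN N s x0 x0 = \<kappa> s" if "0 < s" for s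
    using that by (simp add: heatN_explicit \<kappa>_def config_dist2_def)
  have \<kappa>0: "0 < \<kappa> s" if "0 < s" for s using that by (simp add: \<kappa>_def)
  have fn: "(l2norm ?M (f s))\<^sup>2 = \<kappa> (2 * s)" if s: "0 < s" for s
  proof -
    have "(l2norm ?M (f s))\<^sup>2 = (LINT y|?M. heatN N s x0 y * heatN N s y x0)"
      unfolding l2norm_square by (simp add: f_def power2_eq_square heatN_sym[of N s _ x0])
    also have "\<dots> = \<kappa> (2 * s)" unfolding heatN_convolution[OF s s x0 x0] using s diag[of "2 * s"] by simp
    finally show ?thesis .
  qed
  have pair: "(LINT x|?M. heatN.heat_op N t (f s) x * f s x) = complex_of_real (\<kappa> (2 * s + t))" if s: "0 < s" and t: "0 < t" for s t
  proof -
    have "heatN.heat_op N t (f s) x = complex_of_real (heatN N (t + s) x x0)" if x: "x \<in> space ?M" for x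
    proof -
      have "heatN.heat_op N t (f s) x = (LINT y|?M. complex_of_real (heatN N t x y * heatN N s y x0))"
        by (simp add: heatN.heat_op_def integral_op_def f_def heatN_sym[of N s x0])
      then show ?thesis unfolding integral_complex_of_real heatN_convolution[OF t s x x0] .
    qed
    then have "(LINT x|?M. heatN.heat_op N t (f s) x * f s x) = (LINT x|?M. complex_of_real (heatN N s x0 x * heatN N (t + s) x x0))"
      by (intro Bochner_Integration.integral_cong refl) (simp add: f_def)
    also have "\<dots> = complex_of_real (heatN N (s + (t + s)) x0 x0)"
      unfolding integral_complex_of_real using heatN_convolution[OF s _ x0 x0, of "t + s"] s t by simp
    also have "\<dots> = complex_of_real (\<kappa> (2 * s + t))" using diag[of "s + (t + s)"] s t by (simp add: add_ac)
    finally show ?thesis .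
  qed
  \<comment> \<open>The Rayleigh quotient of G at the kernel of time s: the pairing is \<kappa> (2
    s) J s and the squared norm is \<kappa> (2 s).\<close>
  define J where "J = (\<lambda>s. LINT t|lborel. indicator {0<..} t * exp (- (t * (- \<mu>))) * (\<kappa> (2 * s + t) / \<kappa> (2 * s)))"
  have hb: "has_bochner_integral lborel (\<lambda>t. indicator {0<..} t * exp (- (t * (- \<mu>)))) (1 / - \<mu>)"
    using \<mu> by (intro exp_half_line) auto
  have [measurable]: "\<kappa> \<in> borel_measurable borel" unfolding \<kappa>_def by measurable
  define S where "S = (\<lambda>n::nat. real (Suc n))"
  have "(\<lambda>n. J (S n)) \<longlonglongrightarrow> (LINT t|lborel. indicator {0<..} t * exp (- (t * (- \<mu>))) * 1)"
    unfolding J_def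
  proof (rule integral_dominated_convergence[where w = "\<lambda>t. indicator {0<..} t * exp (- (t * (- \<mu>)))"])
    show "integrable lborel (\<lambda>t. indicator {0<..} t * exp (- (t * (- \<mu>))))" using hb by (simp add: has_bochner_integral_iff)
    have r1: "\<kappa> (2 * S n + t) / \<kappa> (2 * S n) \<le> 1" "0 \<le> \<kappa> (2 * S n + t) / \<kappa> (2 * S n)" if "0 < t" for t n
    proof -
      have p: "0 < 2 * S n" "0 < 2 * S n + t" using that by (auto simp: S_def)
      have "\<kappa> (2 * S n + t) \<le> \<kappa> (2 * S n)"
        unfolding \<kappa>_def using p that by (intro power_mono frac_le) auto
      then show "\<kappa> (2 * S n + t) / \<kappa> (2 * S n) \<le> 1" "0 \<le> \<kappa> (2 * S n + t) / \<kappa> (2 * S n)"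
        using \<kappa>0[OF p(1)] \<kappa>0[OF p(2)] by (auto simp: divide_le_eq_1)
    qed
    show "AE t in lborel. norm (indicator {0<..} t * exp (- (t * (- \<mu>))) * (\<kappa> (2 * S n + t) / \<kappa> (2 * S n))) \<le>
        indicator {0<..} t * exp (- (t * (- \<mu>)))" for n
    proof (rule AE_I2)
      fix t
      show "norm (indicator {0<..} t * exp (- (t * (- \<mu>))) * (\<kappa> (2 * S n + t) / \<kappa> (2 * S n))) \<le> indicator {0<..} t * exp (- (t * (- \<mu>)))"
      proof (cases "0 < t")
        case True
        then have "exp (- (t * (- \<mu>))) * \<bar>\<kappa> (2 * S n + t) / \<kappa> (2 * S n)\<bar> \<le> exp (- (t * (- \<mu>))) * 1"
          using r1[OF True, of n] by (intro mult_left_mono) (simp only: abs_of_nonneg, simp)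
        then show ?thesis using True by (simp only: real_norm_def abs_mult) simp
      qed simp
    qed
    show "AE t in lborel. (\<lambda>n. indicator {0<..} t * exp (- (t * (- \<mu>))) * (\<kappa> (2 * S n + t) / \<kappa> (2 * S n))) \<longlonglongrightarrow>
        indicator {0<..} t * exp (- (t * (- \<mu>))) * 1"
    proof (intro AE_I2)
      fix t :: real
      show "(\<lambda>n. indicator {0<..} t * exp (- (t * (- \<mu>))) * (\<kappa> (2 * S n + t) / \<kappa> (2 * S n))) \<longlonglongrightarrow> indicator {0<..} t * exp (- (t * (- \<mu>))) * 1"
      proof (cases "0 < t")
        case True
        \<comment> \<open>The ratio of normalisations is a power of sqrt (2 s / (2 s + t)) with s =
          n + 1, rewritten in terms of 1 / s so that the limit can be read off.\<close>
        have "(\<lambda>n. ((sqrt (1 / (1 + t / 2 * (1 / real (Suc n))))) ^ 3) ^ N) \<longlonglongrightarrow> ((sqrt (1 / (1 + t / 2 * 0))) ^ 3) ^ N"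
          by (intro tendsto_intros LIMSEQ_Suc[OF lim_1_over_n]) auto
        moreover have "((sqrt (1 / (1 + t / 2 * (1 / real (Suc n))))) ^ 3) ^ N = \<kappa> (2 * S n + t) / \<kappa> (2 * S n)" for n
        proof -
          have "sqrt (1 / (1 + t / 2 * (1 / S n))) = (1 / sqrt (2 * pi * (2 * S n + t))) / (1 / sqrt (2 * pi * (2 * S n)))"
          proof -
            have "0 < S n" by (simp add: S_def)
            then have "1 / (1 + t / 2 * (1 / S n)) = (2 * S n) / (2 * S n + t)"
              using True by (simp add: field_simps)
            also have "\<dots> = (2 * pi * (2 * S n)) / (2 * pi * (2 * S n + t))"
              by (rule mult_divide_mult_cancel_left[symmetric]) simp
            finally have "1 / (1 + t / 2 * (1 / S n)) = (2 * pi * (2 * S n)) / (2 * pi * (2 * S n + t))" .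
            then show ?thesis by (simp only: real_sqrt_divide) simp
          qed
          then show ?thesis unfolding \<kappa>_def S_def by (simp only: power_divide)
        qed
        ultimately show ?thesis by (intro tendsto_mult_left) simp
      qed simp
    qed
  qed measurable
  then have "(\<lambda>n. J (S n)) \<longlonglongrightarrow> 1 / - \<mu>" using hb by (simp add: has_bochner_integral_iff)
  \<comment> \<open>The limit 1 / - \<mu> lies strictly above its half, so the quotient exceeds the
    half at some finite s.\<close>
  moreover have "1 / (- 2 * \<mu>) < 1 / - \<mu>" using \<mu> by (simp add: field_simps)
  ultimately have "\<forall>\<^sub>F n in sequentially. 1 / (- 2 * \<mu>) < J (S n)" by (rule order_tendstoD(1))
  then obtain n where n: "1 / (- 2 * \<mu>) < J (S n)" by (auto simp: eventually_sequentially)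
  define s where "s = S n"
  have s: "0 < s" by (simp add: s_def S_def)
  define b where "b = l2norm ?M (f s)"
  have b2: "b\<^sup>2 = \<kappa> (2 * s)" unfolding b_def by (rule fn[OF s])
  have b0: "0 < b" using b2 \<kappa>0[of "2 * s"] s l2norm_nonneg[of ?M "f s"] by (metis b_def less_le mult_pos_pos power_zero_numeral zero_less_numeral)
  have "(LINT x|?M. heatN.green N \<mu> (f s) x * f s x) = complex_of_real (\<kappa> (2 * s) * J s)"
  proof -
    have "(LINT x|?M. heatN.green N \<mu> (f s) x * f s x) =
        (LINT t|lborel. complex_of_real (\<kappa> (2 * s) * (indicator {0<..} t * exp (- (t * (- \<mu>))) * (\<kappa> (2 * s + t) / \<kappa> (2 * s)))))"
      unfolding heatN.green_pairing[OF \<mu> f f]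
    proof (intro Bochner_Integration.integral_cong refl)
      fix t
      show "complex_of_real (exp (\<mu> * t)) * (LINT x|?M. heatN.heat_op N t (f s) x * f s x) =
          complex_of_real (\<kappa> (2 * s) * (indicator {0<..} t * exp (- (t * (- \<mu>))) * (\<kappa> (2 * s + t) / \<kappa> (2 * s))))"
        using \<kappa>0[of "2 * s"] s by (cases "0 < t") (simp_all add: pair[OF s] mult.commute[of \<mu> t] heatN.heat_op_nonpos)
    qed
    then show ?thesis unfolding integral_complex_of_real J_def integral_mult_right_zero .
  qed
  note eq = this
  have "\<kappa> (2 * s) * J s \<le> l2norm ?M (heatN.green N \<mu> (f s)) * b"
  proof -
    have "\<bar>\<kappa> (2 * s) * J s\<bar> \<le> l2norm ?M (heatN.green N \<mu> (f s)) * b"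
      using L2_Cauchy_Schwarz[OF heatN.green_L2[OF \<mu> f] f, of s s] unfolding eq b_def norm_of_real .
    then show ?thesis by linarith
  qed
  then have "b * J s * b \<le> l2norm ?M (heatN.green N \<mu> (f s)) * b" unfolding b2[symmetric] by (simp add: power2_eq_square mult_ac)
  then have lower: "b * J s \<le> l2norm ?M (heatN.green N \<mu> (f s))" using b0 by (simp add: mult.commute)
  define e where "e = (\<lambda>x. complex_of_real (1 / b) * f s x)"
  have e: "e \<in> L2 ?M" unfolding e_def by (intro L2_scale f)
  have en: "l2norm ?M e = 1" using b0 unfolding e_def l2norm_scale norm_of_real b_def[symmetric] by simp
  have "AE x in ?M. heatN.green N \<mu> e x = complex_of_real (1 / b) * heatN.green N \<mu> (f s) x"
    using heatN.bounded_green[OF \<mu>, of N] f unfolding bounded_op_def e_def by blast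
  then have "l2norm ?M (heatN.green N \<mu> e) = l2norm ?M (\<lambda>x. complex_of_real (1 / b) * heatN.green N \<mu> (f s) x)"
    by (intro l2norm_cong_AE heatN.green_L2 \<mu> e L2_scale f)
  also have "\<dots> = l2norm ?M (heatN.green N \<mu> (f s)) / b" using b0 by (simp only: l2norm_scale norm_of_real) simp
  also have "\<dots> \<ge> J s" using lower b0 by (simp add: field_simps)
  finally have "1 / (- 2 * \<mu>) \<le> l2norm ?M (heatN.green N \<mu> e)" using n by (simp add: s_def)
  also have "\<dots> \<le> op_norm ?M (heatN.green N \<mu>)"
    unfolding op_norm_def
  proof (rule cSUP_upper)
    show "e \<in> {f \<in> L2 ?M. l2norm ?M f \<le> 1}" using e en by simp
    show "bdd_above ((\<lambda>f. l2norm ?M (heatN.green N \<mu> f)) ` {f \<in> L2 ?M. l2norm ?M f \<le> 1})"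
    proof (rule bdd_aboveI2)
      fix g assume "g \<in> {f \<in> L2 ?M. l2norm ?M f \<le> 1}"
      then show "l2norm ?M (heatN.green N \<mu> g) \<le> 1 / - \<mu>"
        using heatN.green_norm[OF \<mu>, of g N] mult_left_mono[of "l2norm ?M g" 1 "1 / - \<mu>"] \<mu> by auto
    qed
  qed
  finally show ?thesis .
qed

section \<open>Heat operators as tensor products\<close>

lemma heat1_L2:
  assumes x: "x \<in> space particle_measure"
  shows "(\<lambda>y. complex_of_real (heat1 t x y)) \<in> L2 particle_measure"
proof -
  have [measurable]: "heat1 t x \<in> borel_measurable particle_measure" using heat1_integrable[OF x] by auto
  have "heat1 t x y \<le> (1 / sqrt (2 * pi * t)) ^ 3" if "0 < t" for y
    using that by (auto simp: heat1_def gauss3_def intro!: mult_left_le)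
  then have le: "(heat1 t x y)\<^sup>2 \<le> (1 / sqrt (2 * pi * t)) ^ 3 * heat1 t x y" if "0 < t" for y
    unfolding power2_eq_square using that by (intro mult_right_mono heat1_nonneg)
  have "integrable particle_measure (\<lambda>y. (heat1 t x y)\<^sup>2)"
  proof (cases "0 < t")
    case True
    show ?thesis
    proof (rule Bochner_Integration.integrable_bound)
      show "integrable particle_measure (\<lambda>y. (1 / sqrt (2 * pi * t)) ^ 3 * heat1 t x y)"
        using heat1_integrable[OF x] by simp
      show "AE y in particle_measure. norm ((heat1 t x y)\<^sup>2) \<le> norm ((1 / sqrt (2 * pi * t)) ^ 3 * heat1 t x y)"
        using le[OF True] by (intro AE_I2) (simp add: order.trans[OF _ abs_ge_self])
    qed measurable
  qed (simp add: heat1_def)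
  then show ?thesis by (simp add: L2_def heat1_nonneg)
qed

lemma bounded_op_scale:
  assumes "bounded_op M A"
  shows "bounded_op M (\<lambda>f x. c * A f x)"
proof -
  obtain C where C: "\<forall>f\<in>L2 M. l2norm M (A f) \<le> C * l2norm M f"
    using assms unfolding bounded_op_def by blast
  show ?thesis
    unfolding bounded_op_def
  proof (intro conjI ballI allI)
    show "(\<lambda>x. c * A f x) \<in> L2 M" if "f \<in> L2 M" for f
      using assms that by (intro L2_scale) (simp add: bounded_op_def)
    show "AE x in M. c * A (\<lambda>y. f y + g y) x = c * A f x + c * A g x" if "f \<in> L2 M" "g \<in> L2 M" for f g
    proof -
      have "AE x in M. A (\<lambda>y. f y + g y) x = A f x + A g x" using assms that by (simp add: bounded_op_def)
      then show ?thesis by eventually_elim (simp add: distrib_left)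
    qed
    show "AE x in M. c * A (\<lambda>y. d * f y) x = d * (c * A f x)" if "f \<in> L2 M" for d f
    proof -
      have "AE x in M. A (\<lambda>y. d * f y) x = d * A f x" using assms that by (simp add: bounded_op_def)
      then show ?thesis by eventually_elim simp
    qed
    show "\<exists>C. \<forall>f\<in>L2 M. l2norm M (\<lambda>x. c * A f x) \<le> C * l2norm M f"
      using C by (intro exI[of _ "cmod c * C"]) (auto simp: l2norm_scale mult.assoc intro!: mult_left_mono)
  qed
qed

text \<open>Kernel and product function both factor over the particles, and so does the integral.
  The scalar is put on particle 0, which exists because 1 \<le> N.\<close>

lemma tensor_product_heat:
  assumes N: "1 \<le> N" and t: "0 < t"
  shows "tensor_product N (\<lambda>i f x. (if i = 0 then c else 1) * heat1.heat_op t f x)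
    (\<lambda>f x. c * heatN.heat_op N t f x)"
  unfolding tensor_product_def
proof (intro conjI allI impI)
  show "bounded_op particle_measure (\<lambda>f x. (if i = 0 then c else 1) * heat1.heat_op t f x)" for i
    by (intro bounded_op_scale heat1.bounded_heat_op)
  show "bounded_op (config_measure N) (\<lambda>f x. c * heatN.heat_op N t f x)"
    by (intro bounded_op_scale heatN.bounded_heat_op)
  fix f :: "nat \<Rightarrow> particle \<Rightarrow> complex"
  assume f: "\<forall>i<N. f i \<in> L2 particle_measure"
  show "AE x in config_measure N. c * heatN.heat_op N t (\<lambda>y. \<Prod>i<N. f i (y i)) x =
      (\<Prod>i<N. (if i = 0 then c else 1) * heat1.heat_op t (f i) (x i))"
  proof (rule AE_I2)
    fix x assume x: "x \<in> space (config_measure N)"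
    have "heatN.heat_op N t (\<lambda>y. \<Prod>i<N. f i (y i)) x =
        (LINT y|config_measure N. (\<Prod>i<N. complex_of_real (heat1 t (x i) (y i)) * f i (y i)))"
      using t by (simp add: heatN.heat_op_def integral_op_def heatN_def prod.distrib)
    also have "\<dots> = (\<Prod>i<N. (LINT y|particle_measure. complex_of_real (heat1 t (x i) y) * f i y))"
      unfolding config_measure_def using f space_configD[OF x]
      by (intro particles.product_integral_prod L2_prod_integrable heat1_L2) auto
    also have "\<dots> = (\<Prod>i<N. heat1.heat_op t (f i) (x i))"
      by (simp add: heat1.heat_op_def integral_op_def)
    finally have "heatN.heat_op N t (\<lambda>y. \<Prod>i<N. f i (y i)) x = (\<Prod>i<N. heat1.heat_op t (f i) (x i))" .
    moreover have "(\<Prod>i<N. (if i = 0 then c else 1)) = c" using N by (simp add: prod.delta)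
    ultimately show "c * heatN.heat_op N t (\<lambda>y. \<Prod>i<N. f i (y i)) x =
        (\<Prod>i<N. (if i = 0 then c else 1) * heat1.heat_op t (f i) (x i))"
      by (simp only: prod.distrib)
  qed
qed

theorem theorem21:
  shows "\<exists>L :: real \<Rightarrow> nat.
    (\<forall>\<epsilon>>0. L \<epsilon> > 0) \<and>
    (\<lambda>\<epsilon>. real (L \<epsilon>)) \<in> O[at_right 0](\<lambda>\<epsilon>. (ln \<epsilon>)\<^sup>2) \<and>
    (\<forall>\<epsilon>>0. \<forall>\<mu><0. \<forall>N\<ge>1.
       \<exists>G. greens_function N \<mu> G \<and>
         (\<exists>F S. separated_representation N (L \<epsilon>) F S \<and>
            op_norm (config_measure N) (\<lambda>f x. G f x - S f x)
              \<le> \<epsilon> * op_norm (config_measure N) G))"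
proof -
  obtain L :: "real \<Rightarrow> nat" where L: "\<forall>\<epsilon>>0. L \<epsilon> > 0" "(\<lambda>\<epsilon>. real (L \<epsilon>)) \<in> O[at_right 0](\<lambda>\<epsilon>. (ln \<epsilon>)\<^sup>2)"
    "\<forall>\<epsilon>>0. \<exists>w \<tau>. (\<forall>j<L \<epsilon>. 0 < \<tau> j) \<and> (\<forall>z\<ge>1::real. \<bar>1 / z - (\<Sum>j<L \<epsilon>. w j * exp (- (z * \<tau> j)))\<bar> \<le> \<epsilon> / 2)"
    using inverse_exp_sum_log_squared by blast
  have "\<exists>G. greens_function N \<mu> G \<and> (\<exists>F S. separated_representation N (L \<epsilon>) F S \<and>
      op_norm (config_measure N) (\<lambda>f x. G f x - S f x) \<le> \<epsilon> * op_norm (config_measure N) G)"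
    if \<epsilon>: "0 < \<epsilon>" and \<mu>: "\<mu> < 0" and N: "1 \<le> N" for \<epsilon> \<mu> :: real and N :: nat
  proof -
    let ?M = "config_measure N"
    let ?G = "heatN.green N \<mu>"
    obtain w \<tau> :: "nat \<Rightarrow> real" where w: "\<forall>j<L \<epsilon>. 0 < \<tau> j"
      "\<forall>z\<ge>1::real. \<bar>1 / z - (\<Sum>j<L \<epsilon>. w j * exp (- (z * \<tau> j)))\<bar> \<le> \<epsilon> / 2"
      using L(3) \<epsilon> by blast
    define m where "m = - \<mu>"
    have m: "0 < m" using \<mu> by (simp add: m_def)
    \<comment> \<open>From z = (s + m) / m: 1 / (s - \<mu>) is 1 / z divided by m, and exp (- z
      \<tau>) is exp (- \<tau>) times exp (- (\<tau> / m) s). The constants join the weight, and the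
      heat time becomes \<tau> / m.\<close>
    define c where "c = (\<lambda>j. w j / m * exp (- \<tau> j))"
    define T where "T = (\<lambda>j. \<tau> j / m)"
    have T: "0 < T j" if "j < L \<epsilon>" for j using w(1) that m by (simp add: T_def)
    define F where "F = (\<lambda>j i f x. (if i = (0::nat) then complex_of_real (c j) else 1) * heat1.heat_op (T j) f x)"
    define S where "S = (\<lambda>f x. \<Sum>j<L \<epsilon>. complex_of_real (c j) * heatN.heat_op N (T j) f x)"
    have sep: "separated_representation N (L \<epsilon>) F S"
      unfolding separated_representation_def F_def S_def
      using tensor_product_heat[OF N T]
      by (intro exI[of _ "\<lambda>j f x. complex_of_real (c j) * heatN.heat_op N (T j) f x"]) simp
    have mult: "\<bar>1 / (s - \<mu>) - (\<Sum>j<L \<epsilon>. c j * exp (- (T j * s)))\<bar> \<le> \<epsilon> / (2 * m)" if s: "0 \<le> s" for s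
    proof -
      define z where "z = (s + m) / m"
      have z: "1 \<le> z" using s m by (simp add: z_def)
      have "1 / (s - \<mu>) = 1 / m * (1 / z)" using m s by (simp add: z_def m_def)
      moreover have "(\<Sum>j<L \<epsilon>. c j * exp (- (T j * s))) = 1 / m * (\<Sum>j<L \<epsilon>. w j * exp (- (z * \<tau> j)))"
        unfolding sum_distrib_left
      proof (intro sum.cong refl)
        fix j
        have "- \<tau> j + - (T j * s) = - (z * \<tau> j)" using m by (simp add: T_def z_def field_simps)
        then have "exp (- \<tau> j) * exp (- (T j * s)) = exp (- (z * \<tau> j))" by (simp only: exp_add[symmetric])
        then show "c j * exp (- (T j * s)) = 1 / m * (w j * exp (- (z * \<tau> j)))"
          by (simp add: c_def mult.assoc)
      qed
      ultimately have "1 / (s - \<mu>) - (\<Sum>j<L \<epsilon>. c j * exp (- (T j * s))) = 1 / m * (1 / z - (\<Sum>j<L \<epsilon>. w j * exp (- (z * \<tau> j))))"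
        by (simp only: right_diff_distrib)
      then have "\<bar>1 / (s - \<mu>) - (\<Sum>j<L \<epsilon>. c j * exp (- (T j * s)))\<bar> = 1 / m * \<bar>1 / z - (\<Sum>j<L \<epsilon>. w j * exp (- (z * \<tau> j)))\<bar>"
        using m by (simp only: abs_mult) simp
      also have "\<dots> \<le> 1 / m * (\<epsilon> / 2)" using w(2) z m by (intro mult_left_mono) auto
      finally show ?thesis by (simp add: mult.commute)
    qed
    have "op_norm ?M (\<lambda>f x. ?G f x - S f x) \<le> \<epsilon> / (2 * m)"
      unfolding op_norm_def
    proof (rule cSUP_least)
      have "(\<lambda>_. 0) \<in> {f \<in> L2 ?M. l2norm ?M f \<le> 1}" by (simp add: L2_def l2norm_def)
      then show "{f \<in> L2 ?M. l2norm ?M f \<le> 1} \<noteq> {}" by blast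
      fix f assume f: "f \<in> {f \<in> L2 ?M. l2norm ?M f \<le> 1}"
      have "l2norm ?M (\<lambda>x. ?G f x - S f x) \<le> \<epsilon> / (2 * m) * l2norm ?M f"
        unfolding S_def using f \<epsilon> m by (intro heatN.multiplier_bound[OF \<mu> T _ mult]) auto
      also have "\<dots> \<le> \<epsilon> / (2 * m) * 1" using f \<epsilon> m by (intro mult_left_mono) auto
      finally show "l2norm ?M (\<lambda>x. ?G f x - S f x) \<le> \<epsilon> / (2 * m)" by simp
    qed
    also have "\<dots> = \<epsilon> * (1 / (- 2 * \<mu>))" by (simp add: m_def)
    \<comment> \<open>Here the absolute error becomes relative: the scalar error \<epsilon> / 2 and
      the lower bound by half of 1 / - \<mu> combine to \<epsilon>.\<close>
    also have "\<dots> \<le> \<epsilon> * op_norm ?M ?G" using green_norm_lower[OF \<mu>] \<epsilon> by (intro mult_left_mono) auto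
    finally show ?thesis using greens_function_green[OF \<mu>] sep by blast
  qed
  then show ?thesis using L(1,2) by blast
qed

end
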